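(* Let $X\subseteq\mathbb{R}^d$ be open, let $w\in C^\infty(X)$, and let $\psi:X\to X$ be smooth and injective with $\det J\psi(x)\neq 0$ for all $x\in X$. Assume moreover that $\{x\in X:\ w(x)\neq 0\}$ is dense in $X$. Then the following are equivalent: (i) The weighted composition operator $C_{w,\psi}$ is topologizable on $\mathscr{D}'(X)$. (ii) $\psi$ has stable orbits.
   Context: Notation. $\mathbb{N}=\{1,2,\dots\}$. $J\psi(x)$ is the Jacobian matrix of $\psi$ at $x$; $\psi^m$ is the $m$-th iterate of $\psi$. $\mathscr{D}(X)$ is the space of compactly supported smooth (complex-valued) functions on $X$ with its standard locally convex (inductive limit) topology, and $\mathscr{D}'(X)$ is the space of distributions on $X$, equipped with the strong dual topology (uniform convergence on bounded subsets of $\mathscr{D}(X)$). Weighted composition operator: for $w\in C^\infty(X)$ and smooth $\psi:X\to X$ with $\det J\psi(x)\ne0$ for all $x\in X$, $C_{w,\psi}$ is the unique continuous linear operator on $\mathscr{D}'(X)$ extending $C(X)\ni f\mapsto w\cdot(f\circ\psi)$. For injective $\psi$ it is given by $\langle C_{w,\psi}(u),\varphi\rangle=\langle u,(\varphi\, w/|\det J\psi|)\circ\psi^{-1}\rangle$ for $\varphi\in\mathscr{D}(X)$, where the function on $\psi(X)$ is extended by zero to $X$. Topologizable: a continuous linear operator $T$ on a locally convex space $E$ is topologizable if for every continuous seminorm $p$ on $E$ there is a continuous seminorm $q$ on $E$ such that for all $m\in\mathbb{N}$ there is $\gamma_m>0$ with $p(T^m(x))\le\gamma_m q(x)$ for all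 $x\in E$. Stable orbits: a continuous map $\psi:X\to X$ has stable orbits if for every compact $K\subseteq X$ there is a compact $L\subseteq X$ with $\psi^m(K)\subseteq L$ for every $m\in\mathbb{N}$. *)

theory Defs
  imports "HOL-Analysis.Analysis"
begin

section \<open>Locally convex spaces of complex-valued functions\<close>

text \<open>Vector spaces are subsets \<open>E\<close> of \<open>'a \<Rightarrow> complex\<close> with the pointwise operations. This covers both
  test functions (\<open>'a = real^'n\<close>) and distributions (\<open>'a\<close> = the type of test functions).\<close>

definition seminorm_on :: "('a \<Rightarrow> complex) set \<Rightarrow> (('a \<Rightarrow> complex) \<Rightarrow> real) \<Rightarrow> bool" where
  "seminorm_on E p \<longleftrightarrow>
     (\<forall>f\<in>E. 0 \<le> p f) \<and>
     (\<forall>f\<in>E. \<forall>c. p (\<lambda>x. c * f x) = cmod c * p f) \<and>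
     (\<forall>f\<in>E. \<forall>g\<in>E. p (\<lambda>x. f x + g x) \<le> p f + p g)"

text \<open>The locally convex topology on \<open>E\<close> generated by a family \<open>P\<close> of seminorms, which need not be
  directed: basic neighbourhoods are finite intersections of balls.\<close>

definition lc_topology ::
  "('a \<Rightarrow> complex) set \<Rightarrow> (('a \<Rightarrow> complex) \<Rightarrow> real) set \<Rightarrow> ('a \<Rightarrow> complex) topology" where
  "lc_topology E P = topology (\<lambda>U. U \<subseteq> E \<and>
     (\<forall>f\<in>U. \<exists>Q \<epsilon>. finite Q \<and> Q \<subseteq> P \<and> \<epsilon> > 0 \<and>
        {g \<in> E. \<forall>p\<in>Q. p (\<lambda>x. g x - f x) < \<epsilon>} \<subseteq> U))"

lemma openin_lc_topology:
  "openin (lc_topology E P) U \<longleftrightarrow> U \<subseteq> E \<and>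
     (\<forall>f\<in>U. \<exists>Q \<epsilon>. finite Q \<and> Q \<subseteq> P \<and> \<epsilon> > 0 \<and>
        {g \<in> E. \<forall>p\<in>Q. p (\<lambda>x. g x - f x) < \<epsilon>} \<subseteq> U)"
proof -
  define N where "N Q \<epsilon> f = {g \<in> E. \<forall>p\<in>Q. p (\<lambda>x. g x - f x) < \<epsilon>}" for Q f and \<epsilon> :: real
  define ok where "ok U f \<longleftrightarrow> (\<exists>Q \<epsilon>. finite Q \<and> Q \<subseteq> P \<and> \<epsilon> > 0 \<and> N Q \<epsilon> f \<subseteq> U)" for U f
  have mono: "ok V f" if "ok U f" "U \<subseteq> V" for U V f
    using that unfolding ok_def by (meson order_trans)
  have int: "ok (U \<inter> V) f" if U: "ok U f" and V: "ok V f" for U V f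
  proof -
    obtain Q1 e1 where 1: "finite Q1" "Q1 \<subseteq> P" "e1 > 0" "N Q1 e1 f \<subseteq> U"
      using U unfolding ok_def by blast
    obtain Q2 e2 where 2: "finite Q2" "Q2 \<subseteq> P" "e2 > 0" "N Q2 e2 f \<subseteq> V"
      using V unfolding ok_def by blast
    have "N (Q1 \<union> Q2) (min e1 e2) f \<subseteq> N Q1 e1 f \<inter> N Q2 e2 f"
      unfolding N_def by (rule subsetI) simp
    also have "\<dots> \<subseteq> U \<inter> V"
      using 1(4) 2(4) by (rule Int_mono)
    finally show ?thesis
      unfolding ok_def using 1(1-3) 2(1-3)
      by (intro exI[of _ "Q1 \<union> Q2"] exI[of _ "min e1 e2"] conjI) simp_all
  qed
  have "istopology (\<lambda>U. U \<subseteq> E \<and> (\<forall>f\<in>U. ok U f))"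
    unfolding istopology_def
  proof (intro conjI allI impI)
    fix S T :: "('a \<Rightarrow> complex) set"
    assume S: "S \<subseteq> E \<and> (\<forall>f\<in>S. ok S f)" and T: "T \<subseteq> E \<and> (\<forall>f\<in>T. ok T f)"
    show "S \<inter> T \<subseteq> E" using S by blast
    show "\<forall>f\<in>S \<inter> T. ok (S \<inter> T) f" using S T int by simp
  next
    fix \<K> :: "('a \<Rightarrow> complex) set set"
    assume K: "\<forall>K\<in>\<K>. K \<subseteq> E \<and> (\<forall>f\<in>K. ok K f)"
    show "\<Union>\<K> \<subseteq> E" using K by blast
    show "\<forall>f\<in>\<Union>\<K>. ok (\<Union>\<K>) f"
    proof
      fix f assume "f \<in> \<Union>\<K>"
      then obtain K where "K \<in> \<K>" "f \<in> K" by blast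
      then show "ok (\<Union>\<K>) f" using K mono[of K f "\<Union>\<K>"] by blast
    qed
  qed
  then have "openin (lc_topology E P) U \<longleftrightarrow> U \<subseteq> E \<and> (\<forall>f\<in>U. ok U f)"
    unfolding lc_topology_def N_def[symmetric] ok_def[symmetric]
    by (simp only: topology_inverse')
  then show ?thesis
    unfolding ok_def N_def .
qed

lemma topspace_lc_topology: "topspace (lc_topology E P) = E"
proof -
  have "openin (lc_topology E P) E"
    unfolding openin_lc_topology
  proof (intro conjI ballI order_refl)
    fix f assume "f \<in> E"
    show "\<exists>Q \<epsilon>. finite Q \<and> Q \<subseteq> P \<and> \<epsilon> > 0 \<and>
        {g \<in> E. \<forall>p\<in>Q. p (\<lambda>x. g x - f x) < \<epsilon>} \<subseteq> E"
      by (rule exI[of _ "{}"], rule exI[of _ "1::real"]) simp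
  qed
  moreover have "U \<subseteq> E" if "openin (lc_topology E P) U" for U
    using that unfolding openin_lc_topology by (rule conjunct1)
  ultimately show ?thesis
    by (meson openin_subset openin_topspace subset_antisym)
qed

definition continuous_seminorm ::
  "('a \<Rightarrow> complex) topology \<Rightarrow> (('a \<Rightarrow> complex) \<Rightarrow> real) \<Rightarrow> bool" where
  "continuous_seminorm \<tau> p \<longleftrightarrow>
     seminorm_on (topspace \<tau>) p \<and> continuous_map \<tau> euclideanreal p"

definition lc_bounded :: "('a \<Rightarrow> complex) topology \<Rightarrow> ('a \<Rightarrow> complex) set \<Rightarrow> bool" where
  "lc_bounded \<tau> B \<longleftrightarrow>
     B \<subseteq> topspace \<tau> \<and> (\<forall>p. continuous_seminorm \<tau> p \<longrightarrow> bdd_above (p ` B))"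

definition continuous_linear_operator ::
  "('a \<Rightarrow> complex) topology \<Rightarrow> (('a \<Rightarrow> complex) \<Rightarrow> ('a \<Rightarrow> complex)) \<Rightarrow> bool" where
  "continuous_linear_operator \<tau> T \<longleftrightarrow>
     continuous_map \<tau> \<tau> T \<and>
     (\<forall>f\<in>topspace \<tau>. \<forall>c. T (\<lambda>x. c * f x) = (\<lambda>x. c * T f x)) \<and>
     (\<forall>f\<in>topspace \<tau>. \<forall>g\<in>topspace \<tau>. T (\<lambda>x. f x + g x) = (\<lambda>x. T f x + T g x))"

definition topologizable ::
  "('a \<Rightarrow> complex) topology \<Rightarrow> (('a \<Rightarrow> complex) \<Rightarrow> ('a \<Rightarrow> complex)) \<Rightarrow> bool" where
  "topologizable \<tau> T \<longleftrightarrow>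
     continuous_linear_operator \<tau> T \<and>
     (\<forall>p. continuous_seminorm \<tau> p \<longrightarrow>
        (\<exists>q. continuous_seminorm \<tau> q \<and>
           (\<forall>m\<ge>1. \<exists>\<gamma>>0. \<forall>x\<in>topspace \<tau>. p ((T ^^ m) x) \<le> \<gamma> * q x)))"


section \<open>Smooth functions, test functions and distributions\<close>

primrec iter_partial ::
  "'n list \<Rightarrow> (real^'n \<Rightarrow> 'b::real_normed_vector) \<Rightarrow> real^'n \<Rightarrow> 'b" where
  "iter_partial [] f = f"
| "iter_partial (i # is) f =
     (\<lambda>x. frechet_derivative (iter_partial is f) (at x) (axis i 1))"

text \<open>For open \<open>X\<close> this is $C^\infty(X)$: all iterated partial derivatives exist and are differentiable,
  hence continuous. Values outside \<open>X\<close> are irrelevant.\<close>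

definition smooth_on :: "(real^'n) set \<Rightarrow> (real^'n \<Rightarrow> 'b::real_normed_vector) \<Rightarrow> bool" where
  "smooth_on X f \<longleftrightarrow> (\<forall>is. iter_partial is f differentiable_on X)"

definition test_functions_in :: "(real^'n) set \<Rightarrow> (real^'n \<Rightarrow> complex) set" where
  "test_functions_in K = {\<phi>. smooth_on UNIV \<phi> \<and> (\<forall>x. x \<notin> K \<longrightarrow> \<phi> x = 0)}"

definition test_topology_in :: "(real^'n) set \<Rightarrow> (real^'n \<Rightarrow> complex) topology" where
  "test_topology_in K = lc_topology (test_functions_in K)
     {\<lambda>\<phi>. SUP x. cmod (iter_partial is \<phi> x) | is. True}"

text \<open>A test function on \<open>X\<close> is identified with its extension by zero to the whole space.\<close>

definition test_functions :: "(real^'n) set \<Rightarrow> (real^'n \<Rightarrow> complex) set" where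
  "test_functions X = (\<Union>K\<in>{K. compact K \<and> K \<subseteq> X}. test_functions_in K)"

text \<open>The inductive limit topology: the finest locally convex topology making all inclusions of the
  spaces \<open>test_functions_in K\<close> continuous. It is generated by all seminorms whose restrictions to
  these spaces are continuous.\<close>

definition test_topology :: "(real^'n) set \<Rightarrow> (real^'n \<Rightarrow> complex) topology" where
  "test_topology X = lc_topology (test_functions X)
     {p. seminorm_on (test_functions X) p \<and>
         (\<forall>K. compact K \<and> K \<subseteq> X \<longrightarrow> continuous_map (test_topology_in K) euclideanreal p)}"

text \<open>Functionals are extended by zero outside the test functions, so that equality of distributions
  is equality of HOL functions.\<close>

definition distributions :: "(real^'n) set \<Rightarrow> ((real^'n \<Rightarrow> complex) \<Rightarrow> complex) set" where
  "distributions X = {u.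
     (\<forall>\<phi>\<in>test_functions X. \<forall>c. u (\<lambda>x. c * \<phi> x) = c * u \<phi>) \<and>
     (\<forall>\<phi>\<in>test_functions X. \<forall>\<eta>\<in>test_functions X. u (\<lambda>x. \<phi> x + \<eta> x) = u \<phi> + u \<eta>) \<and>
     continuous_map (test_topology X) euclidean u \<and>
     (\<forall>\<phi>. \<phi> \<notin> test_functions X \<longrightarrow> u \<phi> = 0)}"

text \<open>The empty set is excluded because \<open>Sup {}\<close> is unspecified on the reals.\<close>

definition strong_topology :: "(real^'n) set \<Rightarrow> ((real^'n \<Rightarrow> complex) \<Rightarrow> complex) topology" where
  "strong_topology X = lc_topology (distributions X)
     {\<lambda>u. SUP \<phi>\<in>B. cmod (u \<phi>) | B. lc_bounded (test_topology X) B \<and> B \<noteq> {}}"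

definition distribution_of ::
  "(real^'n) set \<Rightarrow> (real^'n \<Rightarrow> complex) \<Rightarrow> (real^'n \<Rightarrow> complex) \<Rightarrow> complex" where
  "distribution_of X f =
     (\<lambda>\<phi>. if \<phi> \<in> test_functions X then LINT x:X|lebesgue. f x * \<phi> x else 0)"


section \<open>Weighted composition operators and stable orbits\<close>

text \<open>The unique continuous linear operator on the distributions extending
  $C(X) \ni f \mapsto w \cdot (f \circ \psi)$. Membership in \<open>extensional\<close> only fixes the irrelevant values
  outside \<open>distributions X\<close>.\<close>

definition weighted_composition_operator ::
  "(real^'n) set \<Rightarrow> (real^'n \<Rightarrow> complex) \<Rightarrow> (real^'n \<Rightarrow> real^'n) \<Rightarrow>
   ((real^'n \<Rightarrow> complex) \<Rightarrow> complex) \<Rightarrow> ((real^'n \<Rightarrow> complex) \<Rightarrow> complex)" where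
  "weighted_composition_operator X w \<psi> = (THE T.
     T \<in> extensional (distributions X) \<and>
     continuous_linear_operator (strong_topology X) T \<and>
     (\<forall>f. continuous_on X f \<longrightarrow>
        T (distribution_of X f) = distribution_of X (\<lambda>x. w x * f (\<psi> x))))"

definition stable_orbits :: "'a::topological_space set \<Rightarrow> ('a \<Rightarrow> 'a) \<Rightarrow> bool" where
  "stable_orbits X \<psi> \<longleftrightarrow>
     (\<forall>K. compact K \<and> K \<subseteq> X \<longrightarrow>
        (\<exists>L. compact L \<and> L \<subseteq> X \<and> (\<forall>m\<ge>1. (\<psi> ^^ m) ` K \<subseteq> L)))"

end

theory Submission
  imports Defs
begin

text \<open>Let \<open>\<theta>\<close> be the inverse of \<open>\<psi>\<close> on the open set \<open>Y = \<psi> ` X\<close>, and put \<open>v = w / \<bar>det J\<psi>\<bar>\<close>. The weighted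
  composition operator is the transpose of \<open>S \<phi> = (v \<phi>) \<circ> \<theta>\<close>, extended by zero off \<open>Y\<close>: it maps \<open>u\<close> to
  \<open>\<phi> \<mapsto> u (S \<phi>)\<close>. So its \<open>m\<close>-th power is governed by \<open>S\<^sup>m\<close>, which maps test functions on \<open>K\<close> to test
  functions on \<open>\<psi>\<^sup>m(K)\<close>.

  Continuous seminorms on distributions are dominated by suprema over bounded sets of test functions
  (\<open>strong_seminorm_bound\<close>), and a set of test functions is bounded iff it lives on one compact set and
  all its derivatives are uniformly bounded (\<open>lc_bounded_test_topology_iff\<close>).

  \<^emph>\<open>Stable orbits suffice.\<close> If \<open>\<psi>\<^sup>m(K) \<subseteq> L\<close> for all \<open>m\<close> and \<open>B\<close> is a bounded set of test functions on \<open>K\<close>,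
  all the sets \<open>S\<^sup>m B\<close> are bounded in the metrizable space of test functions on \<open>L\<close>. Countably many
  bounded sets of a metrizable space are absorbed by a single one \<open>B'\<close>
  (\<open>countably_many_bounded_sets_absorbed\<close>), and the supremum over \<open>B'\<close> is a seminorm that serves all
  powers at once.

  \<^emph>\<open>Stable orbits are necessary.\<close> Take the seminorm \<open>u \<mapsto> \<bar>u \<phi>\<bar>\<close> for a bump function \<open>\<phi>\<close>. The seminorm
  provided by topologizability is dominated by a supremum over test functions on some compact \<open>L\<close>.
  Evaluation at a point outside \<open>L\<close> annihilates these, hence all \<open>S\<^sup>m \<phi>\<close> with \<open>m \<ge> 1\<close> vanish outside \<open>L\<close>.
  But \<open>S\<^sup>m \<phi> (\<psi>\<^sup>m x) = v(x) v(\<psi> x) \<dots> v(\<psi>\<^sup>m\<^sup>-\<^sup>1 x) \<phi>(x)\<close> is nonzero for a dense set of \<open>x\<close> in the ball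
  \<open>{\<phi> \<noteq> 0}\<close>, as the iterates of \<open>\<psi>\<close> are open maps (\<open>nonvanishing_along_orbit_dense\<close>). So \<open>\<psi>\<^sup>m\<close> maps the
  whole ball into \<open>L\<close>, and finitely many such balls cover a compact set.

  The operator is only given as the unique continuous linear extension of \<open>f \<mapsto> w \<cdot> (f \<circ> \<psi>)\<close>. The
  transpose of \<open>S\<close> is such an extension by the change of variables formula and by the continuity of \<open>S\<close>,
  which rests on derivatives of \<open>S \<phi>\<close> being differential operators applied to \<open>\<phi>\<close>, composed with \<open>\<theta>\<close>
  (\<open>iter_partial_transport\<close>). It is the only one because continuous functions are dense in the strong
  dual (\<open>continuous_functions_strongly_dense\<close>), by regularization.\<close>

section \<open>Seminorms and the topologies they generate\<close>

definition fun_subspace :: "('a \<Rightarrow> complex) set \<Rightarrow> bool" where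
  "fun_subspace E \<longleftrightarrow> (\<lambda>x. 0) \<in> E \<and> (\<forall>f\<in>E. \<forall>c. (\<lambda>x. c * f x) \<in> E) \<and>
     (\<forall>f\<in>E. \<forall>g\<in>E. (\<lambda>x. f x + g x) \<in> E)"

lemma fun_subspace_0: "fun_subspace E \<Longrightarrow> (\<lambda>x. 0) \<in> E"
  and fun_subspace_scale: "fun_subspace E \<Longrightarrow> f \<in> E \<Longrightarrow> (\<lambda>x. c * f x) \<in> E"
  and fun_subspace_add: "fun_subspace E \<Longrightarrow> f \<in> E \<Longrightarrow> g \<in> E \<Longrightarrow> (\<lambda>x. f x + g x) \<in> E"
  unfolding fun_subspace_def by auto

lemma fun_subspace_diff:
  assumes "fun_subspace E" "f \<in> E" "g \<in> E"
  shows "(\<lambda>x. f x - g x) \<in> E"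
proof -
  have "(\<lambda>x. f x + (-1) * g x) \<in> E"
    using assms by (intro fun_subspace_add fun_subspace_scale)
  then show ?thesis by simp
qed

lemma fun_subspace_sum:
  assumes "fun_subspace E" "\<And>i. i \<in> I \<Longrightarrow> f i \<in> E"
  shows "(\<lambda>x. \<Sum>i\<in>I. f i x) \<in> E"
  using assms(2)
proof (induction I rule: infinite_finite_induct)
  case (insert i I)
  then show ?case using fun_subspace_add[OF assms(1)] by simp
qed (auto intro: fun_subspace_0[OF assms(1)])

lemma seminorm_nonneg: "seminorm_on E p \<Longrightarrow> f \<in> E \<Longrightarrow> 0 \<le> p f"
  and seminorm_scale: "seminorm_on E p \<Longrightarrow> f \<in> E \<Longrightarrow> p (\<lambda>x. c * f x) = cmod c * p f"
  and seminorm_add: "seminorm_on E p \<Longrightarrow> f \<in> E \<Longrightarrow> g \<in> E \<Longrightarrow> p (\<lambda>x. f x + g x) \<le> p f + p g"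
  unfolding seminorm_on_def by auto

lemma seminorm_zero:
  assumes "fun_subspace E" "seminorm_on E p"
  shows "p (\<lambda>x. 0) = 0"
  using seminorm_scale[OF assms(2) fun_subspace_0[OF assms(1)], of 0] by simp

lemma seminorm_diff_le:
  assumes E: "fun_subspace E" and p: "seminorm_on E p" and fg: "f \<in> E" "g \<in> E"
  shows "\<bar>p f - p g\<bar> \<le> p (\<lambda>x. f x - g x)"
proof -
  have d: "(\<lambda>x. f x - g x) \<in> E" "(\<lambda>x. g x - f x) \<in> E"
    using fun_subspace_diff E fg by blast+
  have "p f \<le> p (\<lambda>x. f x - g x) + p g"
    using seminorm_add[OF p d(1) fg(2)] by simp
  moreover have "p g \<le> p (\<lambda>x. g x - f x) + p f"
    using seminorm_add[OF p d(2) fg(1)] by simp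
  moreover have "p (\<lambda>x. g x - f x) = p (\<lambda>x. f x - g x)"
    using seminorm_scale[OF p d(1), of "-1"] by simp
  ultimately show ?thesis by linarith
qed

lemma seminorm_on_subset: "seminorm_on E p \<Longrightarrow> F \<subseteq> E \<Longrightarrow> seminorm_on F p"
  unfolding seminorm_on_def by blast

lemma seminorm_on_cmod_linear:
  assumes "\<And>f c. f \<in> E \<Longrightarrow> u (\<lambda>x. c * f x) = c * u f"
    and "\<And>f g. f \<in> E \<Longrightarrow> g \<in> E \<Longrightarrow> u (\<lambda>x. f x + g x) = u f + u g"
  shows "seminorm_on E (\<lambda>f. cmod (u f))"
  unfolding seminorm_on_def using assms by (auto simp: norm_mult norm_triangle_ineq)

lemma linear_form_diff:
  assumes E: "fun_subspace E" and fg: "f \<in> E" "g \<in> E"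
    and u: "\<And>f c. f \<in> E \<Longrightarrow> u (\<lambda>x. c * f x) = (c::complex) * u f"
      "\<And>f g. f \<in> E \<Longrightarrow> g \<in> E \<Longrightarrow> u (\<lambda>x. f x + g x) = u f + u g"
  shows "u (\<lambda>x. f x - g x) = u f - u g"
  using u(2)[OF fg(1) fun_subspace_scale[OF E fg(2), of "-1"]] u(1)[OF fg(2), of "-1"] by simp

lemma linear_form_zero:
  assumes E: "fun_subspace E" and u: "\<And>f c. f \<in> E \<Longrightarrow> u (\<lambda>x. c * f x) = (c::complex) * u f"
  shows "u (\<lambda>x. 0) = 0"
  using u[OF fun_subspace_0[OF E], of 0] by simp

lemma linear_form_sum:
  assumes E: "fun_subspace E" and f: "\<And>i. i \<in> I \<Longrightarrow> f i \<in> E"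
    and u: "\<And>f c. f \<in> E \<Longrightarrow> u (\<lambda>x. c * f x) = (c::complex) * u f"
      "\<And>f g. f \<in> E \<Longrightarrow> g \<in> E \<Longrightarrow> u (\<lambda>x. f x + g x) = u f + u g"
  shows "u (\<lambda>x. \<Sum>i\<in>I. c i * f i x) = (\<Sum>i\<in>I. c i * u (f i))"
  using f
proof (induction I rule: infinite_finite_induct)
  case (insert i I)
  have "(\<lambda>x. c i * f i x) \<in> E" "(\<lambda>x. \<Sum>i\<in>I. c i * f i x) \<in> E"
    using insert.prems by (auto intro!: fun_subspace_scale[OF E] fun_subspace_sum[OF E])
  then have "u (\<lambda>x. c i * f i x + (\<Sum>i\<in>I. c i * f i x)) = u (\<lambda>x. c i * f i x) + u (\<lambda>x. \<Sum>i\<in>I. c i * f i x)"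
    by (rule u(2))
  then show ?case using insert u(1)[of "f i"] by simp
qed (simp_all add: linear_form_zero[OF E u(1)])

text \<open>The quantitative form of continuity of a seminorm.\<close>

definition dominated_by ::
  "('a \<Rightarrow> complex) set \<Rightarrow> (('a \<Rightarrow> complex) \<Rightarrow> real) set \<Rightarrow> (('a \<Rightarrow> complex) \<Rightarrow> real) \<Rightarrow> bool" where
  "dominated_by E P p \<longleftrightarrow>
     (\<exists>Q C. finite Q \<and> Q \<subseteq> P \<and> C > 0 \<and> (\<forall>f\<in>E. p f \<le> C * (\<Sum>q\<in>Q. q f)))"

lemma dominated_byI:
  assumes "finite Q" "Q \<subseteq> P" "\<And>q f. q \<in> P \<Longrightarrow> f \<in> E \<Longrightarrow> 0 \<le> q f"
    "\<And>f. f \<in> E \<Longrightarrow> p f \<le> C * (\<Sum>q\<in>Q. q f)"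
  shows "dominated_by E P p"
  unfolding dominated_by_def
proof (intro exI conjI ballI)
  fix f assume f: "f \<in> E"
  have "0 \<le> (\<Sum>q\<in>Q. q f)" using assms f by (intro sum_nonneg) auto
  then have "C * (\<Sum>q\<in>Q. q f) \<le> (\<bar>C\<bar> + 1) * (\<Sum>q\<in>Q. q f)"
    by (intro mult_right_mono) linarith+
  then show "p f \<le> (\<bar>C\<bar> + 1) * (\<Sum>q\<in>Q. q f)" using assms(4)[OF f] by linarith
qed (use assms in auto)

lemma dominated_by_member:
  assumes "q \<in> P"
  shows "dominated_by E P q"
  unfolding dominated_by_def
  using assms by (intro exI[of _ "{q}"] exI[of _ 1]) auto

text \<open>This transfers dominated seminorms back to basic neighbourhoods, whose radii the constants of
  the domination determine.\<close>

lemma dominated_imp_neighbourhood: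
  assumes P: "\<And>q. q \<in> P \<Longrightarrow> seminorm_on E q" and E: "fun_subspace E"
    and R: "finite R" "\<And>r. r \<in> R \<Longrightarrow> dominated_by E P r" and e: "e > 0"
  shows "\<exists>Q \<epsilon>. finite Q \<and> Q \<subseteq> P \<and> \<epsilon> > 0 \<and>
    (\<forall>f\<in>E. (\<forall>q\<in>Q. q f < \<epsilon>) \<longrightarrow> (\<forall>r\<in>R. r f < e))"
proof -
  have "\<exists>Q \<epsilon>. finite Q \<and> Q \<subseteq> P \<and> \<epsilon> > 0 \<and> (\<forall>f\<in>E. (\<forall>q\<in>Q. q f < \<epsilon>) \<longrightarrow> r f < e)" if r: "r \<in> R" for r
  proof -
    obtain Q C where Q: "finite Q" "Q \<subseteq> P" "C > 0" "\<And>f. f \<in> E \<Longrightarrow> r f \<le> C * (\<Sum>q\<in>Q. q f)"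
      using R(2)[OF r] unfolding dominated_by_def by blast
    define \<epsilon> where "\<epsilon> = e / (C * (1 + real (card Q)))"
    have eps: "\<epsilon> > 0" unfolding \<epsilon>_def using e Q(3) by simp
    have "r f < e" if f: "f \<in> E" and small: "\<forall>q\<in>Q. q f < \<epsilon>" for f
    proof -
      have "(\<Sum>q\<in>Q. q f) \<le> real (card Q) * \<epsilon>"
        using small by (intro sum_bounded_above) (auto intro: less_imp_le)
      also have "\<dots> < (1 + real (card Q)) * \<epsilon>" using eps by simp
      finally have "C * (\<Sum>q\<in>Q. q f) < C * ((1 + real (card Q)) * \<epsilon>)"
        using Q(3) by (rule mult_strict_left_mono)
      also have "\<dots> = C * (1 + real (card Q)) * \<epsilon>" by simp
      also have "\<dots> = e"
        unfolding \<epsilon>_def using Q(3) by (simp add: add_nonneg_eq_0_iff del: distrib_left_numeral)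
      finally show ?thesis using Q(4)[OF f] by linarith
    qed
    then show ?thesis using Q(1,2) eps by blast
  qed
  then obtain Qf ef where Qf: "\<And>r. r \<in> R \<Longrightarrow> finite (Qf r) \<and> Qf r \<subseteq> P \<and> ef r > 0 \<and>
      (\<forall>f\<in>E. (\<forall>q\<in>Qf r. q f < ef r) \<longrightarrow> r f < e)"
    by metis
  define \<epsilon> where "\<epsilon> = Min (insert 1 (ef ` R))"
  show ?thesis
  proof (intro exI[of _ "\<Union>r\<in>R. Qf r"] exI[of _ \<epsilon>] conjI ballI impI)
    show "finite (\<Union>r\<in>R. Qf r)" "(\<Union>r\<in>R. Qf r) \<subseteq> P" using R(1) Qf by auto
    show "\<epsilon> > 0" unfolding \<epsilon>_def using R(1) Qf by auto
    have le: "\<epsilon> \<le> ef r" if "r \<in> R" for r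
      unfolding \<epsilon>_def using R(1) that by (intro Min_le) auto
    show "r f < e" if f: "f \<in> E" and small: "\<forall>q\<in>\<Union>r\<in>R. Qf r. q f < \<epsilon>" and r: "r \<in> R" for f r
    proof -
      have "\<forall>q\<in>Qf r. q f < ef r" using small r le[OF r] by fastforce
      then show ?thesis using Qf[OF r] f by blast
    qed
  qed
qed

text \<open>Openness of a preimage may be tested with dominated seminorms in place of generators. The
  continuity of seminorms, linear forms and linear operators is obtained from this criterion.\<close>

lemma open_preimage_lc:
  assumes P: "\<And>q. q \<in> P \<Longrightarrow> seminorm_on E q" and E: "fun_subspace E"
    and T: "\<And>f. f \<in> E \<Longrightarrow> T f \<in> U \<Longrightarrow> \<exists>R e. finite R \<and> e > 0 \<and> (\<forall>r\<in>R. dominated_by E P r) \<and>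
      (\<forall>g\<in>E. (\<forall>r\<in>R. r (\<lambda>x. g x - f x) < e) \<longrightarrow> T g \<in> U)"
  shows "openin (lc_topology E P) {f \<in> E. T f \<in> U}"
  unfolding openin_lc_topology
proof (intro conjI ballI)
  fix f assume "f \<in> {f \<in> E. T f \<in> U}"
  then have f: "f \<in> E" "T f \<in> U" by auto
  obtain R e where R: "finite R" "e > 0" "\<forall>r\<in>R. dominated_by E P r"
      "\<forall>g\<in>E. (\<forall>r\<in>R. r (\<lambda>x. g x - f x) < e) \<longrightarrow> T g \<in> U"
    using T[OF f] by blast
  have "\<exists>Q \<epsilon>. finite Q \<and> Q \<subseteq> P \<and> \<epsilon> > 0 \<and>
      (\<forall>f\<in>E. (\<forall>q\<in>Q. q f < \<epsilon>) \<longrightarrow> (\<forall>r\<in>R. r f < e))"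
    by (rule dominated_imp_neighbourhood) (use P E R(1-3) in auto)
  then obtain Q \<epsilon> where Q: "finite Q" "Q \<subseteq> P" "\<epsilon> > 0"
      "\<And>f. f \<in> E \<Longrightarrow> \<forall>q\<in>Q. q f < \<epsilon> \<Longrightarrow> \<forall>r\<in>R. r f < e"
    by meson
  have "{g \<in> E. \<forall>q\<in>Q. q (\<lambda>x. g x - f x) < \<epsilon>} \<subseteq> {f \<in> E. T f \<in> U}"
  proof
    fix g assume g: "g \<in> {g \<in> E. \<forall>q\<in>Q. q (\<lambda>x. g x - f x) < \<epsilon>}"
    then have "g \<in> E" "\<forall>q\<in>Q. q (\<lambda>x. g x - f x) < \<epsilon>" by simp_all
    then show "g \<in> {f \<in> E. T f \<in> U}"
      using Q(4)[OF fun_subspace_diff[OF E _ f(1)], of g] R(4) by simp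
  qed
  then show "\<exists>Q \<epsilon>. finite Q \<and> Q \<subseteq> P \<and> 0 < \<epsilon> \<and>
      {g \<in> E. \<forall>p\<in>Q. p (\<lambda>x. g x - f x) < \<epsilon>} \<subseteq> {f \<in> E. T f \<in> U}"
    using Q(1-3) by (intro exI[of _ Q] exI[of _ \<epsilon>] conjI)
qed auto

lemma dominated_imp_continuous:
  assumes P: "\<And>q. q \<in> P \<Longrightarrow> seminorm_on E q" and E: "fun_subspace E"
    and p: "seminorm_on E p" and dom: "dominated_by E P p"
  shows "continuous_seminorm (lc_topology E P) p"
proof -
  have "openin (lc_topology E P) {f \<in> E. p f \<in> U}" if "open U" for U
  proof (rule open_preimage_lc[OF P E])
    fix f assume f: "f \<in> E" "p f \<in> U"
    then obtain e where e: "e > 0" "\<And>y. \<bar>y - p f\<bar> < e \<Longrightarrow> y \<in> U"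
      using \<open>open U\<close> unfolding open_dist dist_real_def by blast
    have "p g \<in> U" if "g \<in> E" "p (\<lambda>x. g x - f x) < e" for g
      using e(2) seminorm_diff_le[OF E p that(1) f(1)] that(2) by simp
    then show "\<exists>R e. finite R \<and> e > 0 \<and> (\<forall>r\<in>R. dominated_by E P r) \<and>
        (\<forall>g\<in>E. (\<forall>r\<in>R. r (\<lambda>x. g x - f x) < e) \<longrightarrow> p g \<in> U)"
      using dom e(1) by (intro exI[of _ "{p}"] exI[of _ e]) simp
  qed simp
  then show ?thesis
    unfolding continuous_seminorm_def continuous_map by (auto simp: topspace_lc_topology p)
qed

lemma dominated_imp_continuous_form:
  assumes P: "\<And>q. q \<in> P \<Longrightarrow> seminorm_on E q" and E: "fun_subspace E"
    and u: "\<And>f c. f \<in> E \<Longrightarrow> u (\<lambda>x. c * f x) = c * u f"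
      "\<And>f g. f \<in> E \<Longrightarrow> g \<in> E \<Longrightarrow> u (\<lambda>x. f x + g x) = u f + u g"
    and dom: "dominated_by E P (\<lambda>f. cmod (u f))"
  shows "continuous_map (lc_topology E P) euclidean u"
proof -
  have "openin (lc_topology E P) {f \<in> E. u f \<in> U}" if "open U" for U
  proof (rule open_preimage_lc[OF P E])
    fix f assume f: "f \<in> E" "u f \<in> U"
    then obtain e where e: "e > 0" "\<And>y. cmod (y - u f) < e \<Longrightarrow> y \<in> U"
      using \<open>open U\<close> unfolding open_dist dist_norm by blast
    have "u g \<in> U" if g: "g \<in> E" "cmod (u (\<lambda>x. g x - f x)) < e" for g
    proof -
      have "u (\<lambda>x. g x - f x) = u g - u f" using linear_form_diff[OF E g(1) f(1) u] .
      then show ?thesis using e(2) g(2) by simp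
    qed
    then show "\<exists>R e. finite R \<and> e > 0 \<and> (\<forall>r\<in>R. dominated_by E P r) \<and>
        (\<forall>g\<in>E. (\<forall>r\<in>R. r (\<lambda>x. g x - f x) < e) \<longrightarrow> u g \<in> U)"
      using dom e(1) by (intro exI[of _ "{\<lambda>f. cmod (u f)}"] exI[of _ e]) simp
  qed simp
  then show ?thesis
    unfolding continuous_map by (auto simp: topspace_lc_topology)
qed

lemma dominated_imp_continuous_operator:
  assumes P: "\<And>q. q \<in> P \<Longrightarrow> seminorm_on E q" and E: "fun_subspace E"
    and T: "\<And>f. f \<in> E \<Longrightarrow> T f \<in> F"
      "\<And>f g. f \<in> E \<Longrightarrow> g \<in> E \<Longrightarrow> T (\<lambda>x. f x - g x) = (\<lambda>x. T f x - T g x)"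
    and dom: "\<And>r. r \<in> R \<Longrightarrow> dominated_by E P (\<lambda>f. r (T f))"
  shows "continuous_map (lc_topology E P) (lc_topology F R) T"
proof -
  have "openin (lc_topology E P) {f \<in> E. T f \<in> U}" if U: "openin (lc_topology F R) U" for U
  proof (rule open_preimage_lc[OF P E])
    fix f assume f: "f \<in> E" "T f \<in> U"
    then obtain R' e where R': "finite R'" "R' \<subseteq> R" "e > 0"
        "{g \<in> F. \<forall>p\<in>R'. p (\<lambda>x. g x - T f x) < e} \<subseteq> U"
      using U unfolding openin_lc_topology by meson
    have "T g \<in> U" if g: "g \<in> E" "\<forall>r\<in>R'. r (T (\<lambda>x. g x - f x)) < e" for g
      using g(2) R'(4) T(1)[OF g(1)] unfolding T(2)[OF g(1) f(1)] by blast
    then show "\<exists>R e. finite R \<and> e > 0 \<and> (\<forall>r\<in>R. dominated_by E P r) \<and>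
        (\<forall>g\<in>E. (\<forall>r\<in>R. r (\<lambda>x. g x - f x) < e) \<longrightarrow> T g \<in> U)"
      using R'(1-3) dom by (intro exI[of _ "(\<lambda>r f. r (T f)) ` R'"] exI[of _ e]) auto
  qed simp
  then show ?thesis
    unfolding continuous_map by (auto simp: topspace_lc_topology T(1))
qed

text \<open>Conversely, the unit ball of a continuous seminorm contains a basic neighbourhood of zero, and
  homogeneity turns this inclusion into an estimate.\<close>

lemma continuous_seminorm_dominated:
  assumes P: "\<And>q. q \<in> P \<Longrightarrow> seminorm_on E q" and E: "fun_subspace E"
    and p: "seminorm_on E p" and cont: "continuous_map (lc_topology E P) euclideanreal p"
  shows "dominated_by E P p"
proof -
  have "openin (lc_topology E P) {f \<in> E. p f \<in> {..<1}}"
    using openin_continuous_map_preimage[OF cont, of "{..<1}"]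
    by (simp add: topspace_lc_topology)
  moreover have "(\<lambda>x. 0) \<in> {f \<in> E. p f \<in> {..<1}}"
    using fun_subspace_0[OF E] seminorm_zero[OF E p] by simp
  ultimately obtain Q \<epsilon> where Q: "finite Q" "Q \<subseteq> P" "\<epsilon> > 0"
      "{g \<in> E. \<forall>q\<in>Q. q (\<lambda>x. g x - 0) < \<epsilon>} \<subseteq> {f \<in> E. p f \<in> {..<1}}"
    unfolding openin_lc_topology by meson
  have scaled: "t * p f < 1" if f: "f \<in> E" and t: "t > 0" "t * (\<Sum>q\<in>Q. q f) < \<epsilon>" for f t
  proof -
    have q_small: "q (\<lambda>x. of_real t * f x - 0) < \<epsilon>" if "q \<in> Q" for q
    proof -
      have "q f \<le> (\<Sum>q\<in>Q. q f)"
        using seminorm_nonneg[OF P f] Q(1,2) that by (intro member_le_sum) auto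
      then have "t * q f \<le> t * (\<Sum>q\<in>Q. q f)" using t(1) by simp
      also have "\<dots> < \<epsilon>" by (rule t(2))
      finally have "t * q f < \<epsilon>" .
      moreover have "q (\<lambda>x. of_real t * f x) = t * q f"
        using seminorm_scale[OF P f, of q "of_real t"] that Q(2) t(1) by auto
      ultimately show ?thesis by simp
    qed
    have "(\<lambda>x. of_real t * f x) \<in> E" using fun_subspace_scale[OF E f] .
    then have "p (\<lambda>x. of_real t * f x) < 1" using q_small Q(4) by blast
    then show ?thesis using seminorm_scale[OF p f, of "of_real t"] t(1) by simp
  qed
  have "p f \<le> (2 / \<epsilon>) * (\<Sum>q\<in>Q. q f)" if f: "f \<in> E" for f
  proof -
    let ?s = "\<Sum>q\<in>Q. q f"
    have s: "0 \<le> ?s" using seminorm_nonneg[OF P f] Q(2) by (intro sum_nonneg) auto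
    show ?thesis
    proof (cases "?s = 0")
      case True
      have "\<not> p f > 0"
      proof
        assume "p f > 0"
        then show False using scaled[OF f, of "1 / p f"] True Q(3) by simp
      qed
      then show ?thesis using True by simp
    next
      case False
      then have pos: "?s > 0" using s by simp
      have "\<epsilon> / (2 * ?s) * p f < 1"
        using scaled[OF f, of "\<epsilon> / (2 * ?s)"] Q(3) pos by (simp add: field_simps)
      then show ?thesis using pos Q(3) by (simp add: field_simps)
    qed
  qed
  moreover have "0 < 2 / \<epsilon>" using Q(3) by simp
  ultimately show ?thesis unfolding dominated_by_def using Q(1,2) by blast
qed

lemma continuous_seminorm_lc_iff:
  assumes P: "\<And>q. q \<in> P \<Longrightarrow> seminorm_on E q" and E: "fun_subspace E"
  shows "continuous_seminorm (lc_topology E P) p \<longleftrightarrow> seminorm_on E p \<and> dominated_by E P p"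
  using continuous_seminorm_dominated[OF P E] dominated_imp_continuous[OF P E]
  unfolding continuous_seminorm_def topspace_lc_topology by blast

lemma dominated_by_mono:
  assumes "dominated_by E P q" "\<And>f. f \<in> E \<Longrightarrow> p f \<le> q f"
  shows "dominated_by E P p"
  using assms unfolding dominated_by_def by (meson order_trans)

lemma dominated_by_zero: "dominated_by E P (\<lambda>f. 0)"
  unfolding dominated_by_def by (intro exI[of _ "{}"] exI[of _ 1]) simp

lemma dominated_by_add:
  assumes P: "\<And>q. q \<in> P \<Longrightarrow> seminorm_on E q" and p: "dominated_by E P p" and r: "dominated_by E P r"
  shows "dominated_by E P (\<lambda>f. p f + r f)"
proof -
  obtain Q C where Q: "finite Q" "Q \<subseteq> P" "C > 0" "\<And>f. f \<in> E \<Longrightarrow> p f \<le> C * (\<Sum>q\<in>Q. q f)"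
    using p unfolding dominated_by_def by blast
  obtain R D where R: "finite R" "R \<subseteq> P" "D > 0" "\<And>f. f \<in> E \<Longrightarrow> r f \<le> D * (\<Sum>q\<in>R. q f)"
    using r unfolding dominated_by_def by blast
  have nonneg: "0 \<le> q f" if "q \<in> P" "f \<in> E" for q f using seminorm_nonneg[OF P] that by blast
  show ?thesis
  proof (rule dominated_byI[of "Q \<union> R" _ _ _ "C + D"])
    fix f assume f: "f \<in> E"
    have "C * (\<Sum>q\<in>Q. q f) \<le> C * (\<Sum>q\<in>Q \<union> R. q f)"
      using Q R nonneg f by (intro mult_left_mono sum_mono2) auto
    moreover have "D * (\<Sum>q\<in>R. q f) \<le> D * (\<Sum>q\<in>Q \<union> R. q f)"
      using Q R nonneg f by (intro mult_left_mono sum_mono2) auto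
    ultimately show "p f + r f \<le> (C + D) * (\<Sum>q\<in>Q \<union> R. q f)"
      using Q(4)[OF f] R(4)[OF f] by (simp add: distrib_right)
  qed (use Q R nonneg in auto)
qed

lemma dominated_by_scale:
  assumes "dominated_by E P p" "c \<ge> 0"
  shows "dominated_by E P (\<lambda>f. c * p f)"
proof (cases "c = 0")
  case False
  obtain Q C where Q: "finite Q" "Q \<subseteq> P" "C > 0" "\<And>f. f \<in> E \<Longrightarrow> p f \<le> C * (\<Sum>q\<in>Q. q f)"
    using assms(1) unfolding dominated_by_def by blast
  have "c * p f \<le> (c * C) * (\<Sum>q\<in>Q. q f)" if "f \<in> E" for f
    using mult_left_mono[OF Q(4)[OF that] assms(2)] by (simp add: mult.assoc)
  moreover have "c * C > 0" using False assms(2) Q(3) by simp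
  ultimately show ?thesis unfolding dominated_by_def using Q(1,2) by blast
qed (simp add: dominated_by_zero)

lemma dominated_by_sum:
  assumes P: "\<And>q. q \<in> P \<Longrightarrow> seminorm_on E q" and R: "\<And>i. i \<in> I \<Longrightarrow> dominated_by E P (r i)"
  shows "dominated_by E P (\<lambda>f. \<Sum>i\<in>I. r i f)"
  using R
proof (induction I rule: infinite_finite_induct)
  case (insert i I)
  have "dominated_by E P (\<lambda>f. r i f + (\<Sum>i\<in>I. r i f))"
    by (rule dominated_by_add[OF P]) (use insert in auto)
  then show ?case using insert by simp
qed (auto simp: dominated_by_zero)

lemma dominated_by_trans:
  assumes P: "\<And>q. q \<in> P \<Longrightarrow> seminorm_on E q" and R: "\<And>r. r \<in> R \<Longrightarrow> dominated_by E P r"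
    and p: "dominated_by E R p"
  shows "dominated_by E P p"
proof -
  obtain Q C where Q: "finite Q" "Q \<subseteq> R" "C > 0" "\<And>f. f \<in> E \<Longrightarrow> p f \<le> C * (\<Sum>q\<in>Q. q f)"
    using p unfolding dominated_by_def by blast
  have "dominated_by E P (\<lambda>f. C * (\<Sum>q\<in>Q. q f))"
    by (rule dominated_by_scale[OF dominated_by_sum[OF P]]) (use Q R in auto)
  then show ?thesis using dominated_by_mono Q(4) by blast
qed

lemma dominated_by_subset: "dominated_by E P p \<Longrightarrow> F \<subseteq> E \<Longrightarrow> dominated_by F P p"
  unfolding dominated_by_def by blast

section \<open>Calculus of smooth functions\<close>

abbreviation partial :: "'n::finite \<Rightarrow> (real^'n \<Rightarrow> 'b::real_normed_vector) \<Rightarrow> real^'n \<Rightarrow> 'b" where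
  "partial i f \<equiv> (\<lambda>x. frechet_derivative f (at x) (axis i 1))"

lemma frechet_derivative_cong_open:
  assumes "open X" "x \<in> X" "\<And>y. y \<in> X \<Longrightarrow> f y = g y"
  shows "frechet_derivative f (at x) = frechet_derivative g (at x)"
proof -
  have "(f has_derivative D) (at x) \<longleftrightarrow> (g has_derivative D) (at x)" for D
    using has_derivative_transform_within_open[OF _ assms(1,2), of f D UNIV g]
      has_derivative_transform_within_open[OF _ assms(1,2), of g D UNIV f] assms(3) by auto
  then show ?thesis unfolding frechet_derivative_def by simp
qed

lemma partial_eqI:
  assumes "(f has_derivative f') (at x)"
  shows "partial i f x = f' (axis i 1)"
  using frechet_derivative_at[OF assms] by simp

lemma iter_partial_append: "iter_partial (is @ js) f = iter_partial is (iter_partial js f)"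
  by (induction "is") simp_all

lemma iter_partial_snoc: "iter_partial (is @ [i]) f = iter_partial is (partial i f)"
  by (simp add: iter_partial_append)

lemma iter_partial_cong_open:
  assumes "open X" "\<And>y. y \<in> X \<Longrightarrow> f y = g y" "x \<in> X"
  shows "iter_partial is f x = iter_partial is g x"
  using assms(3)
proof (induction "is" arbitrary: x)
  case (Cons i "is")
  then show ?case using frechet_derivative_cong_open[OF assms(1), of x "iter_partial is f" "iter_partial is g"]
    by simp
qed (use assms in simp)

lemma iter_partial_zero: "iter_partial is (\<lambda>x. 0) = (\<lambda>x. 0)"
  by (induction "is") auto

lemma iter_partial_zero_outside:
  assumes "closed K" "\<And>x. x \<notin> K \<Longrightarrow> f x = 0" "x \<notin> K"
  shows "iter_partial is f x = 0"
  using iter_partial_cong_open[of "- K" f "\<lambda>x. 0" x "is"] assms by (simp add: open_Compl iter_partial_zero)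

lemma smooth_on_differentiable_at:
  assumes "smooth_on X f" "open X" "x \<in> X"
  shows "iter_partial is f differentiable (at x)"
  using assms differentiable_on_eq_differentiable_at unfolding smooth_on_def by blast

lemma smooth_on_continuous:
  assumes "smooth_on X f" shows "continuous_on X (iter_partial is f)"
  using assms differentiable_imp_continuous_on unfolding smooth_on_def by blast

lemma smooth_on_subset: "smooth_on X f \<Longrightarrow> Y \<subseteq> X \<Longrightarrow> smooth_on Y f"
  unfolding smooth_on_def using differentiable_on_subset by blast

lemma smooth_on_Un:
  assumes "smooth_on X f" "smooth_on Y f" "open X" "open Y"
  shows "smooth_on (X \<union> Y) f"
  using assms unfolding smooth_on_def
  by (auto simp: differentiable_on_eq_differentiable_at open_Un)

lemma smooth_on_iter_partial: "smooth_on X f \<Longrightarrow> smooth_on X (iter_partial is f)"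
  unfolding smooth_on_def iter_partial_append[symmetric] by blast

lemma smooth_on_partial: "smooth_on X f \<Longrightarrow> smooth_on X (partial i f)"
  using smooth_on_iter_partial[of X f "[i]"] by simp

text \<open>Smoothness is reached through the finite orders of differentiability: these permit induction,
  because one order less suffices for the partial derivatives.\<close>

definition smooth_upto :: "nat \<Rightarrow> (real^'n) set \<Rightarrow> (real^'n \<Rightarrow> 'b::real_normed_vector) \<Rightarrow> bool" where
  "smooth_upto n X f \<longleftrightarrow> (\<forall>is. length is \<le> n \<longrightarrow> iter_partial is f differentiable_on X)"

lemma smooth_on_iff_upto: "smooth_on X f \<longleftrightarrow> (\<forall>n. smooth_upto n X f)"
  unfolding smooth_on_def smooth_upto_def by blast

lemma smooth_upto_0: "smooth_upto 0 X f \<longleftrightarrow> f differentiable_on X"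
  unfolding smooth_upto_def by simp

lemma smooth_upto_mono: "smooth_upto n X f \<Longrightarrow> m \<le> n \<Longrightarrow> smooth_upto m X f"
  unfolding smooth_upto_def by auto

lemma smooth_upto_Suc:
  "smooth_upto (Suc n) X f \<longleftrightarrow> f differentiable_on X \<and> (\<forall>i. smooth_upto n X (partial i f))"
proof
  assume L: "smooth_upto (Suc n) X f"
  have "smooth_upto n X (partial i f)" for i
    unfolding smooth_upto_def iter_partial_snoc[symmetric] using L unfolding smooth_upto_def by simp
  moreover have "iter_partial [] f differentiable_on X"
    using L unfolding smooth_upto_def by (rule allE[of _ "[]"]) simp
  ultimately show "f differentiable_on X \<and> (\<forall>i. smooth_upto n X (partial i f))" by simp
next
  assume R: "f differentiable_on X \<and> (\<forall>i. smooth_upto n X (partial i f))"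
  show "smooth_upto (Suc n) X f"
    unfolding smooth_upto_def
  proof (intro allI impI)
    fix "is" :: "'a list" assume len: "length is \<le> Suc n"
    show "iter_partial is f differentiable_on X"
    proof (cases "is" rule: rev_cases)
      case (snoc js j)
      then show ?thesis using R len unfolding smooth_upto_def by (simp add: iter_partial_snoc)
    qed (use R in simp)
  qed
qed

lemma smooth_upto_differentiable_at:
  assumes "smooth_upto n X f" "open X" "x \<in> X"
  shows "f differentiable (at x)"
  using assms smooth_upto_mono[of n X f 0] by (auto simp: smooth_upto_0 differentiable_on_eq_differentiable_at)

lemma smooth_upto_cong:
  assumes "open X" "\<And>y. y \<in> X \<Longrightarrow> f y = g y"
  shows "smooth_upto n X f \<longleftrightarrow> smooth_upto n X g"
proof -
  have *: "h differentiable_on X" if "h' differentiable_on X" "\<And>y. y \<in> X \<Longrightarrow> h' y = h y"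
    for h h' :: "(real, 'a) vec \<Rightarrow> 'b"
    unfolding differentiable_on_def
  proof
    fix x assume "x \<in> X"
    then show "h differentiable (at x within X)"
      using that by (intro differentiable_transform_within[of h' x X 1 h]) (auto simp: differentiable_on_def)
  qed
  have "iter_partial is f differentiable_on X \<longleftrightarrow> iter_partial is g differentiable_on X" for "is"
    using *[of "iter_partial is f" "iter_partial is g"] *[of "iter_partial is g" "iter_partial is f"]
      iter_partial_cong_open[OF assms] by auto
  then show ?thesis unfolding smooth_upto_def by simp
qed

lemma smooth_on_cong:
  assumes "open X" "\<And>y. y \<in> X \<Longrightarrow> f y = g y"
  shows "smooth_on X f \<longleftrightarrow> smooth_on X g"
  unfolding smooth_on_iff_upto using smooth_upto_cong[OF assms] by simp

lemma smooth_upto_SucI: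
  assumes "open X" "\<And>x. x \<in> X \<Longrightarrow> (f has_derivative D x) (at x)"
    and "\<And>i. smooth_upto n X (\<lambda>x. D x (axis i 1))"
  shows "smooth_upto (Suc n) X f"
  unfolding smooth_upto_Suc
proof (intro conjI allI)
  show "f differentiable_on X"
    unfolding differentiable_on_eq_differentiable_at[OF assms(1)] differentiable_def using assms(2) by blast
  show "smooth_upto n X (partial i f)" for i
    using smooth_upto_cong[OF assms(1), of "partial i f" "\<lambda>x. D x (axis i 1)"]
      partial_eqI[OF assms(2)] assms(3) by simp
qed

lemma smooth_upto_const: "open X \<Longrightarrow> smooth_upto n X (\<lambda>x. c)"
proof (induction n arbitrary: c)
  case (Suc n)
  then show ?case by (intro smooth_upto_SucI[where D = "\<lambda>x h. 0"]) auto
qed (simp add: smooth_upto_0)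

lemma smooth_upto_bounded_linear:
  assumes L: "bounded_linear L" and X: "open X"
  shows "smooth_upto n X f \<Longrightarrow> smooth_upto n X (\<lambda>x. L (f x))"
proof (induction n arbitrary: f)
  case 0
  then show ?case
    using X bounded_linear.has_derivative[OF L] unfolding smooth_upto_0
      differentiable_on_eq_differentiable_at[OF X] differentiable_def by blast
next
  case (Suc n)
  show ?case
  proof (rule smooth_upto_SucI[OF X])
    fix x assume "x \<in> X"
    then show "((\<lambda>x. L (f x)) has_derivative (\<lambda>h. L (frechet_derivative f (at x) h))) (at x)"
      using smooth_upto_differentiable_at[OF Suc.prems X] frechet_derivative_works
        bounded_linear.has_derivative[OF L] by blast
  qed (use Suc in \<open>simp add: smooth_upto_Suc\<close>)
qed

lemma smooth_upto_add:
  assumes X: "open X"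
  shows "smooth_upto n X f \<Longrightarrow> smooth_upto n X g \<Longrightarrow> smooth_upto n X (\<lambda>x. f x + g x)"
proof (induction n arbitrary: f g)
  case 0
  then show ?case
    using differentiable_on_add unfolding smooth_upto_0 by blast
next
  case (Suc n)
  show ?case
  proof (rule smooth_upto_SucI[OF X])
    fix x assume "x \<in> X"
    then show "((\<lambda>x. f x + g x) has_derivative
        (\<lambda>h. frechet_derivative f (at x) h + frechet_derivative g (at x) h)) (at x)"
      using smooth_upto_differentiable_at[OF Suc.prems(1) X] smooth_upto_differentiable_at[OF Suc.prems(2) X]
        frechet_derivative_works by (intro has_derivative_add) blast+
  qed (use Suc in \<open>simp add: smooth_upto_Suc\<close>)
qed

lemma smooth_upto_mult:
  fixes f g :: "real^'n \<Rightarrow> 'b::real_normed_algebra"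
  assumes X: "open X"
  shows "smooth_upto n X f \<Longrightarrow> smooth_upto n X g \<Longrightarrow> smooth_upto n X (\<lambda>x. f x * g x)"
proof (induction n arbitrary: f g)
  case 0
  then show ?case
    unfolding smooth_upto_0 differentiable_on_eq_differentiable_at[OF X] by (auto intro: differentiable_mult)
next
  case (Suc n)
  have f: "smooth_upto n X f" "\<And>i. smooth_upto n X (partial i f)"
    using Suc.prems(1) smooth_upto_mono[of "Suc n" X f n] by (auto simp: smooth_upto_Suc)
  have g: "smooth_upto n X g" "\<And>i. smooth_upto n X (partial i g)"
    using Suc.prems(2) smooth_upto_mono[of "Suc n" X g n] by (auto simp: smooth_upto_Suc)
  show ?case
  proof (rule smooth_upto_SucI[OF X])
    fix x assume "x \<in> X"
    then show "((\<lambda>x. f x * g x) has_derivative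
        (\<lambda>h. f x * frechet_derivative g (at x) h + frechet_derivative f (at x) h * g x)) (at x)"
      using smooth_upto_differentiable_at[OF Suc.prems(1) X] smooth_upto_differentiable_at[OF Suc.prems(2) X]
        frechet_derivative_works by (intro has_derivative_mult) blast+
  next
    show "smooth_upto n X (\<lambda>x. f x * partial i g x + partial i f x * g x)" for i
      by (intro smooth_upto_add[OF X] Suc.IH f g)
  qed
qed

lemma smooth_upto_sum:
  assumes X: "open X" and "\<And>i. i \<in> I \<Longrightarrow> smooth_upto n X (f i)"
  shows "smooth_upto n X (\<lambda>x. \<Sum>i\<in>I. f i x)"
  using assms(2)
proof (induction I rule: infinite_finite_induct)
  case (insert i I)
  then show ?case using smooth_upto_add[OF X, of n "f i" "\<lambda>x. \<Sum>i\<in>I. f i x"] by simp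
qed (use smooth_upto_const[OF X] in auto)

lemma smooth_upto_inverse:
  fixes f :: "real^'n \<Rightarrow> 'b::real_normed_field"
  assumes X: "open X" and nz: "\<And>x. x \<in> X \<Longrightarrow> f x \<noteq> 0"
  shows "smooth_upto n X f \<Longrightarrow> smooth_upto n X (\<lambda>x. inverse (f x))"
proof (induction n)
  have der: "((\<lambda>x. inverse (f x)) has_derivative
        (\<lambda>h. - 1 * (inverse (f x) * frechet_derivative f (at x) h * inverse (f x)))) (at x)"
    if "smooth_upto n X f" and x: "x \<in> X" for n x
  proof -
    have "(f has_derivative frechet_derivative f (at x)) (at x)"
      using smooth_upto_differentiable_at[OF that(1) X x] frechet_derivative_works by blast
    from Deriv.has_derivative_inverse[OF nz[OF x] this] show ?thesis by (simp only: mult_minus1)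
  qed
  {
    case 0
    then show ?case
      unfolding smooth_upto_0 differentiable_on_eq_differentiable_at[OF X] differentiable_def
      using der[of 0] unfolding smooth_upto_0 differentiable_on_eq_differentiable_at[OF X] differentiable_def
      by blast
  next
    case (Suc n)
    have f: "smooth_upto n X f" "\<And>i. smooth_upto n X (partial i f)"
      using Suc.prems(1) smooth_upto_mono[of "Suc n" X f n] by (auto simp: smooth_upto_Suc)
    have inv: "smooth_upto n X (\<lambda>x. inverse (f x))" using Suc.IH f(1) by blast
    show ?case
    proof (rule smooth_upto_SucI[OF X])
      fix x assume x: "x \<in> X"
      show "((\<lambda>x. inverse (f x)) has_derivative
          (\<lambda>h. - 1 * (inverse (f x) * frechet_derivative f (at x) h * inverse (f x)))) (at x)"
        using der[OF Suc.prems x] .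
    next
      show "smooth_upto n X (\<lambda>x. - 1 * (inverse (f x) * partial i f x * inverse (f x)))" for i
        using f(2) inv by (intro smooth_upto_mult[OF X] smooth_upto_const[OF X])
    qed
  }
qed

lemma smooth_on_const: "open X \<Longrightarrow> smooth_on X (\<lambda>x. c)"
  by (simp add: smooth_on_iff_upto smooth_upto_const)

lemma smooth_on_bounded_linear:
  "bounded_linear L \<Longrightarrow> open X \<Longrightarrow> smooth_on X f \<Longrightarrow> smooth_on X (\<lambda>x. L (f x))"
  by (simp add: smooth_on_iff_upto smooth_upto_bounded_linear)

lemma smooth_on_add:
  "open X \<Longrightarrow> smooth_on X f \<Longrightarrow> smooth_on X g \<Longrightarrow> smooth_on X (\<lambda>x. f x + g x)"
  by (simp add: smooth_on_iff_upto smooth_upto_add)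

lemma smooth_on_mult:
  fixes f g :: "real^'n \<Rightarrow> 'b::real_normed_algebra"
  shows "open X \<Longrightarrow> smooth_on X f \<Longrightarrow> smooth_on X g \<Longrightarrow> smooth_on X (\<lambda>x. f x * g x)"
  by (simp add: smooth_on_iff_upto smooth_upto_mult)

lemma smooth_on_sum:
  "open X \<Longrightarrow> (\<And>i. i \<in> I \<Longrightarrow> smooth_on X (f i)) \<Longrightarrow> smooth_on X (\<lambda>x. \<Sum>i\<in>I. f i x)"
  by (simp add: smooth_on_iff_upto smooth_upto_sum)

lemma smooth_on_prod:
  fixes f :: "'i \<Rightarrow> real^'n \<Rightarrow> 'b::real_normed_field"
  assumes X: "open X" and "\<And>i. i \<in> I \<Longrightarrow> smooth_on X (f i)"
  shows "smooth_on X (\<lambda>x. \<Prod>i\<in>I. f i x)"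
  using assms(2)
proof (induction I rule: infinite_finite_induct)
  case (insert i I)
  then show ?case using smooth_on_mult[OF X, of "f i" "\<lambda>x. \<Prod>i\<in>I. f i x"] by simp
qed (use smooth_on_const[OF X] in auto)

lemma smooth_on_inverse:
  fixes f :: "real^'n \<Rightarrow> 'b::real_normed_field"
  shows "open X \<Longrightarrow> (\<And>x. x \<in> X \<Longrightarrow> f x \<noteq> 0) \<Longrightarrow> smooth_on X f \<Longrightarrow> smooth_on X (\<lambda>x. inverse (f x))"
  by (simp add: smooth_on_iff_upto smooth_upto_inverse)

lemma smooth_on_component:
  assumes "open X" "smooth_on X (f :: real^'n \<Rightarrow> real^'m)"
  shows "smooth_on X (\<lambda>x. f x $ j)"
  using assms smooth_on_bounded_linear[OF bounded_linear_vec_nth] by blast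

lemma smooth_on_of_real:
  assumes "open X" "smooth_on X f"
  shows "smooth_on X (\<lambda>x. of_real (f x) :: 'b::real_normed_field)"
  using assms smooth_on_bounded_linear[OF bounded_linear_of_real] by blast

lemma smooth_on_translate_id: "open X \<Longrightarrow> smooth_on X (\<lambda>x. x - a)"
proof -
  assume X: "open X"
  have "smooth_upto n X (\<lambda>x. x - a)" for n
  proof (cases n)
    case 0
    then show ?thesis by (simp add: smooth_upto_0 differentiable_on_def differentiable_diff)
  next
    case (Suc m)
    have "smooth_upto (Suc m) X (\<lambda>x. x - a)"
      by (rule smooth_upto_SucI[OF X, where D = "\<lambda>x h. h"])
        (auto intro!: derivative_eq_intros smooth_upto_const X)
    then show ?thesis using Suc by simp
  qed
  then show ?thesis unfolding smooth_on_iff_upto by blast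
qed

lemma iter_partial_add:
  assumes "smooth_on X f" "smooth_on X g" "open X" "x \<in> X"
  shows "iter_partial is (\<lambda>x. f x + g x) x = iter_partial is f x + iter_partial is g x"
  using assms(4)
proof (induction "is" arbitrary: x)
  case (Cons i "is")
  have "((\<lambda>x. iter_partial is f x + iter_partial is g x) has_derivative
     (\<lambda>h. frechet_derivative (iter_partial is f) (at x) h + frechet_derivative (iter_partial is g) (at x) h)) (at x)"
    using smooth_on_differentiable_at[OF assms(1,3) Cons.prems] smooth_on_differentiable_at[OF assms(2,3) Cons.prems]
      frechet_derivative_works by (intro has_derivative_add) blast+
  from partial_eqI[OF this] show ?case
    using frechet_derivative_cong_open[OF assms(3) Cons.prems Cons.IH] by simp
qed simp

lemma iter_partial_bounded_linear:
  assumes L: "bounded_linear L" and "smooth_on X f" "open X" "x \<in> X"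
  shows "iter_partial is (\<lambda>x. L (f x)) x = L (iter_partial is f x)"
  using assms(4)
proof (induction "is" arbitrary: x)
  case (Cons i "is")
  have "((\<lambda>x. L (iter_partial is f x)) has_derivative
     (\<lambda>h. L (frechet_derivative (iter_partial is f) (at x) h))) (at x)"
    using smooth_on_differentiable_at[OF assms(2,3) Cons.prems] 
      frechet_derivative_works bounded_linear.has_derivative[OF L] by blast
  from partial_eqI[OF this] show ?case
    using frechet_derivative_cong_open[OF assms(3) Cons.prems Cons.IH] by simp
qed simp

lemma iter_partial_cmult:
  fixes f :: "real^'n \<Rightarrow> 'b::real_normed_algebra"
  assumes "smooth_on X f" "open X" "x \<in> X"
  shows "iter_partial is (\<lambda>x. c * f x) x = c * iter_partial is f x"
  using iter_partial_bounded_linear[OF bounded_linear_mult_right assms] .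

lemma iter_partial_sum:
  assumes "\<And>i. i \<in> I \<Longrightarrow> smooth_on X (f i)" "open X" "x \<in> X"
  shows "iter_partial is (\<lambda>x. \<Sum>i\<in>I. f i x) x = (\<Sum>i\<in>I. iter_partial is (f i) x)"
  using assms(1)
proof (induction I rule: infinite_finite_induct)
  case (insert i I)
  then show ?case
    using iter_partial_add[of X "f i" "\<lambda>x. \<Sum>i\<in>I. f i x" x "is"] smooth_on_sum[of X I f] assms(2,3) by simp
qed (auto simp: iter_partial_zero)

lemma frechet_derivative_eq_sum_partial:
  assumes "f differentiable (at x)"
  shows "frechet_derivative f (at x) h = (\<Sum>i\<in>UNIV. h $ i *\<^sub>R partial i f x)"
proof -
  interpret linear "frechet_derivative f (at x)"
    using assms linear_frechet_derivative by blast
  have "h = (\<Sum>i\<in>UNIV. h $ i *\<^sub>R axis i 1)"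
    using basis_expansion[of h] by (simp add: scalar_mult_eq_scaleR)
  from arg_cong[OF this, of "frechet_derivative f (at x)"] show ?thesis by (simp add: sum scaleR)
qed

lemma norm_frechet_derivative_le:
  assumes "f differentiable (at x)" "\<And>i. norm (partial i f x) \<le> M"
  shows "norm (frechet_derivative f (at x) (h::real^'n)) \<le> real CARD('n) * M * norm h"
proof -
  have "norm (frechet_derivative f (at x) h) \<le> (\<Sum>i\<in>UNIV. \<bar>h $ i\<bar> * norm (partial i f x))"
    unfolding frechet_derivative_eq_sum_partial[OF assms(1), of h]
    using norm_sum[of "\<lambda>i. h $ i *\<^sub>R partial i f x" UNIV] by (simp only: norm_scaleR)
  also have "\<dots> \<le> (\<Sum>i\<in>(UNIV::'n set). norm h * M)"
    using assms(2) by (intro sum_mono mult_mono component_le_norm_cart) auto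
  finally show ?thesis by (simp add: mult_ac)
qed

text \<open>The chain rule, with the derivative of the outer function expanded into partial derivatives.\<close>

lemma partial_compose:
  assumes "f differentiable (at (\<theta> x))" "(\<theta> has_derivative \<theta>') (at x)"
  shows "((\<lambda>x. f (\<theta> x)) has_derivative (\<lambda>h. \<Sum>j\<in>UNIV. \<theta>' h $ j *\<^sub>R partial j f (\<theta> x))) (at x)"
proof -
  have "((\<lambda>x. f (\<theta> x)) has_derivative (\<lambda>h. frechet_derivative f (at (\<theta> x)) (\<theta>' h))) (at x)"
    by (rule has_derivative_compose[OF assms(2) assms(1)[unfolded frechet_derivative_works]])
  moreover have "(\<lambda>h. frechet_derivative f (at (\<theta> x)) (\<theta>' h)) =
      (\<lambda>h. \<Sum>j\<in>UNIV. \<theta>' h $ j *\<^sub>R partial j f (\<theta> x))"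
    by (rule ext, rule frechet_derivative_eq_sum_partial[OF assms(1)])
  ultimately show ?thesis by simp
qed

lemma smooth_on_det:
  fixes A :: "real^'n \<Rightarrow> real^'m^'m"
  assumes X: "open X" and A: "\<And>r s. smooth_on X (\<lambda>x. A x $ r $ s)"
  shows "smooth_on X (\<lambda>x. det (A x))"
  unfolding det_def
  by (intro smooth_on_sum smooth_on_mult smooth_on_prod smooth_on_const X A)

text \<open>Needed for \<open>1 / \<bar>d\<bar> = sgn d / d\<close>, where \<open>d\<close> is a Jacobian determinant.\<close>

lemma smooth_on_sgn:
  fixes d :: "real^'n \<Rightarrow> real"
  assumes X: "open X" and d: "continuous_on X d" "\<And>x. x \<in> X \<Longrightarrow> d x \<noteq> 0"
  shows "smooth_on X (\<lambda>x. sgn (d x))"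
proof -
  have der: "((\<lambda>x. sgn (d x)) has_derivative (\<lambda>h. 0)) (at x)" if x: "x \<in> X" for x
  proof -
    \<comment> \<open>The sign is constant on each of the open sets where \<open>d\<close> is positive or negative.\<close>
    let ?U = "X \<inter> d -` {y. 0 < y * sgn (d x)}"
    have "open {y. 0 < y * sgn (d x)}" by (intro open_Collect_less continuous_intros)
    then have U: "open ?U" using continuous_open_preimage[OF d(1) X] by blast
    have xU: "x \<in> ?U" using x d(2)[OF x] by (auto simp: sgn_if)
    show ?thesis
      by (rule has_derivative_transform_within_open[OF has_derivative_const[where c = "sgn (d x)"] U xU])
        (auto simp: sgn_if zero_less_mult_iff split: if_splits)
  qed
  have "smooth_upto n X (\<lambda>x. sgn (d x))" for n
  proof (cases n)
    case 0
    have "(\<lambda>x. sgn (d x)) differentiable_on X"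
      unfolding differentiable_on_eq_differentiable_at[OF X] differentiable_def using der by blast
    then show ?thesis using 0 by (simp add: smooth_upto_0)
  next
    case (Suc m)
    then show ?thesis using smooth_upto_SucI[OF X der smooth_upto_const[OF X]] by simp
  qed
  then show ?thesis unfolding smooth_on_iff_upto by simp
qed

subsection \<open>Bump functions\<close>

text \<open>The derivative of a member of this family is a combination of other members. This is what makes
  \<open>exp (- 1 / t)\<close>, extended by zero, smooth at the origin.\<close>

definition flat_exp :: "nat \<Rightarrow> real \<Rightarrow> real" where
  "flat_exp k t = (if t > 0 then exp (- 1 / t) / t ^ k else 0)"

text \<open>The bound comes from \<open>exp (1 / t) \<ge> (1 / (n t)) ^ n\<close> for \<open>n = k + 1\<close>.\<close>

lemma flat_exp_le: "\<bar>flat_exp k t\<bar> \<le> real (Suc k) ^ Suc k * \<bar>t\<bar>"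
proof (cases "t > 0")
  case True
  let ?n = "real (Suc k)"
  have "1 / (?n * t) \<le> exp (1 / (?n * t))"
    using exp_ge_add_one_self[of "1 / (?n * t)"] by linarith
  then have "(1 / (?n * t)) ^ Suc k \<le> exp (1 / (?n * t)) ^ Suc k"
    using True by (intro power_mono) simp_all
  also have "\<dots> = exp (1 / t)"
    using exp_of_nat_mult[of "Suc k" "1 / (?n * t)"] True by (simp del: of_nat_Suc power_Suc)
  finally have "exp (- 1 / t) \<le> (?n * t) ^ Suc k"
    using True by (simp add: exp_minus' power_divide field_simps del: of_nat_Suc power_Suc)
  then have "exp (- 1 / t) / t ^ k \<le> (?n * t) ^ Suc k / t ^ k"
    using True by (intro divide_right_mono) simp_all
  also have "\<dots> = ?n ^ Suc k * t"
    using True by (simp add: power_mult_distrib del: of_nat_Suc)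
  finally show ?thesis using True by (simp add: flat_exp_def)
next
  case False
  then have "flat_exp k t = 0" by (simp add: flat_exp_def)
  moreover have "0 \<le> real (Suc k) ^ Suc k * \<bar>t\<bar>" by (intro mult_nonneg_nonneg zero_le_power) auto
  ultimately show ?thesis by simp
qed

lemma flat_exp_has_derivative:
  "(flat_exp k has_real_derivative (flat_exp (k + 2) t - real k * flat_exp (k + 1) t)) (at t)"
proof -
  consider "t > 0" | "t < 0" | "t = 0" by linarith
  then show ?thesis
  proof cases
    case 1
    have "((\<lambda>t. exp (- 1 / t) / t ^ k) has_real_derivative
        (flat_exp (k + 2) t - real k * flat_exp (k + 1) t)) (at t)"
      using 1
      by (cases k; auto intro!: derivative_eq_intros simp: flat_exp_def field_simps power2_eq_square)
        (metis One_nat_def mult.commute neq0_conv power_minus_mult)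
    then show ?thesis
      by (rule has_field_derivative_transform_within_open[where S = "{0<..}"])
        (use 1 in \<open>auto simp: flat_exp_def\<close>)
  next
    case 2
    have "((\<lambda>t. 0) has_real_derivative (flat_exp (k + 2) t - real k * flat_exp (k + 1) t)) (at t)"
      using 2 by (simp add: flat_exp_def)
    then show ?thesis
      by (rule has_field_derivative_transform_within_open[where S = "{..<0}"])
        (use 2 in \<open>auto simp: flat_exp_def\<close>)
  next
    case 3
    let ?C = "real (Suc (Suc k)) ^ Suc (Suc k)"
    \<comment> \<open>The difference quotient at 0 is the next function of the family.\<close>
    have quot: "(flat_exp k (0 + h) - flat_exp k 0) / h = flat_exp (Suc k) h" for h
      by (simp add: flat_exp_def)
    have "(flat_exp (Suc k) \<longlongrightarrow> 0) (at 0)"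
    proof (rule Lim_null_comparison)
      show "\<forall>\<^sub>F x in at 0. norm (flat_exp (Suc k) x) \<le> ?C * \<bar>x\<bar>"
        using flat_exp_le[of "Suc k"] by (simp del: of_nat_Suc power_Suc)
      show "((\<lambda>x. ?C * \<bar>x\<bar>) \<longlongrightarrow> 0) (at 0)"
        by (auto intro!: tendsto_eq_intros)
    qed
    then have "(flat_exp k has_real_derivative 0) (at 0)"
      unfolding DERIV_def quot .
    moreover have "flat_exp (k + 2) 0 - real k * flat_exp (k + 1) 0 = 0" by (simp add: flat_exp_def)
    ultimately show ?thesis using 3 by simp
  qed
qed

text \<open>The induction runs over all \<open>k\<close> simultaneously, since differentiation raises \<open>k\<close>.\<close>

lemma smooth_upto_flat_exp_quadratic:
  "smooth_upto n UNIV (\<lambda>x::real^'n. flat_exp k (r - (x - a) \<bullet> (x - a)))"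
proof (induction n arbitrary: k)
  have der: "((\<lambda>x. flat_exp k (r - (x - a) \<bullet> (x - a))) has_derivative
      (\<lambda>h. (- 2 * ((x - a) \<bullet> h)) * (flat_exp (k + 2) (r - (x - a) \<bullet> (x - a))
             + (- real k) * flat_exp (k + 1) (r - (x - a) \<bullet> (x - a))))) (at x)" for k and x :: "real^'n"
  proof -
    have "((\<lambda>x. r - (x - a) \<bullet> (x - a)) has_derivative (\<lambda>h. - 2 * ((x - a) \<bullet> h))) (at x)"
      by (auto intro!: derivative_eq_intros simp: inner_commute algebra_simps)
    from has_derivative_compose[OF this flat_exp_has_derivative[unfolded has_field_derivative_def]]
    show ?thesis by (simp add: algebra_simps)
  qed
  {
    case 0
    show ?case
      unfolding smooth_upto_0 differentiable_on_eq_differentiable_at[OF open_UNIV] differentiable_def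
      using der by blast
  next
    case (Suc n)
    have lin: "smooth_upto n UNIV (\<lambda>x::real^'n. - 2 * ((x - a) \<bullet> axis i 1))" for i
      using smooth_on_bounded_linear[OF bounded_linear_mult_right[of "- 2 :: real"] open_UNIV
          smooth_on_bounded_linear[OF bounded_linear_inner_left open_UNIV smooth_on_translate_id[OF open_UNIV]]]
      unfolding smooth_on_iff_upto by blast
    show ?case
      by (rule smooth_upto_SucI[OF open_UNIV der])
        (intro smooth_upto_mult smooth_upto_add lin Suc.IH smooth_upto_const open_UNIV)
  }
qed

lemma bump_function_exists:
  fixes a :: "real^'n"
  assumes "r > 0"
  obtains b :: "real^'n \<Rightarrow> real" where "smooth_on UNIV b" "\<And>x. b x \<ge> 0" "\<And>x. b x > 0 \<longleftrightarrow> x \<in> ball a r"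
proof (rule that)
  let ?b = "\<lambda>x. flat_exp 0 (r\<^sup>2 - (x - a) \<bullet> (x - a))"
  show "smooth_on UNIV ?b" unfolding smooth_on_iff_upto using smooth_upto_flat_exp_quadratic by blast
  show "?b x \<ge> 0" for x by (simp add: flat_exp_def)
  have "0 < r\<^sup>2 - (x - a) \<bullet> (x - a) \<longleftrightarrow> norm (x - a) < r" for x
    using assms by (simp add: norm_lt_square)
  then show "?b x > 0 \<longleftrightarrow> x \<in> ball a r" for x
    by (simp add: flat_exp_def dist_norm norm_minus_commute)
qed

section \<open>Change of variables for an arbitrary finite index type\<close>

text \<open>A copy of the index type, well-ordered by an enumeration. The theorem
  \<open>has_absolute_integral_change_of_variables\<close> is about well-ordered coordinates. Relabelling coordinates
  affects neither Lebesgue measure nor determinants, so the formula holds for every finite index type.\<close>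

typedef 'a ranked = "UNIV :: 'a set" ..

instantiation ranked :: (finite) "{finite, wellorder}"
begin

definition less_eq_ranked :: "'a ranked \<Rightarrow> 'a ranked \<Rightarrow> bool" where
  "x \<le> y \<longleftrightarrow> to_nat_on UNIV (Rep_ranked x) \<le> to_nat_on UNIV (Rep_ranked y)"

definition less_ranked :: "'a ranked \<Rightarrow> 'a ranked \<Rightarrow> bool" where
  "x < y \<longleftrightarrow> to_nat_on UNIV (Rep_ranked x) < to_nat_on UNIV (Rep_ranked y)"

instance
proof
  have "inj (Abs_ranked :: 'a \<Rightarrow> 'a ranked)" "surj (Abs_ranked :: 'a \<Rightarrow> 'a ranked)"
    by (auto simp: inj_def Abs_ranked_inject surj_def intro: Abs_ranked_cases)
  then show "finite (UNIV :: 'a ranked set)"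
    by (metis finite_class.finite_UNIV finite_imageI)
next
  fix x y :: "'a ranked"
  assume "x \<le> y" "y \<le> x"
  then have "to_nat_on UNIV (Rep_ranked x) = to_nat_on UNIV (Rep_ranked y)"
    unfolding less_eq_ranked_def by simp
  then have "Rep_ranked x = Rep_ranked y"
    using inj_on_to_nat_on[OF countable_finite, of "UNIV :: 'a set"] by (simp add: inj_def)
  then show "x = y" by (simp add: Rep_ranked_inject)
next
  fix P :: "'a ranked \<Rightarrow> bool" and a
  assume step: "\<And>x. (\<And>y. y < x \<Longrightarrow> P y) \<Longrightarrow> P x"
  show "P a"
    by (induction a rule: measure_induct_rule[where f = "\<lambda>x. to_nat_on UNIV (Rep_ranked x)"])
      (rule step, simp add: less_ranked_def)
qed (auto simp: less_eq_ranked_def less_ranked_def)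

end

lemma bij_Rep_ranked: "bij Rep_ranked"
  by (metis Abs_ranked_inverse Rep_ranked_inverse UNIV_I bij_betw_def inj_def surj_def)

definition reindex :: "('m \<Rightarrow> 'n) \<Rightarrow> 'b^'n \<Rightarrow> 'b^'m" where
  "reindex h x = (\<chi> i. x $ h i)"

lemma reindex_component [simp]: "reindex h x $ i = x $ h i"
  by (simp add: reindex_def)

lemma reindex_inv:
  assumes "bij h"
  shows "reindex h (reindex (inv h) y) = y" "reindex (inv h) (reindex h x) = x"
  using assms by (auto simp: vec_eq_iff bij_is_inj bij_is_surj surj_f_inv_f)

lemma bounded_linear_reindex:
  "bounded_linear (reindex h :: 'b::euclidean_space^'n::finite \<Rightarrow> 'b^'m::finite)"
  by (intro linear_conv_bounded_linear[THEN iffD1] linearI) (auto simp: vec_eq_iff)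

lemma prod_Basis_cart: "(\<Prod>b\<in>(Basis :: (real^'n) set). x \<bullet> b) = (\<Prod>i\<in>UNIV. x $ i)"
proof -
  have "(Basis :: (real^'n) set) = range (\<lambda>i. axis i 1)" by (auto simp: Basis_vec_def)
  moreover have "inj (\<lambda>i::'n. axis i (1::real))" by (auto simp: inj_def axis_eq_axis)
  ultimately have "(\<Prod>b\<in>(Basis :: (real^'n) set). x \<bullet> b) = (\<Prod>i\<in>UNIV. x \<bullet> axis i 1)"
    using prod.reindex[of "\<lambda>i::'n. axis i (1::real)" UNIV "\<lambda>b. x \<bullet> b"] by (simp only: comp_def)
  then show ?thesis by (simp add: inner_axis)
qed

lemma distr_lborel_reindex:
  fixes h :: "'m::finite \<Rightarrow> 'n::finite"
  assumes h: "bij h"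
  shows "distr lborel borel (reindex h :: real^'n \<Rightarrow> real^'m) = lborel"
proof (rule lborel_eqI[symmetric])
  have meas: "(reindex h :: real^'n \<Rightarrow> real^'m) \<in> borel_measurable borel"
    by (intro borel_measurable_continuous_onI linear_continuous_on bounded_linear_reindex)
  fix l u :: "real^'m" assume "\<And>b. b \<in> Basis \<Longrightarrow> l \<bullet> b \<le> u \<bullet> b"
  then have "l \<bullet> axis i 1 \<le> u \<bullet> axis i 1" for i by (simp add: axis_in_Basis_iff)
  then have le: "l $ i \<le> u $ i" for i by (simp add: inner_axis)
  have hi: "h (inv h j) = j" "inv h (h i) = i" for i j
    using h by (simp_all add: bij_is_inj bij_is_surj surj_f_inv_f)
  have box: "reindex h -` box l u = box (reindex (inv h) l) (reindex (inv h) u)"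
    by (auto simp: mem_box_cart hi) (metis hi)+
  have "emeasure (distr lborel borel (reindex h)) (box l u) =
      emeasure lborel (box (reindex (inv h) l) (reindex (inv h) u))"
    using meas by (subst emeasure_distr) (auto simp: box)
  also have "\<dots> = (\<Prod>b\<in>Basis. (reindex (inv h) u - reindex (inv h) l) \<bullet> b)"
    by (rule emeasure_lborel_box) (auto simp: Basis_vec_def inner_axis le)
  also have "(\<Prod>b\<in>Basis. (reindex (inv h) u - reindex (inv h) l) \<bullet> b) = (\<Prod>b\<in>Basis. (u - l) \<bullet> b)"
    using prod.reindex_bij_betw[OF bij_imp_bij_inv[OF h], of "\<lambda>i. (u - l) $ i"]
    by (simp add: prod_Basis_cart)
  finally show "emeasure (distr lborel borel (reindex h)) (box l u) = (\<Prod>b\<in>Basis. (u - l) \<bullet> b)" .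
qed simp

lemma lebesgue_integral_reindex:
  fixes h :: "'m::finite \<Rightarrow> 'n::finite" and f :: "real^'m \<Rightarrow> real"
  assumes h: "bij h" and f: "f \<in> borel_measurable borel"
  shows "integrable lebesgue (\<lambda>x. f (reindex h x)) \<longleftrightarrow> integrable lebesgue f"
    and "integral\<^sup>L lebesgue (\<lambda>x. f (reindex h x)) = integral\<^sup>L lebesgue f"
proof -
  have meas: "(reindex h :: real^'n \<Rightarrow> real^'m) \<in> borel_measurable borel"
    by (intro borel_measurable_continuous_onI linear_continuous_on bounded_linear_reindex)
  have comp: "(\<lambda>x. f (reindex h x)) \<in> borel_measurable lborel"
    using measurable_compose[OF meas f] by simp
  have f': "f \<in> borel_measurable lborel" using f by simp
  show "integrable lebesgue (\<lambda>x. f (reindex h x)) \<longleftrightarrow> integrable lebesgue f"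
    unfolding integrable_completion[OF comp] integrable_completion[OF f']
    using integrable_distr_eq[of "reindex h" lborel borel f] meas f distr_lborel_reindex[OF h] by simp
  show "integral\<^sup>L lebesgue (\<lambda>x. f (reindex h x)) = integral\<^sup>L lebesgue f"
    unfolding integral_completion[OF comp] integral_completion[OF f']
    using integral_distr[of "reindex h" lborel borel f] meas f distr_lborel_reindex[OF h] by simp
qed

text \<open>Conjugation by \<open>h\<close> turns transpositions into transpositions.\<close>

lemma sign_conjugate:
  fixes h :: "'m::finite \<Rightarrow> 'n::finite"
  assumes h: "bij h" and p: "p permutes UNIV"
  shows "sign (h \<circ> p \<circ> inv h) = sign p"
  using p finite
proof (induction p rule: permutes_induct)
  case id
  have "h \<circ> inv h = id" using h by (metis bij_is_surj surj_iff)
  then show ?case by simp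
next
  case (swap a b p)
  have conj: "h \<circ> (Transposition.transpose a b \<circ> p) \<circ> inv h =
      Transposition.transpose (h a) (h b) \<circ> (h \<circ> p \<circ> inv h)"
    using h by (auto simp: fun_eq_iff Transposition.transpose_def dest: bij_is_inj[THEN injD])
  have "bij p" "bij (inv h)" using swap h by (auto simp: permutes_bij bij_imp_bij_inv)
  then have "bij (h \<circ> p \<circ> inv h)" using h by (intro bij_comp) auto
  then have perm: "permutation (h \<circ> p \<circ> inv h)" "permutation p"
    using \<open>bij p\<close> by (auto simp: permutation)
  have ne: "h a \<noteq> h b" using swap(3) h by (auto dest: bij_is_inj[THEN injD])
  show ?case
    unfolding conj sign_compose[OF permutation_swap_id perm(1)] sign_compose[OF permutation_swap_id perm(2)]
    using swap ne by (simp add: sign_swap_id comp_def)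
qed

lemma det_reindex:
  fixes h :: "'m::finite \<Rightarrow> 'n::finite" and A :: "real^'n^'n"
  assumes h: "bij h"
  shows "det (\<chi> i j. A $ h i $ h j :: real^'m^'m) = det A"
proof -
  have hi: "h (inv h j) = j" "inv h (h i) = i" for i j
    using h by (simp_all add: bij_is_inj bij_is_surj surj_f_inv_f)
  have "bij_betw (\<lambda>p. h \<circ> p \<circ> inv h) {p. p permutes (UNIV::'m set)} {p. p permutes (UNIV::'n set)}"
  proof -
    have "bij_betw h UNIV UNIV" using h .
    from bij_betw_permutations[OF this] show ?thesis by (simp add: comp_def)
  qed
  from sum.reindex_bij_betw[OF this, of "\<lambda>q. of_int (sign q) * (\<Prod>i\<in>UNIV. A $ i $ q i)"]
  have "det A = (\<Sum>p | p permutes (UNIV::'m set). of_int (sign (h \<circ> p \<circ> inv h)) *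
      (\<Prod>i\<in>UNIV. A $ i $ (h \<circ> p \<circ> inv h) i))"
    unfolding det_def by simp
  also have "\<dots> = (\<Sum>p | p permutes (UNIV::'m set). of_int (sign p) * (\<Prod>i\<in>UNIV. A $ h i $ h (p i)))"
  proof (intro sum.cong refl, goal_cases)
    case (1 p)
    have "(\<Prod>i\<in>UNIV. A $ i $ (h \<circ> p \<circ> inv h) i) = (\<Prod>i\<in>UNIV. A $ h i $ h (p i))"
      using prod.reindex_bij_betw[OF h, of "\<lambda>i. A $ i $ (h \<circ> p \<circ> inv h) i"] by (simp add: hi)
    then show ?case using sign_conjugate[OF h] 1 by simp
  qed
  finally show ?thesis unfolding det_def by simp
qed

lemma det_matrix_reindex:
  fixes h :: "'m::finite \<Rightarrow> 'n::finite" and L :: "real^'n \<Rightarrow> real^'n"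
  assumes h: "bij h"
  shows "det (matrix (\<lambda>y. reindex h (L (reindex (inv h) y)))) = det (matrix L)"
proof -
  have "reindex (inv h) (axis j 1) = (axis (h j) 1 :: real^'n)" for j
    using h by (auto simp: vec_eq_iff axis_def bij_is_surj surj_f_inv_f bij_is_inj)
  note this [simp]
  have "matrix (\<lambda>y. reindex h (L (reindex (inv h) y))) = (\<chi> i j. matrix L $ h i $ h j)"
    by (simp add: matrix_def vec_eq_iff)
  then show ?thesis using det_reindex[OF h, of "matrix L"] by simp
qed

lemma has_absolute_integral_change_of_variables_real:
  fixes f :: "real^'m::{finite,wellorder} \<Rightarrow> real" and g :: "real^'m::_ \<Rightarrow> real^'m::_"
  assumes S: "S \<in> sets lebesgue"
    and der_g: "\<And>x. x \<in> S \<Longrightarrow> (g has_derivative g' x) (at x within S)"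
    and inj: "inj_on g S"
    and int: "(\<lambda>x. \<bar>det (matrix (g' x))\<bar> * f (g x)) absolutely_integrable_on S"
  shows "f absolutely_integrable_on (g ` S)"
    and "integral (g ` S) f = integral S (\<lambda>x. \<bar>det (matrix (g' x))\<bar> * f (g x))"
proof -
  have "(\<lambda>x. \<bar>det (matrix (g' x))\<bar> *\<^sub>R vec (f(g x)) :: real ^ 1) absolutely_integrable_on S \<and>
           integral S (\<lambda>x. \<bar>det (matrix (g' x))\<bar> *\<^sub>R vec (f(g x))) = (vec b :: real ^ 1)
         \<longleftrightarrow> (\<lambda>x. vec (f x) :: real ^ 1) absolutely_integrable_on (g ` S) \<and>
           integral (g ` S) (\<lambda>x. vec (f x)) = (vec b :: real ^ 1)" for b
    by (intro has_absolute_integral_change_of_variables assms)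
  then have "(\<lambda>x. \<bar>det (matrix (g' x))\<bar> * f(g x)) absolutely_integrable_on S \<and>
           integral S (\<lambda>x. \<bar>det (matrix (g' x))\<bar> * f (g x)) = b
         \<longleftrightarrow> f absolutely_integrable_on (g ` S) \<and> integral (g ` S) f = b" for b
    by (simp add: absolutely_integrable_on_1_iff integral_on_1_eq)
  with int show "f absolutely_integrable_on (g ` S)"
    "integral (g ` S) f = integral S (\<lambda>x. \<bar>det (matrix (g' x))\<bar> * f (g x))" by auto
qed

lemma set_integral_reindex:
  fixes h :: "'m::finite \<Rightarrow> 'n::finite" and G :: "real^'n \<Rightarrow> real"
  assumes h: "bij h" and X: "open X" and G: "continuous_on X G"
  shows "set_integrable lebesgue (reindex h ` X) (\<lambda>y. G (reindex (inv h) y)) \<longleftrightarrow> set_integrable lebesgue X G"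
    and "(LINT y:reindex h ` X|lebesgue. G (reindex (inv h) y)) = (LINT x:X|lebesgue. G x)"
proof -
  have ind: "indicator (reindex h ` X) y = (indicator X (reindex (inv h) y) :: real)" for y
    using reindex_inv[OF h] by (metis (no_types, opaque_lifting) imageE imageI indicator_simps)
  have meas: "(\<lambda>x. indicator X x *\<^sub>R G x) \<in> borel_measurable borel"
    using X G by (intro borel_measurable_continuous_on_indicator) auto
  show "set_integrable lebesgue (reindex h ` X) (\<lambda>y. G (reindex (inv h) y)) \<longleftrightarrow> set_integrable lebesgue X G"
    "(LINT y:reindex h ` X|lebesgue. G (reindex (inv h) y)) = (LINT x:X|lebesgue. G x)"
    unfolding set_integrable_def set_lebesgue_integral_def ind
    using lebesgue_integral_reindex[OF bij_imp_bij_inv[OF h] meas] by auto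
qed

text \<open>Transport \<open>\<psi>\<close> to the well-ordered coordinates, apply the formula there, and transport back. Continuity
  of both integrands provides the measurability that relabelling integrals requires.\<close>

lemma integral_change_of_variables_real:
  fixes \<psi> :: "real^'n \<Rightarrow> real^'n" and f :: "real^'n \<Rightarrow> real"
  assumes X: "open X" and der: "\<And>x. x \<in> X \<Longrightarrow> (\<psi> has_derivative \<psi>' x) (at x)"
    and inj: "inj_on \<psi> X" and Y: "open (\<psi> ` X)" and f: "continuous_on (\<psi> ` X) f"
    and G: "continuous_on X (\<lambda>x. \<bar>det (matrix (\<psi>' x))\<bar> * f (\<psi> x))"
    and int: "set_integrable lebesgue X (\<lambda>x. \<bar>det (matrix (\<psi>' x))\<bar> * f (\<psi> x))"
  shows "set_integrable lebesgue (\<psi> ` X) f"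
    "(LINT y:\<psi> ` X|lebesgue. f y) = (LINT x:X|lebesgue. \<bar>det (matrix (\<psi>' x))\<bar> * f (\<psi> x))"
proof -
  define h :: "'n ranked \<Rightarrow> 'n" where "h = Rep_ranked"
  have h: "bij h" unfolding h_def by (rule bij_Rep_ranked)
  let ?R = "reindex h :: real^'n \<Rightarrow> real^'n ranked" and ?R' = "reindex (inv h) :: real^'n ranked \<Rightarrow> real^'n"
  let ?g = "\<lambda>y. ?R (\<psi> (?R' y))" and ?g' = "\<lambda>y v. ?R (\<psi>' (?R' y) (?R' v))"
  let ?G = "\<lambda>x. \<bar>det (matrix (\<psi>' x))\<bar> * f (\<psi> x)"
  let ?S = "?R ` X"
  note RR = reindex_inv[OF h]
  have S_eq: "?S = ?R' -` X" 
  proof (rule set_eqI)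
    show "y \<in> ?S \<longleftrightarrow> y \<in> ?R' -` X" for y
      using imageI[of "?R' y" X ?R] by (auto simp: RR)
  qed
  have "open ?S"
    unfolding S_eq by (intro open_vimage X linear_continuous_on bounded_linear_reindex)
  then have S: "?S \<in> sets lebesgue" by auto
  have der_g: "(?g has_derivative ?g' y) (at y within ?S)" if "y \<in> ?S" for y
  proof -
    have R: "(?R has_derivative ?R) F" "(?R' has_derivative ?R') F'" for F F'
      by (intro bounded_linear_imp_has_derivative bounded_linear_reindex)+
    have "?R' y \<in> X" using that S_eq by blast
    then have "((\<lambda>y. \<psi> (?R' y)) has_derivative (\<lambda>v. \<psi>' (?R' y) (?R' v))) (at y)"
      using has_derivative_compose[OF R(2) der] by blast
    from has_derivative_compose[OF this R(1)] show ?thesis by (rule has_derivative_at_withinI)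
  qed
  have inj_g: "inj_on ?g ?S"
    using inj by (auto simp: inj_on_def RR) (metis RR)
  have img: "?g ` ?S = ?R ` (\<psi> ` X)" by (simp add: image_image RR)
  have det: "det (matrix (?g' y)) = det (matrix (\<psi>' (?R' y)))" for y
    by (rule det_matrix_reindex[OF h])
  have eq: "(\<lambda>y. \<bar>det (matrix (?g' y))\<bar> * f (?R' (?g y))) = (\<lambda>y. ?G (?R' y))"
    by (simp add: det RR)
  have int': "(\<lambda>y. \<bar>det (matrix (?g' y))\<bar> * f (?R' (?g y))) absolutely_integrable_on ?S"
    unfolding eq using set_integral_reindex(1)[OF h X G] int by simp
  note cov = has_absolute_integral_change_of_variables_real[OF S der_g inj_g, where f = "\<lambda>y. f (?R' y)", OF _ int']
  have ai: "(\<lambda>y. f (?R' y)) absolutely_integrable_on (?R ` (\<psi> ` X))" using cov(1) img by simp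
  show "set_integrable lebesgue (\<psi> ` X) f"
    using set_integral_reindex(1)[OF h Y f] ai by simp
  have "(LINT y:\<psi> ` X|lebesgue. f y) = (LINT y:?R ` (\<psi> ` X)|lebesgue. f (?R' y))"
    using set_integral_reindex(2)[OF h Y f] by simp
  also have "\<dots> = integral (?R ` (\<psi> ` X)) (\<lambda>y. f (?R' y))"
    using ai by (rule set_lebesgue_integral_eq_integral)
  also have "\<dots> = integral ?S (\<lambda>y. ?G (?R' y))"
    using cov(2) unfolding img eq by simp
  also have "\<dots> = (LINT y:?S|lebesgue. ?G (?R' y))"
    using int' unfolding eq by (rule set_lebesgue_integral_eq_integral(2)[symmetric])
  also have "\<dots> = (LINT x:X|lebesgue. ?G x)"
    by (rule set_integral_reindex(2)[OF h X G])
  finally show "(LINT y:\<psi> ` X|lebesgue. f y) = (LINT x:X|lebesgue. ?G x)" .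
qed

lemma integral_change_of_variables_complex:
  fixes \<psi> :: "real^'n \<Rightarrow> real^'n" and f :: "real^'n \<Rightarrow> complex"
  assumes X: "open X" and der: "\<And>x. x \<in> X \<Longrightarrow> (\<psi> has_derivative \<psi>' x) (at x)"
    and inj: "inj_on \<psi> X" and Y: "open (\<psi> ` X)" and f: "continuous_on (\<psi> ` X) f"
    and f_int: "set_integrable lebesgue (\<psi> ` X) f"
    and G: "continuous_on X (\<lambda>x. \<bar>det (matrix (\<psi>' x))\<bar> *\<^sub>R f (\<psi> x))"
    and G_int: "set_integrable lebesgue X (\<lambda>x. \<bar>det (matrix (\<psi>' x))\<bar> *\<^sub>R f (\<psi> x))"
  shows "(LINT y:\<psi> ` X|lebesgue. f y) = (LINT x:X|lebesgue. \<bar>det (matrix (\<psi>' x))\<bar> *\<^sub>R f (\<psi> x))"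
proof (rule complex_eqI)
  note int = f_int[unfolded set_integrable_def] G_int[unfolded set_integrable_def]
  have "continuous_on X (\<lambda>x. \<bar>det (matrix (\<psi>' x))\<bar> * Re (f (\<psi> x)))"
    "set_integrable lebesgue X (\<lambda>x. \<bar>det (matrix (\<psi>' x))\<bar> * Re (f (\<psi> x)))"
    using continuous_on_Re[OF G] integrable_Re[OF int(2)] unfolding set_integrable_def by (simp_all add: mult.assoc)
  from integral_change_of_variables_real(2)[OF X der inj Y continuous_on_Re[OF f] this]
  show "Re (LINT y:\<psi> ` X|lebesgue. f y) = Re (LINT x:X|lebesgue. \<bar>det (matrix (\<psi>' x))\<bar> *\<^sub>R f (\<psi> x))"
    unfolding set_lebesgue_integral_def using integral_Re[OF int(1)] integral_Re[OF int(2)] by (simp add: mult.assoc)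
  have "continuous_on X (\<lambda>x. \<bar>det (matrix (\<psi>' x))\<bar> * Im (f (\<psi> x)))"
    "set_integrable lebesgue X (\<lambda>x. \<bar>det (matrix (\<psi>' x))\<bar> * Im (f (\<psi> x)))"
    using continuous_on_Im[OF G] integrable_Im[OF int(2)] unfolding set_integrable_def by (simp_all add: mult.assoc)
  from integral_change_of_variables_real(2)[OF X der inj Y continuous_on_Im[OF f] this]
  show "Im (LINT y:\<psi> ` X|lebesgue. f y) = Im (LINT x:X|lebesgue. \<bar>det (matrix (\<psi>' x))\<bar> *\<^sub>R f (\<psi> x))"
    unfolding set_lebesgue_integral_def using integral_Im[OF int(1)] integral_Im[OF int(2)] by (simp add: mult.assoc)
qed

section \<open>Test functions and their bounded sets\<close>

abbreviation deriv_sup :: "'n::finite list \<Rightarrow> (real^'n \<Rightarrow> complex) \<Rightarrow> real" where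
  "deriv_sup is \<phi> \<equiv> (SUP x. cmod (iter_partial is \<phi> x))"

abbreviation deriv_sups :: "((real^'n::finite \<Rightarrow> complex) \<Rightarrow> real) set" where
  "deriv_sups \<equiv> range (\<lambda>is. deriv_sup is)"

abbreviation dominated_on :: "(real^'n::finite) set \<Rightarrow> ((real^'n \<Rightarrow> complex) \<Rightarrow> real) \<Rightarrow> bool" where
  "dominated_on K \<equiv> dominated_by (test_functions_in K) deriv_sups"

lemma test_topology_in_eq: "test_topology_in K = lc_topology (test_functions_in K) deriv_sups"
  unfolding test_topology_in_def by (simp add: full_SetCompr_eq)

lemma test_functions_in_smooth: "\<phi> \<in> test_functions_in K \<Longrightarrow> smooth_on UNIV \<phi>"
  and test_functions_in_zero: "\<phi> \<in> test_functions_in K \<Longrightarrow> x \<notin> K \<Longrightarrow> \<phi> x = 0"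
  unfolding test_functions_in_def by auto

lemma test_functions_in_mono: "K \<subseteq> L \<Longrightarrow> test_functions_in K \<subseteq> test_functions_in L"
  unfolding test_functions_in_def by blast

lemma test_functions_in_subset:
  "compact K \<Longrightarrow> K \<subseteq> X \<Longrightarrow> test_functions_in K \<subseteq> test_functions X"
  unfolding test_functions_def by blast

lemma test_functionsE:
  assumes "\<phi> \<in> test_functions X"
  obtains K where "compact K" "K \<subseteq> X" "\<phi> \<in> test_functions_in K"
  using assms unfolding test_functions_def by blast

lemma test_functions_two:
  assumes "\<phi> \<in> test_functions X" "\<eta> \<in> test_functions X"
  obtains K where "compact K" "K \<subseteq> X" "\<phi> \<in> test_functions_in K" "\<eta> \<in> test_functions_in K"
proof -
  obtain K L where "compact K" "K \<subseteq> X" "\<phi> \<in> test_functions_in K"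
    "compact L" "L \<subseteq> X" "\<eta> \<in> test_functions_in L"
    using assms by (metis test_functionsE)
  then show ?thesis
    using that[of "K \<union> L"] test_functions_in_mono[of K "K \<union> L"] test_functions_in_mono[of L "K \<union> L"] by auto
qed

lemma fun_subspace_test_functions_in: "fun_subspace (test_functions_in K)"
  unfolding fun_subspace_def test_functions_in_def
  by (auto intro: smooth_on_const smooth_on_add smooth_on_mult[OF open_UNIV smooth_on_const[OF open_UNIV]])

lemma fun_subspace_test_functions: "fun_subspace (test_functions X)"
  unfolding fun_subspace_def
proof (intro conjI ballI allI)
  have "compact {}" "{} \<subseteq> X" by auto
  then show "(\<lambda>x. 0) \<in> test_functions X"
    using fun_subspace_0[OF fun_subspace_test_functions_in] test_functions_in_subset by blast
  show "(\<lambda>x. c * f x) \<in> test_functions X" if "f \<in> test_functions X" for f c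
    using that fun_subspace_scale[OF fun_subspace_test_functions_in] unfolding test_functions_def by blast
  show "(\<lambda>x. f x + g x) \<in> test_functions X" if fg: "f \<in> test_functions X" "g \<in> test_functions X" for f g
  proof -
    obtain K where "compact K" "K \<subseteq> X" "f \<in> test_functions_in K" "g \<in> test_functions_in K"
      using test_functions_two[OF fg] .
    then show ?thesis
      using fun_subspace_add[OF fun_subspace_test_functions_in] test_functions_in_subset by blast
  qed
qed

lemma test_function_iter_partial:
  assumes "\<phi> \<in> test_functions_in K" "compact K"
  shows "iter_partial is \<phi> \<in> test_functions_in K"
  using assms iter_partial_zero_outside[of K \<phi> _ "is"] smooth_on_iter_partial
  unfolding test_functions_in_def by (auto simp: compact_imp_closed)

lemma test_function_bounded:
  assumes "\<phi> \<in> test_functions X"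
  shows "bdd_above (range (\<lambda>x. cmod (iter_partial is \<phi> x)))"
proof -
  obtain K where K: "compact K" "K \<subseteq> X" "\<phi> \<in> test_functions_in K" using test_functionsE[OF assms] .
  have "continuous_on K (\<lambda>x. cmod (iter_partial is \<phi> x))"
    using smooth_on_continuous[OF test_functions_in_smooth[OF K(3)]] continuous_on_subset
    by (intro continuous_on_norm) blast
  then have "bounded ((\<lambda>x. cmod (iter_partial is \<phi> x)) ` K)"
    using compact_continuous_image K(1) compact_imp_bounded by blast
  then obtain M where M: "\<And>x. x \<in> K \<Longrightarrow> cmod (iter_partial is \<phi> x) \<le> M"
    unfolding bounded_iff by auto
  have "cmod (iter_partial is \<phi> x) \<le> max M 0" for x
    using M[of x] test_functions_in_zero[OF test_function_iter_partial[OF K(3,1)], of x "is"]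
    by (cases "x \<in> K") auto
  then show ?thesis by (intro bdd_aboveI2)
qed

lemma norm_iter_partial_le_deriv_sup:
  assumes "\<phi> \<in> test_functions X"
  shows "cmod (iter_partial is \<phi> x) \<le> deriv_sup is \<phi>"
  using test_function_bounded[OF assms] by (rule cSUP_upper[OF UNIV_I])

lemma norm_le_deriv_sup: "\<phi> \<in> test_functions X \<Longrightarrow> cmod (\<phi> x) \<le> deriv_sup [] \<phi>"
  using norm_iter_partial_le_deriv_sup[of \<phi> X "[]" x] by simp

lemma deriv_sup_le: "(\<And>x. cmod (iter_partial is \<phi> x) \<le> M) \<Longrightarrow> deriv_sup is \<phi> \<le> M"
  by (rule cSUP_least) auto

lemma deriv_sup_nonneg:
  assumes "\<phi> \<in> test_functions X" shows "0 \<le> deriv_sup is \<phi>"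
  using norm_iter_partial_le_deriv_sup[OF assms, of "is" 0] norm_ge_zero order_trans by blast

lemma test_functions_smooth: "\<phi> \<in> test_functions X \<Longrightarrow> smooth_on UNIV \<phi>"
  using test_functionsE test_functions_in_smooth by metis

lemma seminorm_deriv_sup: "seminorm_on (test_functions X) (deriv_sup is)"
  unfolding seminorm_on_def
proof (intro conjI ballI allI)
  fix f c assume f: "f \<in> test_functions X"
  show "0 \<le> deriv_sup is f" using deriv_sup_nonneg[OF f] .
  have eq: "cmod (iter_partial is (\<lambda>x. c * f x) x) = cmod c * cmod (iter_partial is f x)" for x
    using iter_partial_cmult[OF test_functions_smooth[OF f] open_UNIV UNIV_I] by (simp add: norm_mult)
  show "deriv_sup is (\<lambda>x. c * f x) = cmod c * deriv_sup is f"
    unfolding eq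
  proof (cases "c = 0")
    case False
    show "(SUP x. cmod c * cmod (iter_partial is f x)) = cmod c * deriv_sup is f"
    proof (rule antisym)
      show "(SUP x. cmod c * cmod (iter_partial is f x)) \<le> cmod c * deriv_sup is f"
        using norm_iter_partial_le_deriv_sup[OF f] by (intro cSUP_least) (auto intro: mult_left_mono)
      have "bdd_above (range (\<lambda>x. cmod c * cmod (iter_partial is f x)))"
        using norm_iter_partial_le_deriv_sup[OF f]
        by (intro bdd_aboveI[of _ "cmod c * deriv_sup is f"]) (auto intro: mult_left_mono)
      then have "cmod c * cmod (iter_partial is f x) \<le> (SUP x. cmod c * cmod (iter_partial is f x))" for x
        by (rule cSUP_upper[OF UNIV_I])
      then have "deriv_sup is f \<le> (SUP x. cmod c * cmod (iter_partial is f x)) / cmod c"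
        using False by (intro deriv_sup_le) (simp add: field_simps)
      then show "cmod c * deriv_sup is f \<le> (SUP x. cmod c * cmod (iter_partial is f x))"
        using False by (simp add: field_simps)
    qed
  qed simp
next
  fix f g assume fg: "f \<in> test_functions X" "g \<in> test_functions X"
  show "deriv_sup is (\<lambda>x. f x + g x) \<le> deriv_sup is f + deriv_sup is g"
  proof (rule deriv_sup_le)
    fix x
    show "cmod (iter_partial is (\<lambda>x. f x + g x) x) \<le> deriv_sup is f + deriv_sup is g"
      using iter_partial_add[OF test_functions_smooth[OF fg(1)] test_functions_smooth[OF fg(2)] open_UNIV UNIV_I, of "is" x]
        norm_iter_partial_le_deriv_sup[OF fg(1), of "is" x] norm_iter_partial_le_deriv_sup[OF fg(2), of "is" x]
        norm_triangle_ineq[of "iter_partial is f x" "iter_partial is g x"] by simp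
  qed
qed

lemma seminorm_deriv_sups_in:
  assumes "compact K" "q \<in> deriv_sups"
  shows "seminorm_on (test_functions_in K) q"
  using assms(2) seminorm_on_subset[OF seminorm_deriv_sup test_functions_in_subset[OF assms(1) order_refl]]
  by auto

lemma dominated_by_deriv_sups_iff:
  assumes K: "compact K"
  shows "dominated_on K p \<longleftrightarrow>
    (\<exists>F C. finite F \<and> C > 0 \<and> (\<forall>\<phi>\<in>test_functions_in K. p \<phi> \<le> C * (\<Sum>is\<in>F. deriv_sup is \<phi>)))"
proof
  assume "dominated_on K p"
  then obtain Q C where Q: "finite Q" "Q \<subseteq> deriv_sups" "C > 0"
      "\<And>f. f \<in> test_functions_in K \<Longrightarrow> p f \<le> C * (\<Sum>q\<in>Q. q f)"
    unfolding dominated_by_def by blast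
  obtain F where F: "finite F" "Q = (\<lambda>is. deriv_sup is) ` F"
    using finite_subset_image[OF Q(1,2)] by blast
  have "p \<phi> \<le> C * (\<Sum>is\<in>F. deriv_sup is \<phi>)" if \<phi>: "\<phi> \<in> test_functions_in K" for \<phi>
  proof -
    have "(\<Sum>q\<in>(\<lambda>is. deriv_sup is) ` F. q \<phi>) \<le> (\<Sum>is\<in>F. deriv_sup is \<phi>)"
      using sum_image_le[OF F(1), of "\<lambda>q. q \<phi>" "\<lambda>is. deriv_sup is"]
        deriv_sup_nonneg test_functions_in_subset[OF K order_refl] \<phi> by (auto simp: comp_def)
    then show ?thesis using Q(3) Q(4)[OF \<phi>] F(2) by (meson less_imp_le mult_left_mono order_trans)
  qed
  then show "\<exists>F C. finite F \<and> C > 0 \<and> (\<forall>\<phi>\<in>test_functions_in K. p \<phi> \<le> C * (\<Sum>is\<in>F. deriv_sup is \<phi>))"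
    using F(1) Q(3) by blast
next
  assume "\<exists>F C. finite F \<and> C > 0 \<and> (\<forall>\<phi>\<in>test_functions_in K. p \<phi> \<le> C * (\<Sum>is\<in>F. deriv_sup is \<phi>))"
  then obtain F C where F: "finite F" "C > 0"
    "\<And>\<phi>. \<phi> \<in> test_functions_in K \<Longrightarrow> p \<phi> \<le> C * (\<Sum>is\<in>F. deriv_sup is \<phi>)" by blast
  have "dominated_on K (\<lambda>\<phi>. C * (\<Sum>is\<in>F. deriv_sup is \<phi>))"
    by (rule dominated_by_scale[OF dominated_by_sum[OF seminorm_deriv_sups_in[OF K]]])
      (use F in \<open>auto intro: dominated_by_member\<close>)
  then show "dominated_on K p"
    using dominated_by_mono F(3) by blast
qed

text \<open>The seminorms that generate the inductive limit topology, their continuity on the steps expressed by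
  estimates.\<close>

definition test_seminorms :: "(real^'n::finite) set \<Rightarrow> ((real^'n \<Rightarrow> complex) \<Rightarrow> real) set" where
  "test_seminorms X = {p. seminorm_on (test_functions X) p \<and>
     (\<forall>K. compact K \<and> K \<subseteq> X \<longrightarrow> dominated_on K p)}"

lemma test_topology_eq: "test_topology X = lc_topology (test_functions X) (test_seminorms X)"
proof -
  have "continuous_map (test_topology_in K) euclideanreal p \<longleftrightarrow>
      dominated_on K p"
    if "seminorm_on (test_functions X) p" "compact K" "K \<subseteq> X" for p K
    using continuous_seminorm_lc_iff[OF seminorm_deriv_sups_in[OF that(2)] fun_subspace_test_functions_in, of deriv_sups p]
      seminorm_on_subset[OF that(1) test_functions_in_subset[OF that(2,3)]]
    unfolding continuous_seminorm_def topspace_lc_topology test_topology_in_eq by blast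
  then have "{p. seminorm_on (test_functions X) p \<and>
         (\<forall>K. compact K \<and> K \<subseteq> X \<longrightarrow> continuous_map (test_topology_in K) euclideanreal p)} = test_seminorms X"
    unfolding test_seminorms_def by auto
  then show ?thesis unfolding test_topology_def by simp
qed

lemma seminorm_test_seminorms: "q \<in> test_seminorms X \<Longrightarrow> seminorm_on (test_functions X) q"
  unfolding test_seminorms_def by blast

text \<open>The generating family is saturated: domination by members of the family restricts, on each compact
  set, to domination by derivative suprema.\<close>

lemma continuous_seminorm_test_topology:
  "continuous_seminorm (test_topology X) p \<longleftrightarrow> p \<in> test_seminorms X"
proof -
  have iff: "continuous_seminorm (test_topology X) p \<longleftrightarrow>
      seminorm_on (test_functions X) p \<and> dominated_by (test_functions X) (test_seminorms X) p"
    unfolding test_topology_eq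
    by (rule continuous_seminorm_lc_iff[OF seminorm_test_seminorms fun_subspace_test_functions])
  show ?thesis
  proof
    assume "continuous_seminorm (test_topology X) p"
    then have p: "seminorm_on (test_functions X) p" "dominated_by (test_functions X) (test_seminorms X) p"
      using iff by simp_all
    have "dominated_on K p" if K: "compact K" "K \<subseteq> X" for K
    proof (rule dominated_by_trans[OF seminorm_deriv_sups_in[OF K(1)] _
            dominated_by_subset[OF p(2) test_functions_in_subset[OF K]]])
      show "dominated_on K r" if "r \<in> test_seminorms X" for r
        using that K unfolding test_seminorms_def by simp
    qed simp
    then show "p \<in> test_seminorms X" using p(1) unfolding test_seminorms_def by simp
  next
    assume p: "p \<in> test_seminorms X"
    then show "continuous_seminorm (test_topology X) p"
      using iff dominated_by_member[OF p] seminorm_test_seminorms[OF p] by simp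
  qed
qed

lemma deriv_sup_in_test_seminorms: "deriv_sup is \<in> test_seminorms X"
  unfolding test_seminorms_def by (auto intro: seminorm_deriv_sup dominated_by_member)

text \<open>Otherwise there are members \<open>\<phi>\<^sub>n\<close> with \<open>\<phi>\<^sub>n x\<^sub>n \<noteq> 0\<close> at points \<open>x\<^sub>n\<close> that leave every compact subset.
  The seminorm \<open>\<Sum>\<^sub>n n \<bar>\<phi> x\<^sub>n\<bar> / \<bar>\<phi>\<^sub>n x\<^sub>n\<bar>\<close> is continuous, being a finite sum on each compact set, and it is
  at least \<open>n\<close> at \<open>\<phi>\<^sub>n\<close>.\<close>

lemma bounded_test_functions_common_support:
  assumes X: "open X" and B: "lc_bounded (test_topology X) B"
  obtains K where "compact K" "K \<subseteq> X" "B \<subseteq> test_functions_in K"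
proof (rule ccontr)
  assume no: "\<not> thesis"
  have "\<exists>C :: nat \<Rightarrow> _. (\<forall>n. compact (C n)) \<and> (\<forall>n. C n \<subseteq> X) \<and>
      (\<forall>K. compact K \<and> K \<subseteq> X \<longrightarrow> (\<exists>N. \<forall>n\<ge>N. K \<subseteq> C n))"
    by (rule open_Union_compact_subsets[OF X]) blast
  then obtain C :: "nat \<Rightarrow> (real^'a) set" where C: "\<And>n. compact (C n)" "\<And>n. C n \<subseteq> X"
      "\<And>K. compact K \<Longrightarrow> K \<subseteq> X \<Longrightarrow> \<exists>N. \<forall>n\<ge>N. K \<subseteq> C n"
    by metis
  have BX: "B \<subseteq> test_functions X"
    using B unfolding lc_bounded_def test_topology_eq topspace_lc_topology by blast
  have "\<exists>\<phi> x. \<phi> \<in> B \<and> x \<notin> C n \<and> \<phi> x \<noteq> 0" for n :: nat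
  proof (rule ccontr)
    assume "\<nexists>\<phi> x. \<phi> \<in> B \<and> x \<notin> C n \<and> \<phi> x \<noteq> 0"
    then have "B \<subseteq> test_functions_in (C n)"
      using BX test_functions_smooth unfolding test_functions_in_def by fastforce
    then show False using no that C(1,2) by blast
  qed
  then obtain \<phi> x where \<phi>: "\<And>n::nat. \<phi> n \<in> B" "\<And>n. x n \<notin> C n" "\<And>n. \<phi> n (x n) \<noteq> 0"
    by metis
  define c where "c n = real n / cmod (\<phi> n (x n))" for n
  have c: "c n \<ge> 0" for n unfolding c_def by simp
  define p where "p f = (\<Sum>n. c n * cmod (f (x n)))" for f :: "real^'a \<Rightarrow> complex"
  have fin: "\<exists>N. \<forall>f\<in>test_functions_in K. p f = (\<Sum>n<N. c n * cmod (f (x n)))"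
    if K: "compact K" "K \<subseteq> X" for K
  proof -
    obtain N where N: "\<And>n. n \<ge> N \<Longrightarrow> K \<subseteq> C n" using C(3)[OF K] by blast
    have "p f = (\<Sum>n<N. c n * cmod (f (x n)))" if f: "f \<in> test_functions_in K" for f
      unfolding p_def
    proof (rule suminf_finite)
      fix n assume "n \<notin> {..<N}"
      then have "x n \<notin> K" using N[of n] \<phi>(2)[of n] by auto
      then show "c n * cmod (f (x n)) = 0" using test_functions_in_zero[OF f] by simp
    qed simp
    then show ?thesis by blast
  qed
  have "seminorm_on (test_functions X) p"
    unfolding seminorm_on_def
  proof (intro conjI ballI allI)
    fix f a assume f: "f \<in> test_functions X"
    obtain K where K: "compact K" "K \<subseteq> X" "f \<in> test_functions_in K" using test_functionsE[OF f] .
    obtain N where N: "\<And>f. f \<in> test_functions_in K \<Longrightarrow> p f = (\<Sum>n<N. c n * cmod (f (x n)))"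
      using fin[OF K(1,2)] by blast
    show "0 \<le> p f" unfolding N[OF K(3)] by (intro sum_nonneg mult_nonneg_nonneg c) auto
    show "p (\<lambda>x. a * f x) = cmod a * p f"
      unfolding N[OF K(3)] N[OF fun_subspace_scale[OF fun_subspace_test_functions_in K(3)]]
      by (simp add: norm_mult sum_distrib_left mult_ac)
  next
    fix f g assume fg: "f \<in> test_functions X" "g \<in> test_functions X"
    obtain K where K: "compact K" "K \<subseteq> X" "f \<in> test_functions_in K" "g \<in> test_functions_in K"
      using test_functions_two[OF fg] .
    obtain N where N: "\<And>f. f \<in> test_functions_in K \<Longrightarrow> p f = (\<Sum>n<N. c n * cmod (f (x n)))"
      using fin[OF K(1,2)] by blast
    show "p (\<lambda>x. f x + g x) \<le> p f + p g"
      unfolding N[OF K(3)] N[OF K(4)] N[OF fun_subspace_add[OF fun_subspace_test_functions_in K(3,4)]]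
        sum.distrib[symmetric] distrib_left[symmetric]
      by (intro sum_mono mult_left_mono norm_triangle_ineq c)
  qed
  moreover have "dominated_on K p" if K: "compact K" "K \<subseteq> X" for K
  proof -
    obtain N where N: "\<And>f. f \<in> test_functions_in K \<Longrightarrow> p f = (\<Sum>n<N. c n * cmod (f (x n)))"
      using fin[OF K(1,2)] by blast
    have "dominated_on K (\<lambda>f. c n * deriv_sup [] f)" for n
      by (intro dominated_by_scale dominated_by_member c rangeI)
    then have "dominated_on K (\<lambda>f. \<Sum>n<N. c n * deriv_sup [] f)"
      by (intro dominated_by_sum[OF seminorm_deriv_sups_in[OF K(1)]])
    then show ?thesis
    proof (rule dominated_by_mono)
      fix f assume "f \<in> test_functions_in K"
      then show "p f \<le> (\<Sum>n<N. c n * deriv_sup [] f)"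
        unfolding N[OF \<open>f \<in> test_functions_in K\<close>]
        using test_functions_in_subset[OF K] by (intro sum_mono mult_left_mono norm_le_deriv_sup c) blast
    qed
  qed
  ultimately have "p \<in> test_seminorms X" unfolding test_seminorms_def by blast
  then have "continuous_seminorm (test_topology X) p"
    by (simp only: continuous_seminorm_test_topology)
  then have "bdd_above (p ` B)"
    using B unfolding lc_bounded_def by simp
  then obtain M where M: "\<And>f. f \<in> B \<Longrightarrow> p f \<le> M" unfolding bdd_above_def by blast
  obtain n where n: "real n > M" using reals_Archimedean2 by blast
  obtain K where K: "compact K" "K \<subseteq> X" "\<phi> n \<in> test_functions_in K"
    using \<phi>(1) BX test_functionsE by blast
  have "summable (\<lambda>m. c m * cmod (\<phi> n (x m)))"
  proof -
    obtain N where N: "\<And>n. n \<ge> N \<Longrightarrow> K \<subseteq> C n" using C(3)[OF K(1,2)] by blast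
    show ?thesis
    proof (rule summable_finite)
      fix m assume "m \<notin> {..<N}"
      then have "x m \<notin> K" using N[of m] \<phi>(2)[of m] by auto
      then show "c m * cmod (\<phi> n (x m)) = 0" using test_functions_in_zero[OF K(3)] by simp
    qed simp
  qed
  then have "(\<Sum>m\<in>{n}. c m * cmod (\<phi> n (x m))) \<le> p (\<phi> n)"
    unfolding p_def by (rule sum_le_suminf) (auto intro: mult_nonneg_nonneg c)
  then have "real n \<le> p (\<phi> n)" using \<phi>(3)[of n] by (simp add: c_def)
  then show False using M[OF \<phi>(1)[of n]] n by linarith
qed

lemma dominated_bdd_above:
  assumes K: "compact K" and B: "B \<subseteq> test_functions_in K" "\<And>is. bdd_above (deriv_sup is ` B)"
    and p: "dominated_on K p"
  shows "bdd_above (p ` B)"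
proof -
  obtain F C where F: "finite F" "C > 0"
    "\<And>\<phi>. \<phi> \<in> test_functions_in K \<Longrightarrow> p \<phi> \<le> C * (\<Sum>is\<in>F. deriv_sup is \<phi>)"
    using p unfolding dominated_by_deriv_sups_iff[OF K] by blast
  have "\<exists>M. \<forall>is. \<forall>\<phi>\<in>B. deriv_sup is \<phi> \<le> M is"
    using B(2) unfolding bdd_above_def by (auto intro!: choice)
  then obtain M where M: "\<And>is \<phi>. \<phi> \<in> B \<Longrightarrow> deriv_sup is \<phi> \<le> M is" by blast
  have "p \<phi> \<le> C * (\<Sum>is\<in>F. M is)" if \<phi>: "\<phi> \<in> B" for \<phi>
  proof -
    have "C * (\<Sum>is\<in>F. deriv_sup is \<phi>) \<le> C * (\<Sum>is\<in>F. M is)"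
      using M[OF \<phi>] F(2) by (intro mult_left_mono sum_mono) auto
    then show ?thesis using F(3) B(1) \<phi> by (meson order_trans subsetD)
  qed
  then show ?thesis by (intro bdd_aboveI2)
qed

text \<open>Each derivative supremum is a continuous seminorm, and on a common compact support all continuous
  seminorms are bounded by them.\<close>

lemma lc_bounded_test_topology_iff:
  assumes X: "open X"
  shows "lc_bounded (test_topology X) B \<longleftrightarrow>
    (\<exists>K. compact K \<and> K \<subseteq> X \<and> B \<subseteq> test_functions_in K \<and> (\<forall>is. bdd_above (deriv_sup is ` B)))"
proof
  assume B: "lc_bounded (test_topology X) B"
  obtain K where "compact K" "K \<subseteq> X" "B \<subseteq> test_functions_in K"
    using bounded_test_functions_common_support[OF X B] .
  moreover have "bdd_above (deriv_sup is ` B)" for "is"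
  proof -
    have "continuous_seminorm (test_topology X) (deriv_sup is)"
      by (simp only: continuous_seminorm_test_topology deriv_sup_in_test_seminorms)
    then show ?thesis using B unfolding lc_bounded_def by simp
  qed
  ultimately show "\<exists>K. compact K \<and> K \<subseteq> X \<and> B \<subseteq> test_functions_in K \<and> (\<forall>is. bdd_above (deriv_sup is ` B))"
    by blast
next
  assume "\<exists>K. compact K \<and> K \<subseteq> X \<and> B \<subseteq> test_functions_in K \<and> (\<forall>is. bdd_above (deriv_sup is ` B))"
  then obtain K where K: "compact K" "K \<subseteq> X" "B \<subseteq> test_functions_in K"
    "\<And>is. bdd_above (deriv_sup is ` B)" by blast
  have "bdd_above (p ` B)" if p: "continuous_seminorm (test_topology X) p" for p
  proof (rule dominated_bdd_above[OF K(1,3,4)])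
    show "dominated_on K p"
      using p K(1,2) unfolding continuous_seminorm_test_topology test_seminorms_def by blast
  qed
  moreover have "B \<subseteq> topspace (test_topology X)"
    using K(3) test_functions_in_subset[OF K(1,2)] unfolding test_topology_eq topspace_lc_topology by blast
  ultimately show "lc_bounded (test_topology X) B" unfolding lc_bounded_def by blast
qed

lemma lc_bounded_Un:
  assumes "lc_bounded \<tau> A" "lc_bounded \<tau> B"
  shows "lc_bounded \<tau> (A \<union> B)"
  using assms unfolding lc_bounded_def by (auto simp: image_Un bdd_above_Un)

lemma lc_bounded_finite:
  assumes "finite A" "A \<subseteq> topspace \<tau>"
  shows "lc_bounded \<tau> A"
  using assms unfolding lc_bounded_def by auto

lemma lc_bounded_UN:
  assumes "finite I" "\<And>i. i \<in> I \<Longrightarrow> lc_bounded \<tau> (A i)"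
  shows "lc_bounded \<tau> (\<Union>i\<in>I. A i)"
  using assms by (induction I rule: finite_induct) (auto intro: lc_bounded_Un lc_bounded_finite)

lemma topspace_test_topology: "topspace (test_topology X) = test_functions X"
  unfolding test_topology_eq topspace_lc_topology ..

section \<open>Distributions and their strong topology\<close>

lemma distribution_scale:
    "u \<in> distributions X \<Longrightarrow> \<phi> \<in> test_functions X \<Longrightarrow> u (\<lambda>x. c * \<phi> x) = c * u \<phi>"
  and distribution_add:
    "u \<in> distributions X \<Longrightarrow> \<phi> \<in> test_functions X \<Longrightarrow> \<eta> \<in> test_functions X \<Longrightarrow>
      u (\<lambda>x. \<phi> x + \<eta> x) = u \<phi> + u \<eta>"
  and distribution_outside: "u \<in> distributions X \<Longrightarrow> \<phi> \<notin> test_functions X \<Longrightarrow> u \<phi> = 0"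
  unfolding distributions_def by auto

lemma distribution_diff:
  assumes "u \<in> distributions X" "\<phi> \<in> test_functions X" "\<eta> \<in> test_functions X"
  shows "u (\<lambda>x. \<phi> x - \<eta> x) = u \<phi> - u \<eta>"
  by (rule linear_form_diff[OF fun_subspace_test_functions assms(2,3)])
    (simp_all add: distribution_scale[OF assms(1)] distribution_add[OF assms(1)])

text \<open>Continuity of a linear form on the inductive limit amounts to the classical estimates by finitely many
  derivatives on each compact set.\<close>

lemma distributions_iff:
  "u \<in> distributions X \<longleftrightarrow>
     (\<forall>\<phi>\<in>test_functions X. \<forall>c. u (\<lambda>x. c * \<phi> x) = c * u \<phi>) \<and>
     (\<forall>\<phi>\<in>test_functions X. \<forall>\<eta>\<in>test_functions X. u (\<lambda>x. \<phi> x + \<eta> x) = u \<phi> + u \<eta>) \<and>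
     (\<forall>K. compact K \<and> K \<subseteq> X \<longrightarrow> dominated_on K (\<lambda>\<phi>. cmod (u \<phi>))) \<and>
     (\<forall>\<phi>. \<phi> \<notin> test_functions X \<longrightarrow> u \<phi> = 0)"
proof -
  have "continuous_map (test_topology X) euclidean u \<longleftrightarrow>
      (\<forall>K. compact K \<and> K \<subseteq> X \<longrightarrow> dominated_on K (\<lambda>\<phi>. cmod (u \<phi>)))"
    if lin: "\<forall>\<phi>\<in>test_functions X. \<forall>c. u (\<lambda>x. c * \<phi> x) = c * u \<phi>"
      "\<forall>\<phi>\<in>test_functions X. \<forall>\<eta>\<in>test_functions X. u (\<lambda>x. \<phi> x + \<eta> x) = u \<phi> + u \<eta>"
  proof -
    have sn: "seminorm_on (test_functions X) (\<lambda>\<phi>. cmod (u \<phi>))"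
      using lin by (intro seminorm_on_cmod_linear) auto
    show ?thesis
    proof
      assume "continuous_map (test_topology X) euclidean u"
      then have "continuous_seminorm (test_topology X) (\<lambda>\<phi>. cmod (u \<phi>))"
        using sn unfolding continuous_seminorm_def topspace_test_topology
        by (auto intro: continuous_map_norm)
      then have "(\<lambda>\<phi>. cmod (u \<phi>)) \<in> test_seminorms X"
        by (simp only: continuous_seminorm_test_topology)
      then show "\<forall>K. compact K \<and> K \<subseteq> X \<longrightarrow> dominated_on K (\<lambda>\<phi>. cmod (u \<phi>))"
        unfolding test_seminorms_def by simp
    next
      assume "\<forall>K. compact K \<and> K \<subseteq> X \<longrightarrow> dominated_on K (\<lambda>\<phi>. cmod (u \<phi>))"
      then have "(\<lambda>\<phi>. cmod (u \<phi>)) \<in> test_seminorms X"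
        unfolding test_seminorms_def using sn by simp
      then show "continuous_map (test_topology X) euclidean u"
        unfolding test_topology_eq using lin
        by (intro dominated_imp_continuous_form[OF seminorm_test_seminorms fun_subspace_test_functions])
          (auto intro: dominated_by_member)
    qed
  qed
  then show ?thesis unfolding distributions_def by auto
qed

lemma distribution_dominated:
  "u \<in> distributions X \<Longrightarrow> compact K \<Longrightarrow> K \<subseteq> X \<Longrightarrow>
    dominated_on K (\<lambda>\<phi>. cmod (u \<phi>))"
  unfolding distributions_iff by simp

lemma distribution_continuous_seminorm:
  assumes "u \<in> distributions X"
  shows "continuous_seminorm (test_topology X) (\<lambda>\<phi>. cmod (u \<phi>))"
  unfolding continuous_seminorm_test_topology test_seminorms_def
  using assms distribution_dominated[OF assms] distribution_scale[OF assms] distribution_add[OF assms]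
  by (auto intro!: seminorm_on_cmod_linear)

lemma fun_subspace_distributions: "fun_subspace (distributions X)"
  unfolding fun_subspace_def
proof (intro conjI ballI allI)
  show "(\<lambda>\<phi>. 0) \<in> distributions X"
    unfolding distributions_iff by (simp add: dominated_by_zero)
next
  fix u c assume u: "u \<in> distributions X"
  have "dominated_on K (\<lambda>\<phi>. cmod (c * u \<phi>))" if "compact K" "K \<subseteq> X" for K
    using dominated_by_scale[OF distribution_dominated[OF u that], of "cmod c"] by (simp add: norm_mult)
  then show "(\<lambda>\<phi>. c * u \<phi>) \<in> distributions X"
    using u unfolding distributions_iff by (simp add: algebra_simps)
next
  fix u v assume u: "u \<in> distributions X" and v: "v \<in> distributions X"
  have "dominated_on K (\<lambda>\<phi>. cmod (u \<phi> + v \<phi>))" if K: "compact K" "K \<subseteq> X" for K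
    by (rule dominated_by_mono[OF dominated_by_add[OF seminorm_deriv_sups_in[OF K(1)]
            distribution_dominated[OF u K] distribution_dominated[OF v K]]])
      (auto intro: norm_triangle_ineq)
  then show "(\<lambda>\<phi>. u \<phi> + v \<phi>) \<in> distributions X"
    using u v unfolding distributions_iff by (simp add: algebra_simps)
qed

abbreviation sup_on :: "'a set \<Rightarrow> ('a \<Rightarrow> complex) \<Rightarrow> real" where
  "sup_on B u \<equiv> (SUP \<phi>\<in>B. cmod (u \<phi>))"

definition strong_seminorms :: "(real^'n::finite) set \<Rightarrow> (((real^'n \<Rightarrow> complex) \<Rightarrow> complex) \<Rightarrow> real) set" where
  "strong_seminorms X = {sup_on B | B. lc_bounded (test_topology X) B \<and> B \<noteq> {}}"

lemma strong_topology_eq: "strong_topology X = lc_topology (distributions X) (strong_seminorms X)"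
  unfolding strong_topology_def strong_seminorms_def ..

lemma topspace_strong_topology: "topspace (strong_topology X) = distributions X"
  unfolding strong_topology_eq topspace_lc_topology ..

lemma distribution_bdd_above:
  assumes "u \<in> distributions X" "lc_bounded (test_topology X) B"
  shows "bdd_above ((\<lambda>\<phi>. cmod (u \<phi>)) ` B)"
  using assms distribution_continuous_seminorm[OF assms(1)] unfolding lc_bounded_def by simp

lemma distribution_le_sup_on:
  assumes "u \<in> distributions X" "lc_bounded (test_topology X) B" "\<phi> \<in> B"
  shows "cmod (u \<phi>) \<le> sup_on B u"
  using cSUP_upper[OF assms(3) distribution_bdd_above[OF assms(1,2)]] .

lemma seminorm_sup_on:
  assumes B: "lc_bounded (test_topology X) B" "B \<noteq> {}"
  shows "seminorm_on (distributions X) (sup_on B)"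
  unfolding seminorm_on_def
proof (intro conjI ballI allI)
  obtain \<phi> where \<phi>: "\<phi> \<in> B" using B(2) by blast
  fix u c assume u: "u \<in> distributions X"
  note le = distribution_le_sup_on[OF u B(1)]
  show nonneg: "0 \<le> sup_on B u" using le[OF \<phi>] norm_ge_zero order_trans by blast
  show "sup_on B (\<lambda>\<phi>. c * u \<phi>) = cmod c * sup_on B u"
  proof (rule antisym)
    show "sup_on B (\<lambda>\<phi>. c * u \<phi>) \<le> cmod c * sup_on B u"
      using le B(2) by (intro cSUP_least) (auto simp: norm_mult intro: mult_left_mono)
    have cu: "(\<lambda>\<phi>. c * u \<phi>) \<in> distributions X"
      using fun_subspace_scale[OF fun_subspace_distributions u] .
    show "cmod c * sup_on B u \<le> sup_on B (\<lambda>\<phi>. c * u \<phi>)"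
    proof (cases "c = 0")
      case True
      then show ?thesis using B(2) by simp
    next
      case False
      have "cmod (u \<eta>) \<le> sup_on B (\<lambda>\<phi>. c * u \<phi>) / cmod c" if "\<eta> \<in> B" for \<eta>
        using distribution_le_sup_on[OF cu B(1) that] False by (simp add: norm_mult field_simps)
      then have "sup_on B u \<le> sup_on B (\<lambda>\<phi>. c * u \<phi>) / cmod c"
        using B(2) by (intro cSUP_least)
      then show ?thesis using False by (simp add: field_simps)
    qed
  qed
next
  fix u v assume u: "u \<in> distributions X" and v: "v \<in> distributions X"
  show "sup_on B (\<lambda>\<phi>. u \<phi> + v \<phi>) \<le> sup_on B u + sup_on B v"
    using B(2) by (intro cSUP_least order_trans[OF norm_triangle_ineq] add_mono
        distribution_le_sup_on[OF u B(1)] distribution_le_sup_on[OF v B(1)])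
qed

lemma seminorm_strong_seminorms: "q \<in> strong_seminorms X \<Longrightarrow> seminorm_on (distributions X) q"
  unfolding strong_seminorms_def using seminorm_sup_on by blast

lemma strong_seminormsI:
  "lc_bounded (test_topology X) B \<Longrightarrow> B \<noteq> {} \<Longrightarrow> sup_on B \<in> strong_seminorms X"
  unfolding strong_seminorms_def by blast

lemma continuous_seminorm_strong_iff:
  "continuous_seminorm (strong_topology X) p \<longleftrightarrow>
    seminorm_on (distributions X) p \<and> dominated_by (distributions X) (strong_seminorms X) p"
  unfolding strong_topology_eq
  by (rule continuous_seminorm_lc_iff[OF seminorm_strong_seminorms fun_subspace_distributions])

lemma continuous_sup_on:
  assumes "lc_bounded (test_topology X) B" "B \<noteq> {}"
  shows "continuous_seminorm (strong_topology X) (sup_on B)"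
  unfolding continuous_seminorm_strong_iff
  using seminorm_sup_on[OF assms] dominated_by_member[OF strong_seminormsI[OF assms]] by simp

text \<open>Finitely many bounded sets can be replaced by their union.\<close>

lemma strong_seminorm_bound:
  assumes "dominated_by (distributions X) (strong_seminorms X) p"
  obtains B C where "lc_bounded (test_topology X) B" "B \<noteq> {}" "C > 0"
    "\<And>u. u \<in> distributions X \<Longrightarrow> p u \<le> C * sup_on B u"
proof -
  obtain Q C where Q: "finite Q" "Q \<subseteq> strong_seminorms X" "C > 0"
      "\<And>u. u \<in> distributions X \<Longrightarrow> p u \<le> C * (\<Sum>q\<in>Q. q u)"
    using assms unfolding dominated_by_def by blast
  have "\<forall>q\<in>Q. \<exists>B. lc_bounded (test_topology X) B \<and> B \<noteq> {} \<and> q = sup_on B"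
    using Q(2) unfolding strong_seminorms_def by blast
  then obtain Bq where Bq: "\<And>q. q \<in> Q \<Longrightarrow> lc_bounded (test_topology X) (Bq q)" "\<And>q. q \<in> Q \<Longrightarrow> Bq q \<noteq> {}"
      "\<And>q. q \<in> Q \<Longrightarrow> q = sup_on (Bq q)"
    by metis
  \<comment> \<open>The zero function keeps \<open>B\<close> nonempty if \<open>Q\<close> is empty.\<close>
  define B where "B = {\<lambda>x. 0} \<union> (\<Union>q\<in>Q. Bq q)"
  have B: "lc_bounded (test_topology X) B"
    unfolding B_def
  proof (rule lc_bounded_Un)
    show "lc_bounded (test_topology X) {\<lambda>x. 0}"
      using fun_subspace_0[OF fun_subspace_test_functions]
      by (intro lc_bounded_finite) (auto simp: topspace_test_topology)
    show "lc_bounded (test_topology X) (\<Union>q\<in>Q. Bq q)" using Q(1) Bq(1) by (intro lc_bounded_UN)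
  qed
  have ne: "B \<noteq> {}" unfolding B_def by simp
  have "p u \<le> (C * (1 + real (card Q))) * sup_on B u" if u: "u \<in> distributions X" for u
  proof -
    have "q u \<le> sup_on B u" if q: "q \<in> Q" for q
    proof -
      have "sup_on (Bq q) u \<le> sup_on B u"
        using q Bq(2) by (intro cSUP_least distribution_le_sup_on[OF u B]) (auto simp: B_def)
      then show ?thesis by (subst Bq(3)[OF q])
    qed
    then have "(\<Sum>q\<in>Q. q u) \<le> real (card Q) * sup_on B u"
      by (intro sum_bounded_above) auto
    also have "\<dots> \<le> (1 + real (card Q)) * sup_on B u"
      using seminorm_nonneg[OF seminorm_sup_on[OF B ne] u] by (intro mult_right_mono) auto
    finally have "C * (\<Sum>q\<in>Q. q u) \<le> C * ((1 + real (card Q)) * sup_on B u)"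
      using Q(3) by (intro mult_left_mono) auto
    then show ?thesis using Q(4)[OF u] by (simp add: mult.assoc)
  qed
  moreover have "C * (1 + real (card Q)) > 0" using Q(3) by (simp add: add_pos_nonneg)
  ultimately show ?thesis using that[OF B ne] by blast
qed

lemma delta_distribution:
  assumes "y \<in> X"
  shows "(\<lambda>\<phi>. if \<phi> \<in> test_functions X then \<phi> y else 0) \<in> distributions X"
  unfolding distributions_iff
proof (intro conjI ballI allI impI)
  fix K assume K: "compact K \<and> K \<subseteq> X"
  have "dominated_on K (deriv_sup [])"
    by (intro dominated_by_member rangeI)
  then show "dominated_on K (\<lambda>\<phi>. cmod (if \<phi> \<in> test_functions X then \<phi> y else 0))"
  proof (rule dominated_by_mono)
    fix \<phi> assume "\<phi> \<in> test_functions_in K"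
    then have "\<phi> \<in> test_functions X" using K test_functions_in_subset by blast
    then show "cmod (if \<phi> \<in> test_functions X then \<phi> y else 0) \<le> deriv_sup [] \<phi>"
      using norm_le_deriv_sup[of \<phi> X y] by simp
  qed
qed (simp_all add: fun_subspace_scale[OF fun_subspace_test_functions] fun_subspace_add[OF fun_subspace_test_functions])

subsection \<open>Continuous functions as distributions\<close>

lemma set_integrable_compact_support:
  fixes g :: "real^'n \<Rightarrow> complex"
  assumes K: "compact K" "K \<subseteq> X" and g: "continuous_on K g" "\<And>x. x \<in> X \<Longrightarrow> x \<notin> K \<Longrightarrow> g x = 0"
  shows "set_integrable lebesgue X g"
    and "(\<And>x. x \<in> K \<Longrightarrow> cmod (g x) \<le> M) \<Longrightarrow> cmod (LINT x:X|lebesgue. g x) \<le> M * measure lebesgue K"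
proof -
  have eq: "(\<lambda>x. indicat_real X x *\<^sub>R g x) = (\<lambda>x. indicat_real K x *\<^sub>R g x)"
    using K(2) g(2) by (auto simp: indicator_def fun_eq_iff)
  have "integrable lborel (\<lambda>x. indicator K x *\<^sub>R g x)"
    using borel_integrable_compact[OF K(1) g(1)] .
  then have int: "integrable lebesgue (\<lambda>x. indicat_real K x *\<^sub>R g x)"
    using integrable_completion borel_measurable_integrable by blast
  then show "set_integrable lebesgue X g" unfolding set_integrable_def eq .
  have Kint: "integrable lebesgue (indicat_real K)"
    using lmeasurable_compact[OF K(1)] by (intro integrable_real_indicator) (auto simp: fmeasurable_def)
  show "cmod (LINT x:X|lebesgue. g x) \<le> M * measure lebesgue K" if M: "\<And>x. x \<in> K \<Longrightarrow> cmod (g x) \<le> M"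
  proof -
    have "cmod (LINT x:X|lebesgue. g x) \<le> (LINT x|lebesgue. norm (indicat_real K x *\<^sub>R g x))"
      unfolding set_lebesgue_integral_def eq by (rule integral_norm_bound)
    also have "\<dots> \<le> (LINT x|lebesgue. M * indicat_real K x)"
      using M by (intro integral_mono[OF integrable_norm[OF int] integrable_mult_right[OF Kint]])
        (auto simp: indicator_def)
    also have "\<dots> = M * measure lebesgue K" using K(1) by simp
    finally show ?thesis .
  qed
qed

lemma continuous_times_test_function_integrable:
  assumes f: "continuous_on X f" and K: "compact K" "K \<subseteq> X" and \<phi>: "\<phi> \<in> test_functions_in K"
  shows "set_integrable lebesgue X (\<lambda>x. f x * \<phi> x)"
proof (rule set_integrable_compact_support(1)[OF K])
  show "continuous_on K (\<lambda>x. f x * \<phi> x)"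
    using f continuous_on_subset[OF f K(2)] smooth_on_continuous[OF test_functions_in_smooth[OF \<phi>], of "[]"]
    by (auto intro!: continuous_on_mult intro: continuous_on_subset)
qed (use test_functions_in_zero[OF \<phi>] in simp)

lemma distribution_of_in_distributions:
  assumes f: "continuous_on X f"
  shows "distribution_of X f \<in> distributions X"
  unfolding distributions_iff
proof (intro conjI ballI allI impI)
  fix \<phi> c assume \<phi>: "\<phi> \<in> test_functions X"
  have "(LINT x:X|lebesgue. f x * (c * \<phi> x)) = (LINT x:X|lebesgue. c * (f x * \<phi> x))"
    by (simp add: mult_ac)
  then show "distribution_of X f (\<lambda>x. c * \<phi> x) = c * distribution_of X f \<phi>"
    using \<phi> fun_subspace_scale[OF fun_subspace_test_functions \<phi>] unfolding distribution_of_def by simp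
next
  fix \<phi> \<eta> assume \<phi>: "\<phi> \<in> test_functions X" and \<eta>: "\<eta> \<in> test_functions X"
  obtain K where K: "compact K" "K \<subseteq> X" "\<phi> \<in> test_functions_in K" "\<eta> \<in> test_functions_in K"
    using test_functions_two[OF \<phi> \<eta>] .
  have "(LINT x:X|lebesgue. f x * (\<phi> x + \<eta> x)) = (LINT x:X|lebesgue. f x * \<phi> x) + (LINT x:X|lebesgue. f x * \<eta> x)"
    unfolding distrib_left
    using K by (intro set_integral_add continuous_times_test_function_integrable[OF f])
  then show "distribution_of X f (\<lambda>x. \<phi> x + \<eta> x) = distribution_of X f \<phi> + distribution_of X f \<eta>"
    using \<phi> \<eta> fun_subspace_add[OF fun_subspace_test_functions \<phi> \<eta>] unfolding distribution_of_def by simp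
next
  fix K assume K: "compact K \<and> K \<subseteq> X"
  have fK: "continuous_on K f" using K f continuous_on_subset by blast
  then have "bounded (f ` K)" using K compact_continuous_image compact_imp_bounded by blast
  then obtain M where M: "\<And>x. x \<in> K \<Longrightarrow> cmod (f x) \<le> M" unfolding bounded_iff by auto
  define C where "C = \<bar>M\<bar> * measure lebesgue K"
  have C: "C \<ge> 0" unfolding C_def by simp
  have "dominated_on K (\<lambda>\<phi>. C * deriv_sup [] \<phi>)"
    by (intro dominated_by_scale[OF _ C] dominated_by_member rangeI)
  then show "dominated_on K (\<lambda>\<phi>. cmod (distribution_of X f \<phi>))"
  proof (rule dominated_by_mono)
    fix \<phi> assume \<phi>: "\<phi> \<in> test_functions_in K"
    then have \<phi>X: "\<phi> \<in> test_functions X" using K test_functions_in_subset by blast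
    have "cmod (LINT x:X|lebesgue. f x * \<phi> x) \<le> (\<bar>M\<bar> * deriv_sup [] \<phi>) * measure lebesgue K"
    proof (rule set_integrable_compact_support(2))
      show "continuous_on K (\<lambda>x. f x * \<phi> x)"
        using fK smooth_on_continuous[OF test_functions_in_smooth[OF \<phi>], of "[]"]
        by (auto intro!: continuous_on_mult intro: continuous_on_subset)
      show "cmod (f x * \<phi> x) \<le> \<bar>M\<bar> * deriv_sup [] \<phi>" if "x \<in> K" for x
        unfolding norm_mult using M[OF that] norm_le_deriv_sup[OF \<phi>X]
        by (intro mult_mono) auto
    qed (use K test_functions_in_zero[OF \<phi>] in auto)
    then show "cmod (distribution_of X f \<phi>) \<le> C * deriv_sup [] \<phi>"
      using \<phi>X unfolding distribution_of_def C_def by (simp add: mult_ac)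
  qed
qed (simp add: distribution_of_def)

section \<open>Regularization\<close>

lemma integral_compact_support:
  fixes g :: "real^'n \<Rightarrow> 'b::banach"
  assumes "continuous_on UNIV g" "\<And>x. x \<notin> cbox a b \<Longrightarrow> g x = 0"
  shows "(g has_integral integral (cbox a b) g) UNIV" "g integrable_on UNIV" "integral UNIV g = integral (cbox a b) g"
proof -
  have "g integrable_on cbox a b"
    using assms(1) continuous_on_subset by (intro integrable_continuous) blast
  then show "(g has_integral integral (cbox a b) g) UNIV"
    using assms(2) by (intro has_integral_on_superset[OF integrable_integral]) auto
  then show "g integrable_on UNIV" "integral UNIV g = integral (cbox a b) g"
    by (auto simp: has_integral_integrable_integral)
qed

definition conv :: "(real^'n::finite \<Rightarrow> complex) \<Rightarrow> (real^'n \<Rightarrow> complex) \<Rightarrow> real^'n \<Rightarrow> complex" where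
  "conv g h x = integral UNIV (\<lambda>y. g y * h (x - y))"

lemma conv_commute:
  assumes g: "continuous_on UNIV g" "\<And>x. x \<notin> cbox a b \<Longrightarrow> g x = 0" and h: "continuous_on UNIV h"
  shows "conv g h x = conv h g x"
proof -
  let ?F = "\<lambda>y. g y * h (x - y)"
  have F: "continuous_on UNIV ?F"
    by (intro continuous_intros g continuous_on_compose2[OF h]) auto
  have "?F integrable_on cbox a b"
    using F continuous_on_subset by (intro integrable_continuous) blast
  from has_integral_affinity[OF integrable_integral[OF this], of "-1" x]
  have "((\<lambda>y. ?F (x - y)) has_integral integral (cbox a b) ?F) ((\<lambda>y. x - y) ` cbox a b)"
    by (simp add: algebra_simps)
  then have "((\<lambda>y. ?F (x - y)) has_integral integral (cbox a b) ?F) UNIV"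
  proof (rule has_integral_on_superset)
    fix y assume y: "y \<notin> (\<lambda>y. x - y) ` cbox a b"
    have "x - y \<notin> cbox a b"
    proof
      assume "x - y \<in> cbox a b"
      then have "x - (x - y) \<in> (\<lambda>y. x - y) ` cbox a b" by (rule imageI)
      then show False using y by simp
    qed
    then show "?F (x - y) = 0" using g(2) by simp
  qed simp
  then have "conv h g x = integral (cbox a b) ?F"
    unfolding conv_def by (simp add: mult.commute integral_unique)
  then show ?thesis
    unfolding conv_def using integral_compact_support(3)[OF F, of a b] g(2) by simp
qed

text \<open>Differentiation under the integral sign. With \<open>conv_commute\<close> it moves derivatives from one factor
  of a convolution to the other without reversing the order of differentiation, as repeated integration
  by parts would do.\<close>

lemma conv_has_derivative:
  assumes g: "continuous_on UNIV g" "\<And>x. x \<notin> cbox a b \<Longrightarrow> g x = 0" and h: "smooth_on UNIV h"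
  obtains D where "(conv g h has_derivative D) (at x)" "\<And>i. D (axis i 1) = conv g (partial i h) x"
proof -
  have hd: "(h has_derivative frechet_derivative h (at z)) (at z)" for z
    using smooth_on_differentiable_at[OF h open_UNIV UNIV_I, of "[]"] by (simp add: frechet_derivative_works)
  have bl: "bounded_linear (\<lambda>v. g t * frechet_derivative h (at z) v)" for t z
    using has_derivative_bounded_linear[OF hd] bounded_linear_compose[OF bounded_linear_mult_right] by blast
  define fx where "fx x t = Blinfun (\<lambda>v. g t * frechet_derivative h (at (x - t)) v)" for x t
  have fx: "blinfun_apply (fx x t) = (\<lambda>v. g t * frechet_derivative h (at (x - t)) v)" for x t
    unfolding fx_def using bl by (simp add: bounded_linear_Blinfun_apply)
  have ph: "continuous_on UNIV (partial i h)" for i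
    using smooth_on_continuous[OF h, of "[i]"] by simp
  have hc: "continuous_on UNIV h" using smooth_on_continuous[OF h, of "[]"] by simp
  have cont: "continuous_on (UNIV \<times> cbox a b) (\<lambda>(x, t). fx x t)"
  proof (rule continuous_on_blinfun_componentwise)
    fix e :: "real^'a" assume "e \<in> Basis"
    then obtain i where i: "e = axis i 1" by (auto simp: Basis_vec_def)
    have "continuous_on (UNIV \<times> cbox a b) (\<lambda>p. g (snd p) * partial i h (fst p - snd p))"
      by (intro continuous_intros continuous_on_compose2[OF g(1)] continuous_on_compose2[OF ph]) auto
    then show "continuous_on (UNIV \<times> cbox a b) (\<lambda>p. blinfun_apply (case p of (x, t) \<Rightarrow> fx x t) e)"
      by (simp add: case_prod_beta fx i)
  qed
  have conv_eq: "conv g k x = integral (cbox a b) (\<lambda>y. g y * k (x - y))" if "continuous_on UNIV k" for k x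
    unfolding conv_def
    by (rule integral_compact_support(3))
      (auto intro!: continuous_intros g continuous_on_compose2[OF that] simp: g(2))
  have "((\<lambda>x. integral (cbox a b) (\<lambda>t. g t * h (x - t))) has_derivative
      blinfun_apply (integral (cbox a b) (fx x))) (at x within UNIV)"
  proof (rule leibniz_rule[OF _ _ cont])
    fix x t :: "real^'a"
    have "((\<lambda>x. x - t) has_derivative (\<lambda>v. v)) (at x)" by (auto intro!: derivative_eq_intros)
    from has_derivative_compose[OF this hd]
    show "((\<lambda>x. g t * h (x - t)) has_derivative blinfun_apply (fx x t)) (at x within UNIV)"
      unfolding fx by (intro has_derivative_mult_right)
    show "(\<lambda>t. g t * h (x - t)) integrable_on cbox a b"
      by (intro integrable_continuous continuous_intros continuous_on_subset[OF g(1)] continuous_on_compose2[OF hc]) auto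
  qed auto
  moreover have "blinfun_apply (integral (cbox a b) (fx x)) (axis i 1) = conv g (partial i h) x" for i
  proof -
    have "continuous_on (cbox a b) (Pair x)" by (intro continuous_on_Pair continuous_on_const continuous_on_id)
    from continuous_on_compose2[OF cont this] have "continuous_on (cbox a b) (fx x)" by auto
    then have "fx x integrable_on cbox a b" by (rule integrable_continuous)
    then show ?thesis by (simp add: blinfun_apply_integral fx conv_eq[OF ph])
  qed
  moreover have "conv g h = (\<lambda>x. integral (cbox a b) (\<lambda>t. g t * h (x - t)))"
    using conv_eq[OF hc] by blast
  ultimately show ?thesis using that by simp
qed

lemma iter_partial_conv:
  assumes g: "continuous_on UNIV g" "\<And>x. x \<notin> cbox a b \<Longrightarrow> g x = 0" and h: "smooth_on UNIV h"
  shows "iter_partial is (conv g h) = conv g (iter_partial is h)"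
proof (induction "is")
  case (Cons i "is")
  show ?case
  proof
    fix x
    obtain D where D: "(conv g (iter_partial is h) has_derivative D) (at x)"
      "\<And>i. D (axis i 1) = conv g (partial i (iter_partial is h)) x"
      using conv_has_derivative[OF g smooth_on_iter_partial[OF h]] by blast
    show "iter_partial (i # is) (conv g h) x = conv g (iter_partial (i # is) h) x"
      using partial_eqI[OF D(1), of i] D(2) Cons by simp
  qed
qed simp

lemma iter_partial_shift:
  assumes h: "smooth_on UNIV h"
  shows "iter_partial is (\<lambda>x. h (x - z)) = (\<lambda>x. iter_partial is h (x - z))"
    and "smooth_on UNIV (\<lambda>x. h (x - z))"
proof -
  have der: "((\<lambda>x. iter_partial is h (x - z)) has_derivative frechet_derivative (iter_partial is h) (at (x - z))) (at x)"
    for "is" x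
  proof -
    have "((\<lambda>x. x - z) has_derivative (\<lambda>v. v)) (at x)" by (auto intro!: derivative_eq_intros)
    then show ?thesis
      using has_derivative_compose smooth_on_differentiable_at[OF h open_UNIV UNIV_I] frechet_derivative_works by blast
  qed
  have eq: "iter_partial is (\<lambda>x. h (x - z)) = (\<lambda>x. iter_partial is h (x - z))" for "is"
  proof (induction "is")
    case (Cons i "is")
    then show ?case using partial_eqI[OF der[of "is"], where i = i] by simp
  qed simp
  show "iter_partial is (\<lambda>x. h (x - z)) = (\<lambda>x. iter_partial is h (x - z))" by (rule eq)
  show "smooth_on UNIV (\<lambda>x. h (x - z))"
    unfolding smooth_on_def differentiable_on_eq_differentiable_at[OF open_UNIV] eq differentiable_def
    using der by blast
qed

lemma mollifier_exists:
  assumes "\<epsilon> > 0"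
  obtains \<rho> :: "real^'n \<Rightarrow> real" where "smooth_on UNIV \<rho>" "\<And>x. \<rho> x \<ge> 0"
    "\<And>x. x \<notin> cball 0 \<epsilon> \<Longrightarrow> \<rho> x = 0" "(\<rho> has_integral 1) UNIV"
proof -
  obtain b :: "real^'n \<Rightarrow> real" where b: "smooth_on UNIV b" "\<And>x. b x \<ge> 0" "\<And>x. b x > 0 \<longleftrightarrow> x \<in> ball 0 \<epsilon>"
    using bump_function_exists[OF assms, of 0] by blast
  have zero: "b x = 0" if "x \<notin> ball 0 \<epsilon>" for x using b(2,3)[of x] that by force
  have bc: "continuous_on UNIV b" using smooth_on_continuous[OF b(1), of "[]"] by simp
  obtain a :: "real^'n" where a: "ball 0 \<epsilon> \<subseteq> box (- a) a"
    using bounded_subset_box_symmetric[OF bounded_ball] by blast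
  then have a': "ball 0 \<epsilon> \<subseteq> cbox (- a) a" using box_subset_cbox by blast
  define I where "I = integral (cbox (- a) a) b"
  have int: "(b has_integral I) UNIV"
    unfolding I_def using zero a' by (intro integral_compact_support(1)[OF bc]) blast
  have int_box: "(b has_integral I) (cbox (- a) a)"
    unfolding I_def using bc continuous_on_subset by (intro integrable_integral integrable_continuous) blast
  have "I \<noteq> 0"
  proof
    assume "I = 0"
    have 0: "0 \<in> box (- a) a" using a assms by (auto simp: subset_eq)
    have "b 0 = 0"
      using int_box \<open>I = 0\<close> bc b(2) 0 subsetD[OF box_subset_cbox 0]
      by (intro has_integral_0_cbox_imp_0[of "- a" a b]) (auto intro: continuous_on_subset)
    then show False using b(3)[of 0] assms by simp
  qed
  moreover have "I \<ge> 0" using int b(2) by (rule has_integral_nonneg) 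
  ultimately have I: "I > 0" by simp
  show ?thesis
  proof (rule that[of "\<lambda>x. inverse I * b x"])
    show "smooth_on UNIV (\<lambda>x. inverse I * b x)"
      by (intro smooth_on_mult smooth_on_const b open_UNIV)
    show "((\<lambda>x. inverse I * b x) has_integral 1) UNIV"
      using has_integral_mult_right[OF int, of "inverse I"] I by simp
  qed (use I b(2) zero in auto)
qed

lemma lipschitz_of_partial_bound:
  fixes h :: "real^'n \<Rightarrow> 'b::real_normed_vector"
  assumes "\<And>z. h differentiable (at z)" "\<And>i x. norm (partial i h x) \<le> M"
  shows "norm (h u - h v) \<le> real CARD('n) * M * norm (u - v)"
proof (rule differentiable_bound[of UNIV h "\<lambda>z. frechet_derivative h (at z)"])
  show "(h has_derivative frechet_derivative h (at z)) (at z within UNIV)" for z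
    using assms(1) frechet_derivative_works by auto
  show "onorm (frechet_derivative h (at z)) \<le> real CARD('n) * M" for z
    using norm_frechet_derivative_le[OF assms] by (intro onorm_le)
qed auto

text \<open>The mollifier has mass one near the origin, so the error is an average of increments \<open>h (x - y) - h x\<close>
  with \<open>\<bar>y\<bar> \<le> \<epsilon>\<close>, which the mean value inequality bounds.\<close>

lemma conv_mollifier_close:
  fixes h :: "real^'n \<Rightarrow> complex"
  assumes \<rho>: "continuous_on UNIV \<rho>" "\<And>x. \<rho> x \<ge> 0" "\<And>x. x \<notin> cball 0 \<epsilon> \<Longrightarrow> \<rho> x = 0" "(\<rho> has_integral 1) UNIV"
    and h: "smooth_on UNIV h" "\<And>i x. cmod (partial i h x) \<le> M"
  shows "cmod (conv (\<lambda>x. of_real (\<rho> x)) h x - h x) \<le> real CARD('n) * M * \<epsilon>"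
proof -
  have hc: "continuous_on UNIV h" using smooth_on_continuous[OF h(1), of "[]"] by simp
  have hd: "h differentiable (at z)" for z
    using smooth_on_differentiable_at[OF h(1) open_UNIV UNIV_I, of "[]"] by simp
  note lip = lipschitz_of_partial_bound[OF hd h(2)]
  have "cmod (partial undefined h 0) \<le> M" by (rule h(2))
  then have M: "0 \<le> M" using norm_ge_zero order_trans by blast
  obtain a :: "real^'n" where a: "cball 0 \<epsilon> \<subseteq> cbox (- a) a"
    using bounded_subset_cbox_symmetric[OF bounded_cball] by blast
  have int1: "(\<lambda>y. of_real (\<rho> y) * h (x - y)) integrable_on UNIV"
    using a \<rho>(3) by (intro integral_compact_support(2)[of _ "- a" a])
      (auto intro!: continuous_intros \<rho> continuous_on_compose2[OF hc])
  have int2: "((\<lambda>y. of_real (\<rho> y) * h x) has_integral h x) UNIV"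
    using has_integral_mult_left[OF has_integral_of_real[OF \<rho>(4)], of "h x"] by simp
  have "conv (\<lambda>x. of_real (\<rho> x)) h x - h x = integral UNIV (\<lambda>y. of_real (\<rho> y) * h (x - y) - of_real (\<rho> y) * h x)"
    unfolding conv_def using integral_diff[OF int1 has_integral_integrable[OF int2]] integral_unique[OF int2] by simp
  moreover have "cmod (integral UNIV (\<lambda>y. of_real (\<rho> y) * h (x - y) - of_real (\<rho> y) * h x)) \<le>
      integral UNIV (\<lambda>y. \<rho> y * (real CARD('n) * M * \<epsilon>))"
  proof (rule integral_norm_bound_integral)
    show "(\<lambda>y. of_real (\<rho> y) * h (x - y) - of_real (\<rho> y) * h x) integrable_on UNIV"
      using integrable_diff[OF int1 has_integral_integrable[OF int2]] .
    show "(\<lambda>y. \<rho> y * (real CARD('n) * M * \<epsilon>)) integrable_on UNIV"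
      using has_integral_integrable[OF has_integral_mult_left[OF \<rho>(4)]] .
    fix y
    show "cmod (of_real (\<rho> y) * h (x - y) - of_real (\<rho> y) * h x) \<le> \<rho> y * (real CARD('n) * M * \<epsilon>)"
    proof (cases "y \<in> cball 0 \<epsilon>")
      case True
      have "cmod (h (x - y) - h x) \<le> real CARD('n) * M * norm y" using lip[of "x - y" x] by simp
      also have "\<dots> \<le> real CARD('n) * M * \<epsilon>" using True M by (intro mult_left_mono) auto
      finally have "\<rho> y * cmod (h (x - y) - h x) \<le> \<rho> y * (real CARD('n) * M * \<epsilon>)"
        using \<rho>(2) by (rule mult_left_mono)
      moreover have "cmod (of_real (\<rho> y) * h (x - y) - of_real (\<rho> y) * h x) = \<rho> y * cmod (h (x - y) - h x)"
        using \<rho>(2)[of y] by (simp add: right_diff_distrib[symmetric] norm_mult)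
      ultimately show ?thesis by simp
    qed (simp add: \<rho>(3))
  qed
  moreover have "integral UNIV (\<lambda>y. \<rho> y * (real CARD('n) * M * \<epsilon>)) = real CARD('n) * M * \<epsilon>"
    using integral_unique[OF has_integral_mult_left[OF \<rho>(4)]] by simp
  ultimately show ?thesis by (simp only:)
qed

text \<open>Tents of radius \<open>\<delta>\<close> around finitely many points of \<open>K\<close>, normalized to sum to one on \<open>K\<close>. Off \<open>K\<close>
  the sum of the tents may vanish, so the denominator is bounded below by its minimum \<open>c\<close> on \<open>K\<close>.\<close>

lemma continuous_partition_of_unity_small:
  fixes K :: "(real^'n) set"
  assumes K: "compact K" and \<delta>: "\<delta> > 0"
  obtains Z and f :: "real^'n \<Rightarrow> real^'n \<Rightarrow> real" where "finite Z" "Z \<subseteq> K"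
    "\<And>z. continuous_on UNIV (f z)" "\<And>z y. f z y \<ge> 0"
    "\<And>y. y \<in> K \<Longrightarrow> (\<Sum>z\<in>Z. f z y) = 1" "\<And>z y. f z y \<noteq> 0 \<Longrightarrow> dist y z < \<delta>"
proof -
  have cover: "K \<subseteq> (\<Union>z\<in>K. ball z \<delta>)" using \<delta> by auto
  obtain Z where Z: "Z \<subseteq> K" "finite Z" "K \<subseteq> (\<Union>z\<in>Z. ball z \<delta>)"
    by (rule compactE_image[OF K _ cover]) auto
  define t where "t z y = max 0 (\<delta> - dist y z)" for z y :: "real^'n"
  define s where "s y = (\<Sum>z\<in>Z. t z y)" for y
  have t_cont: "continuous_on UNIV (t z)" for z
    unfolding t_def by (intro continuous_intros)
  have s_cont: "continuous_on UNIV s"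
    unfolding s_def by (intro continuous_intros t_cont)
  have s_pos: "s y > 0" if y: "y \<in> K" for y
  proof -
    obtain z where z: "z \<in> Z" "dist z y < \<delta>" using Z(3) y by auto
    have "t z y > 0" using z by (simp add: t_def dist_commute)
    then show ?thesis unfolding s_def using Z(2) z(1) by (intro sum_pos2) (auto simp: t_def)
  qed
  have "\<exists>c>0. \<forall>y\<in>K. c \<le> s y"
  proof (cases "K = {}")
    case False
    obtain y0 where "y0 \<in> K" "\<forall>y\<in>K. s y0 \<le> s y"
      using continuous_attains_inf[OF K False continuous_on_subset[OF s_cont subset_UNIV]] by blast
    then show ?thesis using s_pos by blast
  qed (auto intro: zero_less_one)
  then obtain c where c: "c > 0" "\<And>y. y \<in> K \<Longrightarrow> c \<le> s y" by blast
  show ?thesis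
  proof (rule that[of Z "\<lambda>z y. t z y / max c (s y)"])
    show "continuous_on UNIV (\<lambda>y. t z y / max c (s y))" for z
      using c(1) by (intro continuous_intros t_cont s_cont) (auto simp: max_def)
    show "0 \<le> t z y / max c (s y)" for z y using c(1) by (simp add: t_def)
    show "(\<Sum>z\<in>Z. t z y / max c (s y)) = 1" if "y \<in> K" for y
      using c(2)[OF that] s_pos[OF that] unfolding sum_divide_distrib[symmetric] s_def[symmetric] by simp
    show "dist y z < \<delta>" if "t z y / max c (s y) \<noteq> 0" for z y
      using that by (auto simp: t_def max_def split: if_splits)
  qed (use Z in auto)
qed

lemma integral_times_test_function:
  assumes f: "continuous_on UNIV f" and K: "compact K" "K \<subseteq> X" and \<phi>: "\<phi> \<in> test_functions_in K"
  shows "(LINT y:X|lebesgue. f y * \<phi> y) = integral UNIV (\<lambda>y. f y * \<phi> y)"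
    and "(\<lambda>y. f y * \<phi> y) integrable_on UNIV"
proof -
  have "(LINT y:X|lebesgue. f y * \<phi> y) = integral X (\<lambda>y. f y * \<phi> y)"
    using continuous_times_test_function_integrable[OF continuous_on_subset[OF f subset_UNIV] K \<phi>]
    by (rule set_lebesgue_integral_eq_integral(2))
  also have "\<dots> = integral UNIV (\<lambda>y. if y \<in> X then f y * \<phi> y else 0)"
    by (rule Henstock_Kurzweil_Integration.integral_restrict_UNIV[symmetric])
  also have "(\<lambda>y. if y \<in> X then f y * \<phi> y else 0) = (\<lambda>y. f y * \<phi> y)"
    using test_functions_in_zero[OF \<phi>] K(2) by (auto simp: fun_eq_iff)
  finally show "(LINT y:X|lebesgue. f y * \<phi> y) = integral UNIV (\<lambda>y. f y * \<phi> y)" .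
  obtain a where a: "K \<subseteq> cbox (- a) a"
    using bounded_subset_cbox_symmetric[OF compact_imp_bounded[OF K(1)]] by blast
  show "(\<lambda>y. f y * \<phi> y) integrable_on UNIV"
  proof (rule integral_compact_support(2))
    show "continuous_on UNIV (\<lambda>y. f y * \<phi> y)"
      using smooth_on_continuous[OF test_functions_in_smooth[OF \<phi>], of "[]"] f by (intro continuous_intros) auto
    show "f y * \<phi> y = 0" if "y \<notin> cbox (- a) a" for y
      using test_functions_in_zero[OF \<phi>, of y] that a by auto
  qed
qed

text \<open>The operator \<open>P \<phi> = \<Sum>\<^sub>z (\<integral> f\<^sub>z \<phi>) \<rho> (\<cdot> - z)\<close>, a Riemann sum of the convolution with a mollifier \<open>\<rho>\<close>,
  approximates the identity uniformly on a bounded set, derivatives included, and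
  \<open>u (P \<phi>) = \<integral> (\<Sum>\<^sub>z u (\<rho> (\<cdot> - z)) f\<^sub>z) \<phi>\<close> is given by a continuous density.\<close>

lemma continuous_functions_strongly_dense:
  fixes X :: "(real^'n) set"
  assumes X: "open X" and u: "u \<in> distributions X" and B: "lc_bounded (test_topology X) B" and e: "e > 0"
  shows "\<exists>g. continuous_on X g \<and> (\<forall>\<phi>\<in>B. cmod (u \<phi> - distribution_of X g \<phi>) \<le> e)"
proof -
  obtain K where K: "compact K" "K \<subseteq> X" "B \<subseteq> test_functions_in K" "\<And>is. bdd_above (deriv_sup is ` B)"
    using B unfolding lc_bounded_test_topology_iff[OF X] by blast
  obtain r where r: "r > 0" "(\<Union>x\<in>K. cball x r) \<subseteq> X"
    using compact_subset_open_imp_cball_epsilon_subset[OF K(1) X K(2)] by blast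
  define K' where "K' = {x + y | x y. x \<in> K \<and> y \<in> cball 0 r}"
  have K': "compact K'" unfolding K'_def by (intro compact_sums K compact_cball)
  have K'X: "K' \<subseteq> X"
  proof
    fix p assume "p \<in> K'"
    then obtain x y where p: "p = x + y" "x \<in> K" "norm y \<le> r" unfolding K'_def by auto
    then have "p \<in> cball x r" by (simp add: dist_norm)
    then show "p \<in> X" using r(2) p(2) by blast
  qed
  have KK': "K \<subseteq> K'"
  proof
    fix x assume "x \<in> K"
    then have "x = x + 0 \<and> x \<in> K \<and> 0 \<in> cball 0 r" using r(1) by simp
    then show "x \<in> K'" unfolding K'_def by blast
  qed
  obtain F C where F: "finite F" "C > 0"
    "\<And>\<phi>. \<phi> \<in> test_functions_in K' \<Longrightarrow> cmod (u \<phi>) \<le> C * (\<Sum>is\<in>F. deriv_sup is \<phi>)"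
    using distribution_dominated[OF u K' K'X] unfolding dominated_by_deriv_sups_iff[OF K'] by blast
  have "\<exists>M. \<forall>is. \<forall>\<phi>\<in>B. deriv_sup is \<phi> \<le> M is"
    using K(4) unfolding bdd_above_def by (auto intro!: choice)
  then obtain Mf where Mf: "\<And>is \<phi>. \<phi> \<in> B \<Longrightarrow> deriv_sup is \<phi> \<le> Mf is" by blast
  have BX: "\<phi> \<in> test_functions X" if "\<phi> \<in> B" for \<phi>
    using K(3) that test_functions_in_subset[OF K(1,2)] by blast
  define M where "M = (\<Sum>is\<in>F. \<Sum>i\<in>UNIV. \<bar>Mf (i # is)\<bar>)"
  have M_nonneg: "M \<ge> 0" unfolding M_def by (intro sum_nonneg) auto
  have M: "cmod (partial i (iter_partial is \<phi>) x) \<le> M" if "\<phi> \<in> B" "is \<in> F" for \<phi> "is" i x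
  proof -
    have "cmod (iter_partial (i # is) \<phi> x) \<le> deriv_sup (i # is) \<phi>"
      by (rule norm_iter_partial_le_deriv_sup[OF BX[OF that(1)]])
    also have "\<dots> \<le> \<bar>Mf (i # is)\<bar>" using Mf[OF that(1), of "i # is"] by linarith
    also have "\<dots> \<le> (\<Sum>i\<in>UNIV. \<bar>Mf (i # is)\<bar>)" by (intro member_le_sum) auto
    also have "\<dots> \<le> M" unfolding M_def using F(1) that(2)
      by (intro member_le_sum[of "is" F "\<lambda>is. \<Sum>i\<in>UNIV. \<bar>Mf (i # is)\<bar>"] sum_nonneg) auto
    finally show ?thesis by simp
  qed
  define M0 where "M0 = \<bar>Mf []\<bar>"
  have M0: "cmod (\<phi> x) \<le> M0" if "\<phi> \<in> B" for \<phi> x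
    using norm_le_deriv_sup[OF BX[OF that], of x] Mf[OF that, of "[]"] unfolding M0_def by linarith
  obtain a where a: "K' \<subseteq> cbox (- a) a"
    using bounded_subset_cbox_symmetric[OF compact_imp_bounded[OF K']] by blast
  define V where "V = M0 * measure lborel (cbox (- a) a)"
  have V: "V \<ge> 0" unfolding V_def M0_def by simp
  \<comment> \<open>The tolerance \<open>\<eta>\<close> is for a single derivative. Half of it is for the convolution error, at most
    \<open>n M \<epsilon>\<close>, and half for the Riemann sum error, at most \<open>n L \<delta> V\<close>, where \<open>M\<close> and \<open>L\<close> bound the next
    derivatives of members of \<open>B\<close> and of the mollifier.\<close>
  let ?n = "real CARD('n)"
  define \<eta> where "\<eta> = e / (C * (1 + real (card F)))"
  have \<eta>: "\<eta> > 0" unfolding \<eta>_def using e F(2) by (simp add: add_pos_nonneg)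
  define \<epsilon> where "\<epsilon> = min r (\<eta> / (2 * (?n * M + 1)))"
  have nM: "?n * M \<ge> 0" using M_nonneg by simp
  have \<epsilon>: "\<epsilon> > 0" "\<epsilon> \<le> r" unfolding \<epsilon>_def using r(1) \<eta> nM by (simp_all add: add_nonneg_pos)
  have "?n * M * \<epsilon> \<le> ?n * M * (\<eta> / (2 * (?n * M + 1)))"
    unfolding \<epsilon>_def using nM by (intro mult_left_mono) auto
  also have "\<dots> \<le> (?n * M + 1) * (\<eta> / (2 * (?n * M + 1)))"
    using \<eta> nM by (intro mult_right_mono) auto
  also have "\<dots> = \<eta> / 2" using nM by (simp add: field_simps)
  finally have \<epsilon>_small: "?n * M * \<epsilon> \<le> \<eta> / 2" .
  obtain \<rho> :: "real^'n \<Rightarrow> real" where \<rho>: "smooth_on UNIV \<rho>" "\<And>x. \<rho> x \<ge> 0"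
    "\<And>x. x \<notin> cball 0 \<epsilon> \<Longrightarrow> \<rho> x = 0" "(\<rho> has_integral 1) UNIV"
    using mollifier_exists[OF \<epsilon>(1)] by blast
  define c\<rho> where "c\<rho> x = complex_of_real (\<rho> x)" for x
  have c\<rho>_smooth: "smooth_on UNIV c\<rho>" unfolding c\<rho>_def by (rule smooth_on_of_real[OF open_UNIV \<rho>(1)])
  have "c\<rho> \<in> test_functions_in (cball 0 \<epsilon>)"
    unfolding test_functions_in_def using c\<rho>_smooth \<rho>(3) by (simp add: c\<rho>_def)
  then have c\<rho>_test: "c\<rho> \<in> test_functions UNIV"
    using test_functions_in_subset[of "cball 0 \<epsilon>" UNIV] by auto
  define L where "L = 1 + (\<Sum>is\<in>F. \<Sum>i\<in>UNIV. deriv_sup (i # is) c\<rho>)"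
  have L_sum: "0 \<le> (\<Sum>is\<in>F. \<Sum>i\<in>UNIV. deriv_sup (i # is) c\<rho>)"
    by (intro sum_nonneg deriv_sup_nonneg[OF c\<rho>_test])
  have L: "L > 0" unfolding L_def using L_sum by linarith
  have L_le: "cmod (partial i (iter_partial is c\<rho>) x) \<le> L" if "is \<in> F" for "is" i x
  proof -
    have "cmod (iter_partial (i # is) c\<rho> x) \<le> deriv_sup (i # is) c\<rho>"
      by (rule norm_iter_partial_le_deriv_sup[OF c\<rho>_test])
    also have "\<dots> \<le> (\<Sum>i\<in>UNIV. deriv_sup (i # is) c\<rho>)"
      by (intro member_le_sum[of i UNIV "\<lambda>i. deriv_sup (i # is) c\<rho>"] deriv_sup_nonneg[OF c\<rho>_test]) auto
    also have "\<dots> \<le> (\<Sum>is\<in>F. \<Sum>i\<in>UNIV. deriv_sup (i # is) c\<rho>)" using F(1) that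
      by (intro member_le_sum[of "is" F "\<lambda>is. \<Sum>i\<in>UNIV. deriv_sup (i # is) c\<rho>"] sum_nonneg
          deriv_sup_nonneg[OF c\<rho>_test])
    finally show ?thesis unfolding L_def by simp
  qed
  define \<delta> where "\<delta> = \<eta> / (2 * (V + 1) * (?n * L))"
  have n_pos: "?n > 0" by simp
  have nL: "?n * L > 0" using L n_pos by (rule mult_pos_pos[rotated])
  have \<delta>: "\<delta> > 0" unfolding \<delta>_def using \<eta> V L by (intro divide_pos_pos mult_pos_pos) auto
  have "?n * L * \<delta> = \<eta> / (2 * (V + 1))"
    unfolding \<delta>_def using L by simp
  moreover have "\<eta> / (2 * (V + 1)) * V \<le> \<eta> / (2 * (V + 1)) * (V + 1)"
    using \<eta> V by (intro mult_left_mono) auto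
  moreover have "\<eta> / (2 * (V + 1)) * (V + 1) = \<eta> / 2" using V by (simp add: divide_simps)
  ultimately have \<delta>_small: "?n * L * \<delta> * V \<le> \<eta> / 2" by (simp only:)
  obtain Z and f :: "real^'n \<Rightarrow> real^'n \<Rightarrow> real" where Z: "finite Z" "Z \<subseteq> K"
    and f: "\<And>z. continuous_on UNIV (f z)" "\<And>z y. f z y \<ge> 0"
      "\<And>y. y \<in> K \<Longrightarrow> (\<Sum>z\<in>Z. f z y) = 1" "\<And>z y. f z y \<noteq> 0 \<Longrightarrow> dist y z < \<delta>"
    using continuous_partition_of_unity_small[OF K(1) \<delta>] by metis
  have cf: "continuous_on UNIV (\<lambda>y. complex_of_real (f z y))" for z
    by (intro continuous_intros f)
  have shift: "(\<lambda>x. c\<rho> (x - z)) \<in> test_functions_in K'" if z: "z \<in> Z" for z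
    unfolding test_functions_in_def
  proof (intro CollectI conjI allI impI)
    show "smooth_on UNIV (\<lambda>x. c\<rho> (x - z))" by (rule iter_partial_shift(2)[OF c\<rho>_smooth])
    fix x assume x: "x \<notin> K'"
    have "x - z \<notin> cball 0 \<epsilon>"
    proof
      assume "x - z \<in> cball 0 \<epsilon>"
      then have "z + (x - z) \<in> K'" unfolding K'_def using z Z(2) \<epsilon>(2) by fastforce
      then show False using x by simp
    qed
    then show "c\<rho> (x - z) = 0" using \<rho>(3) by (simp add: c\<rho>_def)
  qed
  define g where "g y = (\<Sum>z\<in>Z. u (\<lambda>x. c\<rho> (x - z)) * complex_of_real (f z y))" for y
  have g_cont: "continuous_on UNIV g"
    unfolding g_def by (intro continuous_intros cf)
  have "cmod (u \<phi> - distribution_of X g \<phi>) \<le> e" if \<phi>: "\<phi> \<in> B" for \<phi>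
  proof -
    have \<phi>K: "\<phi> \<in> test_functions_in K" using \<phi> K(3) by blast
    have \<phi>_smooth: "smooth_on UNIV \<phi>" by (rule test_functions_in_smooth[OF \<phi>K])
    have \<phi>_cont: "continuous_on UNIV \<phi>" using smooth_on_continuous[OF \<phi>_smooth, of "[]"] by simp
    have \<phi>_zero: "\<phi> y = 0" if "y \<notin> cbox (- a) a" for y
      using that a KK' test_functions_in_zero[OF \<phi>K, of y] by blast
    define co where "co z = integral UNIV (\<lambda>y. complex_of_real (f z y) * \<phi> y)" for z
    note int_f = integral_times_test_function(2)[OF cf K(1,2) \<phi>K]
    define P where "P x = (\<Sum>z\<in>Z. co z * c\<rho> (x - z))" for x
    have P_test: "P \<in> test_functions_in K'"
      unfolding P_def using shift
      by (intro fun_subspace_sum fun_subspace_scale fun_subspace_test_functions_in)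
    have shiftX: "(\<lambda>x. c\<rho> (x - z)) \<in> test_functions X" if "z \<in> Z" for z
      using shift[OF that] test_functions_in_subset[OF K' K'X] by blast
    have uP: "u P = (\<Sum>z\<in>Z. co z * u (\<lambda>x. c\<rho> (x - z)))"
      unfolding P_def using shiftX
      by (intro linear_form_sum[OF fun_subspace_test_functions[of X]] distribution_scale[OF u] distribution_add[OF u])
    have "distribution_of X g \<phi> = integral UNIV (\<lambda>y. g y * \<phi> y)"
      using integral_times_test_function(1)[OF g_cont K(1,2) \<phi>K] BX[OF \<phi>] by (simp add: distribution_of_def)
    also have "\<dots> = integral UNIV (\<lambda>y. \<Sum>z\<in>Z. u (\<lambda>x. c\<rho> (x - z)) * (complex_of_real (f z y) * \<phi> y))"
      by (simp add: g_def sum_distrib_right mult.assoc)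
    also have "\<dots> = (\<Sum>z\<in>Z. u (\<lambda>x. c\<rho> (x - z)) * co z)"
      unfolding co_def using int_f Z(1)
      by (subst Henstock_Kurzweil_Integration.integral_sum) (auto intro: integrable_on_mult_right)
    finally have dist_eq: "distribution_of X g \<phi> = u P" unfolding uP by (simp add: mult.commute)
    have close: "deriv_sup is (\<lambda>x. \<phi> x - P x) \<le> \<eta>" if "is": "is \<in> F" for "is"
    proof (rule deriv_sup_le)
      fix x
      let ?\<rho> = "iter_partial is c\<rho>"
      have \<rho>_cont: "continuous_on UNIV ?\<rho>" by (rule smooth_on_continuous[OF c\<rho>_smooth])
      have "iter_partial is P x = (\<Sum>z\<in>Z. iter_partial is (\<lambda>x. co z * c\<rho> (x - z)) x)"
        unfolding P_def using iter_partial_shift(2)[OF c\<rho>_smooth]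
        by (intro iter_partial_sum[OF _ open_UNIV UNIV_I] smooth_on_mult smooth_on_const open_UNIV)
      also have "\<dots> = (\<Sum>z\<in>Z. co z * ?\<rho> (x - z))"
        using iter_partial_cmult[OF iter_partial_shift(2)[OF c\<rho>_smooth] open_UNIV UNIV_I]
        by (simp add: iter_partial_shift(1)[OF c\<rho>_smooth])
      finally have P_deriv: "iter_partial is P x = (\<Sum>z\<in>Z. co z * ?\<rho> (x - z))" .
      have split: "iter_partial is (\<lambda>x. \<phi> x - P x) x = iter_partial is \<phi> x - iter_partial is P x"
      proof -
        have P_smooth: "smooth_on UNIV P" by (rule test_functions_in_smooth[OF P_test])
        have "iter_partial is (\<lambda>x. \<phi> x + (-1) * P x) x = iter_partial is \<phi> x + iter_partial is (\<lambda>x. (-1) * P x) x"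
          by (intro iter_partial_add[OF \<phi>_smooth _ open_UNIV UNIV_I] smooth_on_mult smooth_on_const P_smooth open_UNIV)
        then show ?thesis using iter_partial_cmult[OF P_smooth open_UNIV UNIV_I, of "is" "-1" x] by simp
      qed
      \<comment> \<open>The Riemann sum is close to the convolution, because \<open>f\<^sub>z\<close> lives near \<open>z\<close>.\<close>
      have sum_int: "(\<lambda>y. \<Sum>z\<in>Z. complex_of_real (f z y) * \<phi> y * ?\<rho> (x - z)) integrable_on UNIV"
        using int_f Z(1) by (intro integrable_sum integrable_on_mult_left)
      have conv_cont: "continuous_on UNIV (\<lambda>y. \<phi> y * ?\<rho> (x - y))"
        by (intro continuous_intros \<phi>_cont continuous_on_compose2[OF \<rho>_cont]) auto
      have conv_int: "(\<lambda>y. \<phi> y * ?\<rho> (x - y)) integrable_on UNIV"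
        using \<phi>_zero by (intro integral_compact_support(2)[OF conv_cont, of "- a" a]) simp
      have "iter_partial is P x = integral UNIV (\<lambda>y. \<Sum>z\<in>Z. complex_of_real (f z y) * \<phi> y * ?\<rho> (x - z))"
        unfolding P_deriv co_def using int_f Z(1)
        by (subst Henstock_Kurzweil_Integration.integral_sum) (auto intro: integrable_on_mult_left)
      then have diff: "iter_partial is P x - conv \<phi> ?\<rho> x =
          integral UNIV (\<lambda>y. (\<Sum>z\<in>Z. complex_of_real (f z y) * \<phi> y * ?\<rho> (x - z)) - \<phi> y * ?\<rho> (x - y))"
        unfolding conv_def using Henstock_Kurzweil_Integration.integral_diff[OF sum_int conv_int] by simp
      let ?d = "\<lambda>y. (\<Sum>z\<in>Z. complex_of_real (f z y) * \<phi> y * ?\<rho> (x - z)) - \<phi> y * ?\<rho> (x - y)"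
      have d_cont: "continuous_on UNIV ?d"
        by (intro continuous_intros cf \<phi>_cont continuous_on_compose2[OF \<rho>_cont]) auto
      have d_zero: "?d y = 0" if "y \<notin> cbox (- a) a" for y using \<phi>_zero[OF that] by simp
      have d_le: "cmod (?d y) \<le> ?n * L * \<delta> * M0" for y
      proof (cases "y \<in> K")
        case False
        then have "\<phi> y = 0" using test_functions_in_zero[OF \<phi>K] by blast
        then show ?thesis using nL \<delta> by (simp add: M0_def)
      next
        case True
        have "complex_of_real (\<Sum>z\<in>Z. f z y) = 1" using f(3)[OF True] by simp
        then have one: "(\<Sum>z\<in>Z. complex_of_real (f z y)) * (\<phi> y * ?\<rho> (x - y)) = \<phi> y * ?\<rho> (x - y)" by simp
        have "(\<Sum>z\<in>Z. complex_of_real (f z y) * (\<phi> y * (?\<rho> (x - z) - ?\<rho> (x - y)))) =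
            (\<Sum>z\<in>Z. complex_of_real (f z y) * \<phi> y * ?\<rho> (x - z)) -
            (\<Sum>z\<in>Z. complex_of_real (f z y)) * (\<phi> y * ?\<rho> (x - y))"
          by (simp only: sum_distrib_right sum_subtractf[symmetric] right_diff_distrib mult.assoc)
        then have "?d y = (\<Sum>z\<in>Z. complex_of_real (f z y) * (\<phi> y * (?\<rho> (x - z) - ?\<rho> (x - y))))"
          unfolding one by (rule sym)
        also have "cmod \<dots> \<le> (\<Sum>z\<in>Z. f z y * (M0 * (?n * L * \<delta>)))"
        proof (rule sum_norm_le)
          fix z
          show "cmod (complex_of_real (f z y) * (\<phi> y * (?\<rho> (x - z) - ?\<rho> (x - y)))) \<le> f z y * (M0 * (?n * L * \<delta>))"
          proof (cases "f z y = 0")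
            case False
            have "cmod (?\<rho> (x - z) - ?\<rho> (x - y)) \<le> ?n * L * norm ((x - z) - (x - y))"
              using smooth_on_differentiable_at[OF c\<rho>_smooth open_UNIV UNIV_I] L_le[OF "is"]
              by (intro lipschitz_of_partial_bound)
            also have "\<dots> \<le> ?n * L * \<delta>"
              using f(4)[OF False] nL by (intro mult_left_mono) (auto simp: dist_norm)
            finally show ?thesis unfolding norm_mult using f(2)[of z y] M0[OF \<phi>]
              by (auto intro!: mult_left_mono mult_mono simp: M0_def)
          qed simp
        qed
        also have "\<dots> = (\<Sum>z\<in>Z. f z y) * (M0 * (?n * L * \<delta>))" by (simp add: sum_distrib_right)
        finally show ?thesis using f(3)[OF True] by (simp add: mult_ac)
      qed
      have d_int: "(?d has_integral integral (cbox (- a) a) ?d) (cbox (- a) a)"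
        using d_cont continuous_on_subset by (intro integrable_integral integrable_continuous) blast
      have "0 \<le> ?n * L * \<delta> * M0" using nL \<delta> by (simp add: M0_def)
      from has_integral_bound[OF this d_int d_le]
      have "cmod (integral (cbox (- a) a) ?d) \<le> (?n * L * \<delta> * M0) * measure lborel (cbox (- a) a)" .
      then have "cmod (iter_partial is P x - conv \<phi> ?\<rho> x) \<le> (?n * L * \<delta> * M0) * measure lborel (cbox (- a) a)"
        using diff integral_compact_support(3)[OF d_cont d_zero] by simp
      then have near1: "cmod (iter_partial is P x - conv \<phi> ?\<rho> x) \<le> \<eta> / 2"
        using \<delta>_small by (simp add: V_def mult.assoc)
      \<comment> \<open>The derivatives of the convolution may be moved from the mollifier to \<open>\<phi>\<close>.\<close>
      have c\<rho>_cont: "continuous_on UNIV c\<rho>" using smooth_on_continuous[OF c\<rho>_smooth, of "[]"] by simp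
      obtain b :: "real^'n" where b: "cball 0 \<epsilon> \<subseteq> cbox (- b) b"
        using bounded_subset_cbox_symmetric[OF bounded_cball] by blast
      have c\<rho>_zero: "c\<rho> y = 0" if "y \<notin> cbox (- b) b" for y
      proof -
        have "y \<notin> cball 0 \<epsilon>" using that b by blast
        then show ?thesis using \<rho>(3) by (simp add: c\<rho>_def)
      qed
      have "conv \<phi> ?\<rho> x = iter_partial is (conv \<phi> c\<rho>) x"
        using iter_partial_conv[OF \<phi>_cont \<phi>_zero c\<rho>_smooth] by simp
      also have "conv \<phi> c\<rho> = conv c\<rho> \<phi>"
        using conv_commute[OF \<phi>_cont \<phi>_zero c\<rho>_cont] by blast
      also have "iter_partial is (conv c\<rho> \<phi>) x = conv c\<rho> (iter_partial is \<phi>) x"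
        using iter_partial_conv[OF c\<rho>_cont c\<rho>_zero \<phi>_smooth] by simp
      finally have "conv \<phi> ?\<rho> x = conv c\<rho> (iter_partial is \<phi>) x" .
      moreover have "cmod (conv c\<rho> (iter_partial is \<phi>) x - iter_partial is \<phi> x) \<le> ?n * M * \<epsilon>"
        unfolding c\<rho>_def using smooth_on_continuous[OF \<rho>(1), of "[]"] M[OF \<phi> "is"]
        by (intro conv_mollifier_close[OF _ \<rho>(2-4)] smooth_on_iter_partial[OF \<phi>_smooth]) auto
      ultimately have near2: "cmod (conv \<phi> ?\<rho> x - iter_partial is \<phi> x) \<le> \<eta> / 2"
        using \<epsilon>_small by simp
      have "cmod (iter_partial is \<phi> x - iter_partial is P x) \<le>
          cmod (iter_partial is P x - conv \<phi> ?\<rho> x) + cmod (conv \<phi> ?\<rho> x - iter_partial is \<phi> x)"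
        using dist_triangle[of "iter_partial is \<phi> x" "iter_partial is P x" "conv \<phi> ?\<rho> x"]
        by (simp add: dist_norm norm_minus_commute)
      then show "cmod (iter_partial is (\<lambda>x. \<phi> x - P x) x) \<le> \<eta>"
        unfolding split using near1 near2 by linarith
    qed
    have \<phi>K': "\<phi> \<in> test_functions_in K'" using \<phi>K test_functions_in_mono[OF KK'] by blast
    have PX: "P \<in> test_functions X" using P_test test_functions_in_subset[OF K' K'X] by blast
    have "u \<phi> - distribution_of X g \<phi> = u (\<lambda>x. \<phi> x - P x)"
      unfolding dist_eq
      by (rule distribution_diff[OF u BX[OF \<phi>] PX, symmetric])
    also have "cmod \<dots> \<le> C * (\<Sum>is\<in>F. deriv_sup is (\<lambda>x. \<phi> x - P x))"
      using F(3)[OF fun_subspace_diff[OF fun_subspace_test_functions_in \<phi>K' P_test]] .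
    also have "\<dots> \<le> C * (real (card F) * \<eta>)"
      using F(2) close by (intro mult_left_mono sum_bounded_above) auto
    also have "\<dots> \<le> C * ((1 + real (card F)) * \<eta>)"
      using F(2) \<eta> by (intro mult_left_mono mult_right_mono) auto
    also have "\<dots> = C * (1 + real (card F)) * \<eta>" by simp
    also have "\<dots> = e"
      unfolding \<eta>_def using F(2) by (simp add: add_nonneg_eq_0_iff)
    finally show ?thesis .
  qed
  then show ?thesis using continuous_on_subset[OF g_cont subset_UNIV] by blast
qed

section \<open>Linear differential operators\<close>

text \<open>Finite sums of terms \<open>a \<partial>\<^sup>\<alpha>\<close> with smooth coefficients \<open>a\<close> on \<open>X\<close>. Derivatives of transposed test functions
  are of this form up to a change of coordinates, which yields their existence and their bounds.\<close>

inductive diffop :: "(real^'n::finite) set \<Rightarrow> ((real^'n \<Rightarrow> complex) \<Rightarrow> real^'n \<Rightarrow> complex) \<Rightarrow> bool"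
  for X where
  diffop_term: "smooth_on X a \<Longrightarrow> diffop X (\<lambda>\<phi> x. a x * iter_partial is \<phi> x)"
| diffop_add: "diffop X S \<Longrightarrow> diffop X T \<Longrightarrow> diffop X (\<lambda>\<phi> x. S \<phi> x + T \<phi> x)"

lemma diffop_smooth:
  assumes "diffop X T" "open X" "smooth_on UNIV \<phi>"
  shows "smooth_on X (T \<phi>)"
  using assms(1)
proof induction
  case (diffop_term a "is")
  then show ?case
    using assms by (intro smooth_on_mult smooth_on_subset[OF smooth_on_iter_partial]) auto
next
  case (diffop_add S T)
  then show ?case using smooth_on_add[OF assms(2)] by blast
qed

lemma diffop_mult:
  assumes "diffop X T" "open X" "smooth_on X b"
  shows "diffop X (\<lambda>\<phi> x. b x * T \<phi> x)"
  using assms(1)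
proof induction
  case (diffop_term a "is")
  then have "smooth_on X (\<lambda>x. b x * a x)" using smooth_on_mult assms by blast
  from diffop.diffop_term[OF this, of "is"] show ?case by (simp add: mult.assoc)
next
  case (diffop_add S T)
  from diffop.diffop_add[OF diffop_add.IH] show ?case by (simp add: distrib_left)
qed

lemma diffop_sum:
  assumes "finite I" "open X" "\<And>i. i \<in> I \<Longrightarrow> diffop X (T i)"
  shows "diffop X (\<lambda>\<phi> x. \<Sum>i\<in>I. T i \<phi> x)"
  using assms(1,3)
proof (induction I rule: finite_induct)
  case empty
  then show ?case using diffop_term[OF smooth_on_const[OF assms(2), of 0], of "[]"] by simp
next
  case (insert i I)
  then have "diffop X (\<lambda>\<phi> x. T i \<phi> x + (\<Sum>i\<in>I. T i \<phi> x))" by (intro diffop_add) auto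
  then show ?case using insert by simp
qed

lemma diffop_partial:
  assumes "diffop X T" and X: "open X"
  shows "\<exists>T'. diffop X T' \<and> (\<forall>\<phi>. smooth_on UNIV \<phi> \<longrightarrow> (\<forall>x\<in>X. partial j (T \<phi>) x = T' \<phi> x))"
  using assms(1)
proof induction
  case (diffop_term a "is")
  let ?T' = "\<lambda>\<phi> x. partial j a x * iter_partial is \<phi> x + a x * iter_partial (j # is) \<phi> x"
  have "diffop X ?T'"
    using diffop_term smooth_on_partial by (intro diffop_add diffop.diffop_term) blast+
  moreover have "partial j (\<lambda>x. a x * iter_partial is \<phi> x) x = ?T' \<phi> x"
    if \<phi>: "smooth_on UNIV \<phi>" and x: "x \<in> X" for \<phi> x
  proof -
    have "((\<lambda>x. a x * iter_partial is \<phi> x) has_derivative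
        (\<lambda>h. a x * frechet_derivative (iter_partial is \<phi>) (at x) h +
             frechet_derivative a (at x) h * iter_partial is \<phi> x)) (at x)"
      using smooth_on_differentiable_at[OF \<phi> open_UNIV UNIV_I, of "is"]
        smooth_on_differentiable_at[OF diffop_term X x, of "[]"]
      by (intro has_derivative_mult) (auto simp: frechet_derivative_works)
    from partial_eqI[OF this] show ?thesis by simp
  qed
  ultimately show ?case by blast
next
  case (diffop_add S T)
  then obtain S' T' where ST: "diffop X S'" "diffop X T'"
    "\<And>\<phi> x. smooth_on UNIV \<phi> \<Longrightarrow> x \<in> X \<Longrightarrow> partial j (S \<phi>) x = S' \<phi> x"
    "\<And>\<phi> x. smooth_on UNIV \<phi> \<Longrightarrow> x \<in> X \<Longrightarrow> partial j (T \<phi>) x = T' \<phi> x"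
    by blast
  have "partial j (\<lambda>x. S \<phi> x + T \<phi> x) x = S' \<phi> x + T' \<phi> x"
    if \<phi>: "smooth_on UNIV \<phi>" and x: "x \<in> X" for \<phi> x
    using iter_partial_add[OF diffop_smooth[OF diffop_add.hyps(1) X \<phi>] diffop_smooth[OF diffop_add.hyps(2) X \<phi>] X x, of "[j]"]
      ST(3,4)[OF \<phi> x] by simp
  then show ?case using diffop.diffop_add[OF ST(1,2)] by blast
qed

lemma diffop_bound:
  assumes "diffop X T" and K: "compact K" "K \<subseteq> X"
  shows "\<exists>F C. finite F \<and> C \<ge> 0 \<and>
    (\<forall>\<phi>\<in>test_functions_in K. \<forall>x\<in>K. cmod (T \<phi> x) \<le> C * (\<Sum>is\<in>F. deriv_sup is \<phi>))"
  using assms(1)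
proof induction
  case (diffop_term a "is")
  have "continuous_on K a"
    using smooth_on_continuous[OF diffop_term, of "[]"] K(2) continuous_on_subset by auto
  then have "bounded (a ` K)" using K compact_continuous_image compact_imp_bounded by blast
  then obtain M where M: "\<And>x. x \<in> K \<Longrightarrow> cmod (a x) \<le> M" unfolding bounded_iff by auto
  have "cmod (a x * iter_partial is \<phi> x) \<le> \<bar>M\<bar> * (\<Sum>is\<in>{is}. deriv_sup is \<phi>)"
    if "\<phi> \<in> test_functions_in K" "x \<in> K" for \<phi> x
  proof -
    have "\<phi> \<in> test_functions X" using that test_functions_in_subset[OF K] by blast
    from norm_iter_partial_le_deriv_sup[OF this, of "is" x] show ?thesis
      unfolding norm_mult using M[OF that(2)] by (auto intro!: mult_mono)
  qed
  then show ?case by (intro exI[of _ "{is}"] exI[of _ "\<bar>M\<bar>"]) auto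
next
  case (diffop_add S T)
  then obtain F C G D where F: "finite F" "C \<ge> 0" "finite G" "D \<ge> 0"
    "\<And>\<phi> x. \<phi> \<in> test_functions_in K \<Longrightarrow> x \<in> K \<Longrightarrow> cmod (S \<phi> x) \<le> C * (\<Sum>is\<in>F. deriv_sup is \<phi>)"
    "\<And>\<phi> x. \<phi> \<in> test_functions_in K \<Longrightarrow> x \<in> K \<Longrightarrow> cmod (T \<phi> x) \<le> D * (\<Sum>is\<in>G. deriv_sup is \<phi>)"
    by metis
  have "cmod (S \<phi> x + T \<phi> x) \<le> (C + D) * (\<Sum>is\<in>F \<union> G. deriv_sup is \<phi>)"
    if \<phi>: "\<phi> \<in> test_functions_in K" and x: "x \<in> K" for \<phi> x
  proof -
    have "\<phi> \<in> test_functions X" using \<phi> test_functions_in_subset[OF K] by blast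
    note nn = deriv_sup_nonneg[OF this]
    have "C * (\<Sum>is\<in>F. deriv_sup is \<phi>) \<le> C * (\<Sum>is\<in>F \<union> G. deriv_sup is \<phi>)"
      using F nn by (intro mult_left_mono sum_mono2) auto
    moreover have "D * (\<Sum>is\<in>G. deriv_sup is \<phi>) \<le> D * (\<Sum>is\<in>F \<union> G. deriv_sup is \<phi>)"
      using F nn by (intro mult_left_mono sum_mono2) auto
    ultimately show ?thesis
      using norm_triangle_ineq[of "S \<phi> x" "T \<phi> x"] F(5)[OF \<phi> x] F(6)[OF \<phi> x]
      by (simp add: distrib_right)
  qed
  then show ?case using F(1-4) by (intro exI[of _ "F \<union> G"] exI[of _ "C + D"]) auto
qed

section \<open>The transpose of the weighted composition operator\<close>

locale weighted_composition =
  fixes X :: "(real^'n) set" and w :: "real^'n \<Rightarrow> complex" and \<psi> :: "real^'n \<Rightarrow> real^'n"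
  assumes open_X: "open X"
    and smooth_w: "smooth_on X w"
    and smooth_\<psi>: "smooth_on X \<psi>"
    and \<psi>_maps: "\<psi> ` X \<subseteq> X"
    and inj_\<psi>: "inj_on \<psi> X"
    and det_nz: "\<And>x. x \<in> X \<Longrightarrow> det (jacobian \<psi> (at x)) \<noteq> 0"
begin

definition "\<theta> = the_inv_into X \<psi>"
definition "Y = \<psi> ` X"
definition "J x = jacobian \<psi> (at x)"

text \<open>By Cramer's rule this is the \<open>(j, i)\<close> entry of the inverse Jacobian matrix.\<close>

definition jinv :: "'n \<Rightarrow> 'n \<Rightarrow> real^'n \<Rightarrow> real" where
  "jinv j i x = det (\<chi> r s. if s = j then axis i 1 $ r else J x $ r $ s) / det (J x)"

definition weight :: "real^'n \<Rightarrow> complex" where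
  "weight x = w x / of_real \<bar>det (J x)\<bar>"

definition transpose_op :: "(real^'n \<Rightarrow> complex) \<Rightarrow> real^'n \<Rightarrow> complex" where
  "transpose_op \<phi> y = (if y \<in> Y then weight (\<theta> y) * \<phi> (\<theta> y) else 0)"

lemma \<theta>_\<psi>: "x \<in> X \<Longrightarrow> \<theta> (\<psi> x) = x"
  unfolding \<theta>_def by (rule the_inv_into_f_f[OF inj_\<psi>])

lemma \<psi>_\<theta>: "y \<in> Y \<Longrightarrow> \<psi> (\<theta> y) = y" and \<theta>_in: "y \<in> Y \<Longrightarrow> \<theta> y \<in> X"
  unfolding Y_def using \<theta>_\<psi> by auto

lemma \<psi>_derivative: "x \<in> X \<Longrightarrow> (\<psi> has_derivative (\<lambda>h. J x *v h)) (at x)"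
  using smooth_on_differentiable_at[OF smooth_\<psi> open_X, of x "[]"] jacobian_works unfolding J_def by auto

lemma J_component: "x \<in> X \<Longrightarrow> J x $ r $ s = partial s \<psi> x $ r"
  unfolding J_def jacobian_def matrix_def by simp

lemma continuous_\<psi>: "continuous_on X \<psi>"
  using smooth_on_continuous[OF smooth_\<psi>, of "[]"] by simp

lemma open_Y: "open Y"
  unfolding Y_def by (rule invariance_of_domain[OF continuous_\<psi> open_X inj_\<psi>])

lemma Y_subset: "Y \<subseteq> X"
  unfolding Y_def by (rule \<psi>_maps)

lemma continuous_\<theta>: "continuous_on Y \<theta>"
  unfolding Y_def by (rule continuous_on_inverse_open[OF open_X continuous_\<psi>]) (auto simp: \<theta>_\<psi>)

lemma smooth_J: "smooth_on X (\<lambda>x. J x $ r $ s)"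
proof -
  have "smooth_on X (\<lambda>x. partial s \<psi> x $ r)"
    by (rule smooth_on_component[OF open_X smooth_on_partial[OF smooth_\<psi>]])
  moreover have "smooth_on X (\<lambda>x. J x $ r $ s) \<longleftrightarrow> smooth_on X (\<lambda>x. partial s \<psi> x $ r)"
    by (rule smooth_on_cong[OF open_X J_component])
  ultimately show ?thesis by blast
qed

lemma smooth_det_J: "smooth_on X (\<lambda>x. det (J x))"
  by (rule smooth_on_det[OF open_X]) (rule smooth_J)

lemma det_J_nz: "x \<in> X \<Longrightarrow> det (J x) \<noteq> 0"
  unfolding J_def by (rule det_nz)

lemma smooth_jinv: "smooth_on X (jinv j i)"
proof -
  have "smooth_on X (\<lambda>x. det (\<chi> r s. if s = j then axis i 1 $ r else J x $ r $ s))"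
  proof (rule smooth_on_det[OF open_X])
    show "smooth_on X (\<lambda>x. (\<chi> r s. if s = j then axis i 1 $ r else J x $ r $ s) $ r $ s)" for r s
      by (cases "s = j") (simp_all add: smooth_J smooth_on_const[OF open_X])
  qed
  then have "smooth_on X (\<lambda>x. det (\<chi> r s. if s = j then axis i 1 $ r else J x $ r $ s) * inverse (det (J x)))"
    by (intro smooth_on_mult smooth_on_inverse open_X smooth_det_J det_J_nz)
  then show ?thesis unfolding jinv_def[abs_def] divide_inverse .
qed

lemma smooth_weight: "smooth_on X weight"
proof -
  have "smooth_on X (\<lambda>x. sgn (det (J x)))"
    using smooth_on_continuous[OF smooth_det_J, of "[]"] det_J_nz by (intro smooth_on_sgn open_X) auto
  then have "smooth_on X (\<lambda>x. w x * of_real (sgn (det (J x)) * inverse (det (J x))))"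
    by (intro smooth_on_mult smooth_on_of_real smooth_on_inverse open_X smooth_w smooth_det_J det_J_nz)
  moreover have "weight x = w x * of_real (sgn (det (J x)) * inverse (det (J x)))" if "x \<in> X" for x
  proof -
    have "inverse \<bar>d\<bar> = sgn d * inverse d" if "d \<noteq> 0" for d :: real
      using that by (cases "d > 0") simp_all
    then show ?thesis
      unfolding weight_def divide_inverse of_real_inverse[symmetric] using det_J_nz[OF that] by simp
  qed
  then have "smooth_on X weight \<longleftrightarrow> smooth_on X (\<lambda>x. w x * of_real (sgn (det (J x)) * inverse (det (J x))))"
    by (rule smooth_on_cong[OF open_X])
  ultimately show ?thesis by blast
qed

lemma \<theta>_derivative:
  assumes y: "y \<in> Y"
  obtains \<theta>' where "(\<theta> has_derivative \<theta>') (at y)" "\<And>i j. \<theta>' (axis i 1) $ j = jinv j i (\<theta> y)"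
proof -
  let ?J = "J (\<theta> y)"
  have "invertible ?J" using det_J_nz[OF \<theta>_in[OF y]] by (simp add: invertible_det_nz)
  then obtain B where B: "?J ** B = mat 1" "B ** ?J = mat 1" unfolding invertible_def by blast
  show ?thesis
  proof (rule that)
    show "(\<theta> has_derivative (\<lambda>h. B *v h)) (at y)"
    proof (rule has_derivative_inverse_basic)
      show "(\<psi> has_derivative (\<lambda>h. ?J *v h)) (at (\<theta> y))" by (rule \<psi>_derivative[OF \<theta>_in[OF y]])
      show "(\<lambda>h. B *v h) \<circ> (\<lambda>h. ?J *v h) = id"
        by (simp add: fun_eq_iff matrix_vector_mul_assoc B)
      show "continuous (at y) \<theta>"
        using continuous_\<theta> open_Y y by (simp add: continuous_on_eq_continuous_at)
    qed (use y open_Y \<psi>_\<theta> in auto)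
    fix i j
    have "?J *v (B *v axis i 1) = axis i 1" by (simp add: matrix_vector_mul_assoc B)
    then have "B *v axis i 1 = (\<chi> k. det (\<chi> r s. if s = k then axis i 1 $ r else ?J $ r $ s) / det ?J)"
      using cramer[OF det_J_nz[OF \<theta>_in[OF y]]] by blast
    then show "(B *v axis i 1) $ j = jinv j i (\<theta> y)" by (simp add: jinv_def)
  qed
qed

text \<open>The derivative of \<open>\<theta>\<close> at \<open>y\<close> is the inverse Jacobian matrix at \<open>\<theta> y\<close>, so differentiating
  \<open>y \<mapsto> (T \<phi>) (\<theta> y)\<close> produces coefficients that are again smooth functions of \<open>\<theta> y\<close>.\<close>

lemma diffop_transport:
  assumes T: "diffop X T"
  shows "\<exists>T'. diffop X T' \<and>
    (\<forall>\<phi>. smooth_on UNIV \<phi> \<longrightarrow> (\<forall>y\<in>Y. partial i (\<lambda>y. T \<phi> (\<theta> y)) y = T' \<phi> (\<theta> y)))"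
proof -
  have "\<forall>j. \<exists>T'. diffop X T' \<and> (\<forall>\<phi>. smooth_on UNIV \<phi> \<longrightarrow> (\<forall>x\<in>X. partial j (T \<phi>) x = T' \<phi> x))"
    using diffop_partial[OF T open_X] by blast
  then obtain P where P: "\<And>j. diffop X (P j)"
      "\<And>j \<phi> x. smooth_on UNIV \<phi> \<Longrightarrow> x \<in> X \<Longrightarrow> partial j (T \<phi>) x = P j \<phi> x"
    by metis
  let ?T' = "\<lambda>\<phi> x. \<Sum>j\<in>UNIV. of_real (jinv j i x) * P j \<phi> x"
  have "diffop X ?T'"
    by (intro diffop_sum diffop_mult P open_X smooth_on_of_real smooth_jinv finite)
  moreover have "partial i (\<lambda>y. T \<phi> (\<theta> y)) y = ?T' \<phi> (\<theta> y)"
    if \<phi>: "smooth_on UNIV \<phi>" and y: "y \<in> Y" for \<phi> y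
  proof -
    obtain \<theta>' where \<theta>': "(\<theta> has_derivative \<theta>') (at y)" "\<And>i j. \<theta>' (axis i 1) $ j = jinv j i (\<theta> y)"
      using \<theta>_derivative[OF y] by blast
    have "T \<phi> differentiable (at (\<theta> y))"
      using smooth_on_differentiable_at[OF diffop_smooth[OF T open_X \<phi>] open_X \<theta>_in[OF y], of "[]"] by simp
    from partial_eqI[OF partial_compose[OF this \<theta>'(1)]]
    show ?thesis using P(2)[OF \<phi> \<theta>_in[OF y]] by (simp add: \<theta>'(2) scaleR_conv_of_real)
  qed
  ultimately show ?thesis by blast
qed

lemma iter_partial_transport:
  "\<exists>T. diffop X T \<and> (\<forall>\<phi>. smooth_on UNIV \<phi> \<longrightarrow>
     (\<forall>y\<in>Y. iter_partial is (transpose_op \<phi>) y = T \<phi> (\<theta> y)))"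
proof (induction "is")
  case Nil
  then show ?case
    using diffop_term[OF smooth_weight, of "[]"]
    by (intro exI[of _ "\<lambda>\<phi> x. weight x * iter_partial [] \<phi> x"]) (simp add: transpose_op_def)
next
  case (Cons i "is")
  then obtain T where T: "diffop X T"
    "\<And>\<phi> y. smooth_on UNIV \<phi> \<Longrightarrow> y \<in> Y \<Longrightarrow> iter_partial is (transpose_op \<phi>) y = T \<phi> (\<theta> y)"
    by blast
  obtain T' where T': "diffop X T'"
    "\<And>\<phi> y. smooth_on UNIV \<phi> \<Longrightarrow> y \<in> Y \<Longrightarrow> partial i (\<lambda>y. T \<phi> (\<theta> y)) y = T' \<phi> (\<theta> y)"
    using diffop_transport[OF T(1), of i] by blast
  have "iter_partial (i # is) (transpose_op \<phi>) y = T' \<phi> (\<theta> y)"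
    if \<phi>: "smooth_on UNIV \<phi>" and y: "y \<in> Y" for \<phi> y
    using frechet_derivative_cong_open[OF open_Y y, of "iter_partial is (transpose_op \<phi>)" "\<lambda>y. T \<phi> (\<theta> y)"]
      T(2)[OF \<phi>] T'(2)[OF \<phi> y] by simp
  then show ?case using T'(1) by blast
qed

lemma compact_\<psi>_image: "compact K \<Longrightarrow> K \<subseteq> X \<Longrightarrow> compact (\<psi> ` K)"
  using compact_continuous_image continuous_on_subset[OF continuous_\<psi>] by blast

text \<open>The function is smooth on \<open>Y\<close> and zero on the complement of the compact set \<open>\<psi> ` K\<close>, and these open
  sets cover the space.\<close>

lemma transpose_op_in:
  assumes K: "compact K" "K \<subseteq> X" and \<phi>: "\<phi> \<in> test_functions_in K"
  shows "transpose_op \<phi> \<in> test_functions_in (\<psi> ` K)"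
proof -
  have zero: "transpose_op \<phi> y = 0" if "y \<notin> \<psi> ` K" for y
  proof (cases "y \<in> Y")
    case True
    then have "\<theta> y \<notin> K" using that \<psi>_\<theta> by (metis imageI)
    then show ?thesis using test_functions_in_zero[OF \<phi>] by (simp add: transpose_op_def)
  qed (simp add: transpose_op_def)
  have "smooth_on Y (transpose_op \<phi>)"
    unfolding smooth_on_def differentiable_on_eq_differentiable_at[OF open_Y]
  proof (intro allI ballI)
    fix "is" y assume y: "y \<in> Y"
    obtain T where T: "diffop X T"
      "\<And>\<phi> y. smooth_on UNIV \<phi> \<Longrightarrow> y \<in> Y \<Longrightarrow> iter_partial is (transpose_op \<phi>) y = T \<phi> (\<theta> y)"
      using iter_partial_transport by blast
    have "T \<phi> differentiable (at (\<theta> y))"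
      using smooth_on_differentiable_at[OF diffop_smooth[OF T(1) open_X test_functions_in_smooth[OF \<phi>]] open_X \<theta>_in[OF y], of "[]"]
      by simp
    note diff = this
    obtain \<theta>' where \<theta>': "(\<theta> has_derivative \<theta>') (at y)" by (rule \<theta>_derivative[OF y])
    have "(iter_partial is (transpose_op \<phi>) has_derivative
        (\<lambda>h. \<Sum>j\<in>UNIV. \<theta>' h $ j *\<^sub>R partial j (T \<phi>) (\<theta> y))) (at y)"
      by (rule has_derivative_transform_within_open[OF partial_compose[OF diff \<theta>'] open_Y y])
        (rule T(2)[OF test_functions_in_smooth[OF \<phi>], symmetric])
    then show "iter_partial is (transpose_op \<phi>) differentiable (at y)"
      unfolding differentiable_def by blast
  qed
  moreover have closed: "open (- \<psi> ` K)"
    using compact_\<psi>_image[OF K] compact_imp_closed open_Compl by blast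
  moreover have "smooth_on (- \<psi> ` K) (transpose_op \<phi>)"
    using smooth_on_cong[OF closed, of "transpose_op \<phi>" "\<lambda>x. 0"] zero smooth_on_const[OF closed, of 0] by simp
  ultimately have "smooth_on (Y \<union> - \<psi> ` K) (transpose_op \<phi>)"
    using smooth_on_Un open_Y by blast
  moreover have "Y \<union> - \<psi> ` K = UNIV" using K(2) unfolding Y_def by blast
  ultimately show ?thesis unfolding test_functions_in_def using zero by simp
qed

text \<open>On \<open>\<psi> ` K\<close> a derivative is a differential operator applied to \<open>\<phi>\<close> at a point of \<open>K\<close>, where the
  coefficients are bounded.\<close>

lemma transpose_op_dominated:
  assumes K: "compact K" "K \<subseteq> X"
  shows "dominated_on K (\<lambda>\<phi>. deriv_sup is (transpose_op \<phi>))"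
proof -
  obtain T where T: "diffop X T"
      "\<And>\<phi> y. smooth_on UNIV \<phi> \<Longrightarrow> y \<in> Y \<Longrightarrow> iter_partial is (transpose_op \<phi>) y = T \<phi> (\<theta> y)"
    using iter_partial_transport by blast
  obtain F C where F: "finite F" "C \<ge> 0"
    "\<And>\<phi> x. \<phi> \<in> test_functions_in K \<Longrightarrow> x \<in> K \<Longrightarrow> cmod (T \<phi> x) \<le> C * (\<Sum>is\<in>F. deriv_sup is \<phi>)"
    using diffop_bound[OF T(1) K] by blast
  have le: "deriv_sup is (transpose_op \<phi>) \<le> C * (\<Sum>is\<in>F. deriv_sup is \<phi>)"
    if \<phi>: "\<phi> \<in> test_functions_in K" for \<phi>
  proof (rule deriv_sup_le)
    fix y
    have "\<phi> \<in> test_functions X" using \<phi> test_functions_in_subset[OF K] by blast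
    then have nn: "0 \<le> C * (\<Sum>is\<in>F. deriv_sup is \<phi>)"
      using F(2) deriv_sup_nonneg by (intro mult_nonneg_nonneg sum_nonneg) blast+
    show "cmod (iter_partial is (transpose_op \<phi>) y) \<le> C * (\<Sum>is\<in>F. deriv_sup is \<phi>)"
    proof (cases "y \<in> \<psi> ` K")
      case True
      then have "y \<in> Y" "\<theta> y \<in> K" using K(2) \<theta>_\<psi> unfolding Y_def by auto
      then show ?thesis using T(2)[OF test_functions_in_smooth[OF \<phi>]] F(3)[OF \<phi>] by simp
    next
      case False
      then show ?thesis
        using test_functions_in_zero[OF test_function_iter_partial[OF transpose_op_in[OF K \<phi>] compact_\<psi>_image[OF K]]] nn
        by simp
    qed
  qed
  have "dominated_on K (\<lambda>\<phi>. C * (\<Sum>is\<in>F. deriv_sup is \<phi>))"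
    by (intro dominated_by_scale dominated_by_sum[OF seminorm_deriv_sups_in[OF K(1)]] F(2) dominated_by_member rangeI)
  then show ?thesis by (rule dominated_by_mono) (rule le)
qed

lemma transpose_op_test_function:
  assumes "\<phi> \<in> test_functions X" shows "transpose_op \<phi> \<in> test_functions X"
proof -
  obtain K where K: "compact K" "K \<subseteq> X" "\<phi> \<in> test_functions_in K" using test_functionsE[OF assms] .
  have "\<psi> ` K \<subseteq> X" using K(2) \<psi>_maps by blast
  then show ?thesis
    using transpose_op_in[OF K] test_functions_in_subset[OF compact_\<psi>_image[OF K(1,2)]] by blast
qed

lemma transpose_op_scale: "transpose_op (\<lambda>x. c * \<phi> x) = (\<lambda>y. c * transpose_op \<phi> y)"
  and transpose_op_add: "transpose_op (\<lambda>x. \<phi> x + \<eta> x) = (\<lambda>y. transpose_op \<phi> y + transpose_op \<eta> y)"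
  by (auto simp: transpose_op_def fun_eq_iff algebra_simps)

lemma transpose_op_bounded:
  assumes "lc_bounded (test_topology X) B"
  shows "lc_bounded (test_topology X) (transpose_op ` B)"
proof -
  obtain K where K: "compact K" "K \<subseteq> X" "B \<subseteq> test_functions_in K" "\<And>is. bdd_above (deriv_sup is ` B)"
    using assms unfolding lc_bounded_test_topology_iff[OF open_X] by blast
  have "\<psi> ` K \<subseteq> X" using K(2) \<psi>_maps by blast
  moreover have "transpose_op ` B \<subseteq> test_functions_in (\<psi> ` K)" using transpose_op_in[OF K(1,2)] K(3) by blast
  moreover have "bdd_above (deriv_sup is ` transpose_op ` B)" for "is"
    using dominated_bdd_above[OF K(1,3,4) transpose_op_dominated[OF K(1,2)], of "is"]
    unfolding image_image .
  ultimately show ?thesis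
    unfolding lc_bounded_test_topology_iff[OF open_X] using compact_\<psi>_image[OF K(1,2)] by blast
qed

text \<open>The transpose on distributions. The value zero elsewhere is the convention for functionals on test
  functions.\<close>

definition pullback :: "((real^'n \<Rightarrow> complex) \<Rightarrow> complex) \<Rightarrow> (real^'n \<Rightarrow> complex) \<Rightarrow> complex" where
  "pullback u \<phi> = (if \<phi> \<in> test_functions X then u (transpose_op \<phi>) else 0)"

lemma pullback_in_distributions:
  assumes u: "u \<in> distributions X"
  shows "pullback u \<in> distributions X"
  unfolding distributions_iff
proof (intro conjI ballI allI impI)
  fix \<phi> c assume \<phi>: "\<phi> \<in> test_functions X"
  then show "pullback u (\<lambda>x. c * \<phi> x) = c * pullback u \<phi>"
    using distribution_scale[OF u transpose_op_test_function[OF \<phi>]]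
      fun_subspace_scale[OF fun_subspace_test_functions \<phi>]
    unfolding pullback_def by (simp add: transpose_op_scale)
next
  fix \<phi> \<eta> assume \<phi>: "\<phi> \<in> test_functions X" and \<eta>: "\<eta> \<in> test_functions X"
  then show "pullback u (\<lambda>x. \<phi> x + \<eta> x) = pullback u \<phi> + pullback u \<eta>"
    using distribution_add[OF u transpose_op_test_function[OF \<phi>] transpose_op_test_function[OF \<eta>]]
      fun_subspace_add[OF fun_subspace_test_functions \<phi> \<eta>]
    unfolding pullback_def by (simp add: transpose_op_add)
next
  fix K assume "compact K \<and> K \<subseteq> X"
  then have K: "compact K" "K \<subseteq> X" "\<psi> ` K \<subseteq> X" using \<psi>_maps by auto
  note cK = compact_\<psi>_image[OF K(1,2)]
  obtain F C where F: "finite F" "C > 0"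
    "\<And>\<phi>. \<phi> \<in> test_functions_in (\<psi> ` K) \<Longrightarrow> cmod (u \<phi>) \<le> C * (\<Sum>is\<in>F. deriv_sup is \<phi>)"
    using distribution_dominated[OF u cK K(3)] unfolding dominated_by_deriv_sups_iff[OF cK] by blast
  have "dominated_on K (\<lambda>\<phi>. C * (\<Sum>is\<in>F. deriv_sup is (transpose_op \<phi>)))"
    using F(2) by (intro dominated_by_scale dominated_by_sum[OF seminorm_deriv_sups_in[OF K(1)]]
        transpose_op_dominated[OF K(1,2)]) auto
  then show "dominated_on K (\<lambda>\<phi>. cmod (pullback u \<phi>))"
  proof (rule dominated_by_mono)
    fix \<phi> assume \<phi>: "\<phi> \<in> test_functions_in K"
    then have "\<phi> \<in> test_functions X" using test_functions_in_subset[OF K(1,2)] by blast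
    then show "cmod (pullback u \<phi>) \<le> C * (\<Sum>is\<in>F. deriv_sup is (transpose_op \<phi>))"
      using F(3)[OF transpose_op_in[OF K(1,2) \<phi>]] unfolding pullback_def by simp
  qed
qed (simp add: pullback_def)

lemma sup_on_pullback:
  assumes "B \<subseteq> test_functions X"
  shows "sup_on B (pullback u) = sup_on (transpose_op ` B) u"
  using assms unfolding pullback_def image_image by (intro SUP_cong) auto

text \<open>Each generating seminorm is carried to another one: the supremum over \<open>B\<close> of \<open>pullback u\<close> is the
  supremum of \<open>u\<close> over the bounded set \<open>transpose_op ` B\<close>.\<close>

lemma continuous_pullback:
  "continuous_linear_operator (strong_topology X) (restrict pullback (distributions X))"
  unfolding continuous_linear_operator_def topspace_strong_topology
proof (intro conjI ballI allI)
  have dom: "dominated_by (distributions X) (strong_seminorms X) (\<lambda>u. r (restrict pullback (distributions X) u))"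
    if r: "r \<in> strong_seminorms X" for r
  proof -
    obtain B where B: "r = sup_on B" "lc_bounded (test_topology X) B" "B \<noteq> {}"
      using r unfolding strong_seminorms_def by blast
    have BX: "B \<subseteq> test_functions X" using B(2) unfolding lc_bounded_def topspace_test_topology by blast
    have "dominated_by (distributions X) (strong_seminorms X) (sup_on (transpose_op ` B))"
      using B(3) by (intro dominated_by_member strong_seminormsI transpose_op_bounded B(2)) simp
    then show ?thesis
      by (rule dominated_by_mono) (simp only: B(1) restrict_apply' sup_on_pullback[OF BX] order_refl)
  qed
  show "continuous_map (strong_topology X) (strong_topology X) (restrict pullback (distributions X))"
    unfolding strong_topology_eq
  proof (rule dominated_imp_continuous_operator[OF seminorm_strong_seminorms fun_subspace_distributions _ _ dom])
    show "restrict pullback (distributions X) u \<in> distributions X" if "u \<in> distributions X" for u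
      using that pullback_in_distributions by simp
    show "restrict pullback (distributions X) (\<lambda>x. u x - v x) =
        (\<lambda>x. restrict pullback (distributions X) u x - restrict pullback (distributions X) v x)"
      if "u \<in> distributions X" "v \<in> distributions X" for u v
      using that fun_subspace_diff[OF fun_subspace_distributions that] by (auto simp: pullback_def)
  qed
qed (auto simp: pullback_def fun_subspace_scale[OF fun_subspace_distributions] fun_subspace_add[OF fun_subspace_distributions])

lemma iterated_pullback:
  assumes "u \<in> distributions X"
  shows "(restrict pullback (distributions X) ^^ m) u \<in> distributions X"
    and "\<phi> \<in> test_functions X \<Longrightarrow> (restrict pullback (distributions X) ^^ m) u \<phi> = u ((transpose_op ^^ m) \<phi>)"
proof (induction m arbitrary: \<phi>)
  case (Suc m)
  { case 1 then show ?case using Suc pullback_in_distributions by simp }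
  { case 2 then show ?case
      using Suc(1) Suc(2)[OF transpose_op_test_function[OF 2]]
      by (simp add: pullback_def funpow_swap1) }
qed (use assms in auto)

text \<open>Substitute \<open>y = \<psi> x\<close> in \<open>\<integral> f (y) v (\<theta> y) \<phi> (\<theta> y) dy\<close>: the Jacobian factor cancels the denominator of \<open>v\<close>.\<close>

lemma pullback_distribution_of:
  assumes f: "continuous_on X f"
  shows "pullback (distribution_of X f) = distribution_of X (\<lambda>x. w x * f (\<psi> x))"
proof
  fix \<phi>
  show "pullback (distribution_of X f) \<phi> = distribution_of X (\<lambda>x. w x * f (\<psi> x)) \<phi>"
  proof (cases "\<phi> \<in> test_functions X")
    case True
    obtain K where K: "compact K" "K \<subseteq> X" "\<phi> \<in> test_functions_in K" using test_functionsE[OF True] .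
    note S = transpose_op_in[OF K]
    have cK: "compact (\<psi> ` K)" "\<psi> ` K \<subseteq> Y" using compact_\<psi>_image[OF K(1,2)] K(2) unfolding Y_def by auto
    let ?F = "\<lambda>y. f y * transpose_op \<phi> y" and ?G = "\<lambda>x. w x * f (\<psi> x) * \<phi> x"
    have fY: "continuous_on Y f" using continuous_on_subset[OF f Y_subset] .
    have F_cont: "continuous_on Y ?F"
      using fY smooth_on_continuous[OF test_functions_in_smooth[OF S], of "[]"]
      by (auto intro!: continuous_on_mult intro: continuous_on_subset)
    have G_cont: "continuous_on X ?G"
      using smooth_on_continuous[OF smooth_w, of "[]"] continuous_on_compose2[OF f continuous_\<psi> \<psi>_maps]
        smooth_on_continuous[OF test_functions_in_smooth[OF K(3)], of "[]"]
      by (auto intro!: continuous_on_mult intro: continuous_on_subset)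
    have F_int: "set_integrable lebesgue Y ?F"
      using continuous_times_test_function_integrable[OF fY cK S] .
    have G_int: "set_integrable lebesgue X ?G"
      using set_integrable_compact_support(1)[OF K(1,2) continuous_on_subset[OF G_cont K(2)]]
        test_functions_in_zero[OF K(3)] by simp
    have G_eq: "\<bar>det (matrix (\<lambda>h. J x *v h))\<bar> *\<^sub>R ?F (\<psi> x) = ?G x" if "x \<in> X" for x
    proof -
      have "transpose_op \<phi> (\<psi> x) = w x / of_real \<bar>det (J x)\<bar> * \<phi> x"
        using that \<theta>_\<psi> by (simp add: transpose_op_def Y_def weight_def)
      then show ?thesis using det_J_nz[OF that] by (simp add: scaleR_conv_of_real)
    qed
    have "(LINT y:X|lebesgue. ?F y) = (LINT y:Y|lebesgue. ?F y)"
      unfolding set_lebesgue_integral_def using Y_subset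
      by (intro Bochner_Integration.integral_cong) (auto simp: indicator_def transpose_op_def)
    also have "\<dots> = (LINT x:X|lebesgue. \<bar>det (matrix (\<lambda>h. J x *v h))\<bar> *\<^sub>R ?F (\<psi> x))"
      unfolding Y_def
    proof (rule integral_change_of_variables_complex[OF open_X \<psi>_derivative inj_\<psi>])
      show "continuous_on X (\<lambda>x. \<bar>det (matrix (\<lambda>h. J x *v h))\<bar> *\<^sub>R ?F (\<psi> x))"
        using iffD2[OF continuous_on_cong[OF refl G_eq] G_cont] .
      show "set_integrable lebesgue X (\<lambda>x. \<bar>det (matrix (\<lambda>h. J x *v h))\<bar> *\<^sub>R ?F (\<psi> x))"
        using iffD2[OF set_integrable_cong[OF refl refl G_eq] G_int] .
    qed (use F_cont F_int open_Y in \<open>simp_all add: Y_def\<close>)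
    also have "\<dots> = (LINT x:X|lebesgue. ?G x)"
      unfolding set_lebesgue_integral_def using G_eq
      by (intro Bochner_Integration.integral_cong) (auto simp: indicator_def)
    finally show ?thesis
      using True transpose_op_test_function[OF True] unfolding pullback_def distribution_of_def by simp
  qed (simp add: pullback_def distribution_of_def)
qed

end

section \<open>Identification of the operator\<close>

lemma continuous_linear_operator_diff:
  assumes T: "continuous_linear_operator (strong_topology X) T"
    and u: "u \<in> distributions X" and v: "v \<in> distributions X"
  shows "T (\<lambda>x. u x - v x) = (\<lambda>x. T u x - T v x)"
proof -
  have add: "T (\<lambda>x. a x + b x) = (\<lambda>x. T a x + T b x)" if "a \<in> distributions X" "b \<in> distributions X" for a b
    using T that unfolding continuous_linear_operator_def topspace_strong_topology by simp
  have scale: "T (\<lambda>x. c * a x) = (\<lambda>x. c * T a x)" if "a \<in> distributions X" for a c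
    using T that unfolding continuous_linear_operator_def topspace_strong_topology by simp
  show ?thesis
    using add[OF u fun_subspace_scale[OF fun_subspace_distributions v, of "-1"]] scale[OF v, of "-1"] by simp
qed

lemma continuous_linear_operator_in:
  assumes "continuous_linear_operator (strong_topology X) T" "u \<in> distributions X"
  shows "T u \<in> distributions X"
  using assms unfolding continuous_linear_operator_def continuous_map topspace_strong_topology by blast

lemma evaluation_dominated:
  assumes T: "continuous_linear_operator (strong_topology X) T" and \<phi>: "\<phi> \<in> test_functions X"
  shows "dominated_by (distributions X) (strong_seminorms X) (\<lambda>u. cmod (T u \<phi>))"
proof -
  have B: "lc_bounded (test_topology X) {\<phi>}"
    using \<phi> by (intro lc_bounded_finite) (auto simp: topspace_test_topology)
  have cont: "continuous_map (strong_topology X) (strong_topology X) T"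
    using T unfolding continuous_linear_operator_def by blast
  have "continuous_map (strong_topology X) euclideanreal (sup_on {\<phi>})"
    using continuous_sup_on[OF B] unfolding continuous_seminorm_def by simp
  then have "continuous_map (strong_topology X) euclideanreal (\<lambda>u. cmod (T u \<phi>))"
    using continuous_map_compose[OF cont, of euclideanreal "sup_on {\<phi>}"] by (simp add: comp_def)
  moreover have "seminorm_on (distributions X) (\<lambda>u. cmod (T u \<phi>))"
  proof (rule seminorm_on_cmod_linear)
    show "T (\<lambda>x. c * u x) \<phi> = c * T u \<phi>" if "u \<in> distributions X" for u c
      using T that unfolding continuous_linear_operator_def topspace_strong_topology by simp
    show "T (\<lambda>x. u x + v x) \<phi> = T u \<phi> + T v \<phi>" if "u \<in> distributions X" "v \<in> distributions X" for u v
      using T that unfolding continuous_linear_operator_def topspace_strong_topology by simp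
  qed
  ultimately have "continuous_seminorm (strong_topology X) (\<lambda>u. cmod (T u \<phi>))"
    unfolding continuous_seminorm_def topspace_strong_topology by simp
  then show ?thesis unfolding continuous_seminorm_strong_iff by simp
qed

text \<open>Evaluating at \<open>\<phi>\<close> after either operator is continuous, hence controlled by a supremum over a bounded set,
  in which \<open>u\<close> is approximated by a continuous function.\<close>

lemma continuous_operators_agree:
  assumes X: "open X" and S: "continuous_linear_operator (strong_topology X) S"
    and T: "continuous_linear_operator (strong_topology X) T"
    and agree: "\<And>f. continuous_on X f \<Longrightarrow> S (distribution_of X f) = T (distribution_of X f)"
    and u: "u \<in> distributions X"
  shows "S u = T u"
proof
  fix \<phi>
  show "S u \<phi> = T u \<phi>"
  proof (cases "\<phi> \<in> test_functions X")
    case False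
    then show ?thesis
      using distribution_outside[OF continuous_linear_operator_in[OF S u]]
        distribution_outside[OF continuous_linear_operator_in[OF T u]] by simp
  next
    case True
    have dom: "dominated_by (distributions X) (strong_seminorms X) (\<lambda>u. cmod (S u \<phi>) + cmod (T u \<phi>))"
      by (rule dominated_by_add[OF seminorm_strong_seminorms evaluation_dominated[OF S True] evaluation_dominated[OF T True]])
    obtain B C where B: "lc_bounded (test_topology X) B" "B \<noteq> {}" "C > 0"
      "\<And>v. v \<in> distributions X \<Longrightarrow> cmod (S v \<phi>) + cmod (T v \<phi>) \<le> C * sup_on B v"
      using strong_seminorm_bound[OF dom] by blast
    have "cmod (S u \<phi> - T u \<phi>) \<le> e" if e: "e > 0" for e
    proof -
      have "e / C > 0" using e B(3) by simp
      then obtain g where g: "continuous_on X g" "\<And>\<phi>. \<phi> \<in> B \<Longrightarrow> cmod (u \<phi> - distribution_of X g \<phi>) \<le> e / C"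
        using continuous_functions_strongly_dense[OF X u B(1)] by blast
      let ?g = "distribution_of X g"
      have gd: "?g \<in> distributions X" by (rule distribution_of_in_distributions[OF g(1)])
      let ?v = "\<lambda>x. u x - ?g x"
      have v: "?v \<in> distributions X" by (rule fun_subspace_diff[OF fun_subspace_distributions u gd])
      have "S u \<phi> - T u \<phi> = S ?v \<phi> - T ?v \<phi>"
        using continuous_linear_operator_diff[OF S u gd] continuous_linear_operator_diff[OF T u gd]
          agree[OF g(1)] by simp
      then have "cmod (S u \<phi> - T u \<phi>) \<le> cmod (S ?v \<phi>) + cmod (T ?v \<phi>)"
        using norm_triangle_ineq4 by metis
      also have "\<dots> \<le> C * sup_on B ?v" by (rule B(4)[OF v])
      also have "\<dots> \<le> C * (e / C)"
        using B(2,3) g(2) by (intro mult_left_mono cSUP_least) auto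
      also have "\<dots> = e" using B(3) by simp
      finally show ?thesis .
    qed
    then have "cmod (S u \<phi> - T u \<phi>) \<le> 0" by (rule field_le_epsilon[of _ 0, simplified])
    then show ?thesis by simp
  qed
qed

context weighted_composition
begin

lemma weighted_composition_operator_eq:
  "weighted_composition_operator X w \<psi> = restrict pullback (distributions X)"
  unfolding weighted_composition_operator_def
proof (rule the_equality)
  let ?T = "restrict pullback (distributions X)"
  have T_f: "?T (distribution_of X f) = distribution_of X (\<lambda>x. w x * f (\<psi> x))" if "continuous_on X f" for f
    using pullback_distribution_of[OF that] distribution_of_in_distributions[OF that] by simp
  then show "?T \<in> extensional (distributions X) \<and> continuous_linear_operator (strong_topology X) ?T \<and>
      (\<forall>f. continuous_on X f \<longrightarrow> ?T (distribution_of X f) = distribution_of X (\<lambda>x. w x * f (\<psi> x)))"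
    using continuous_pullback by auto
  fix S
  assume S: "S \<in> extensional (distributions X) \<and> continuous_linear_operator (strong_topology X) S \<and>
      (\<forall>f. continuous_on X f \<longrightarrow> S (distribution_of X f) = distribution_of X (\<lambda>x. w x * f (\<psi> x)))"
  show "S = ?T"
  proof (rule extensionalityI[of _ "distributions X"])
    show "S u = ?T u" if "u \<in> distributions X" for u
      using continuous_operators_agree[OF open_X _ continuous_pullback _ that, of S] S T_f by simp
  qed (use S in auto)
qed

end

section \<open>Stable orbits imply topologizability\<close>

text \<open>Mackey's countability condition for the metrizable space of test functions on \<open>L\<close>. The \<open>m\<close>-th
  factor controls the derivatives of order at most \<open>m\<close>, so for each derivative all but finitely many of
  the rescaled sets are bounded by one.\<close>

lemma countably_many_bounded_sets_absorbed:
  fixes A :: "nat \<Rightarrow> (real^'n \<Rightarrow> complex) set"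
  assumes X: "open X" and L: "compact L" "L \<subseteq> X"
    and A: "\<And>m. A m \<subseteq> test_functions_in L" "\<And>m. lc_bounded (test_topology X) (A m)"
  shows "\<exists>B \<gamma>. lc_bounded (test_topology X) B \<and> (\<forall>m. \<gamma> m > 0) \<and>
    (\<forall>m. \<forall>\<phi>\<in>A m. (\<lambda>x. of_real (inverse (\<gamma> m)) * \<phi> x) \<in> B)"
proof -
  have "\<forall>m is. \<exists>M. \<forall>\<phi>\<in>A m. deriv_sup is \<phi> \<le> M"
    using A(2) unfolding lc_bounded_test_topology_iff[OF X] bdd_above_def by blast
  then obtain M where M: "\<And>m is \<phi>. \<phi> \<in> A m \<Longrightarrow> deriv_sup is \<phi> \<le> M m is" by metis
  define \<gamma> where "\<gamma> m = 1 + (\<Sum>is\<in>{is :: 'n list. length is \<le> m}. \<bar>M m is\<bar>)" for m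
  have \<gamma>: "\<gamma> m \<ge> 1" for m unfolding \<gamma>_def by (simp add: sum_nonneg)
  have \<gamma>_ge: "\<bar>M m is\<bar> \<le> \<gamma> m" if "length is \<le> m" for m "is"
  proof -
    have "finite {is :: 'n list. length is \<le> m}"
      using finite_lists_length_le[of "UNIV :: 'n set" m] by simp
    then have "\<bar>M m is\<bar> \<le> (\<Sum>is\<in>{is :: 'n list. length is \<le> m}. \<bar>M m is\<bar>)"
      using that by (intro member_le_sum) auto
    then show ?thesis unfolding \<gamma>_def by linarith
  qed
  define B where "B = (\<Union>m. (\<lambda>\<phi> x. of_real (inverse (\<gamma> m)) * \<phi> x) ` A m)"
  have "B \<subseteq> test_functions_in L"
    unfolding B_def using A(1) fun_subspace_scale[OF fun_subspace_test_functions_in] by blast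
  moreover have "bdd_above (deriv_sup is ` B)" for "is"
  proof -
    have "deriv_sup is \<eta> \<le> 1 + (\<Sum>m<length is. \<bar>M m is\<bar>)" if \<eta>: "\<eta> \<in> B" for \<eta>
    proof -
      obtain m \<phi> where \<phi>: "\<phi> \<in> A m" "\<eta> = (\<lambda>x. of_real (inverse (\<gamma> m)) * \<phi> x)"
        using \<eta> unfolding B_def by blast
      have \<phi>X: "\<phi> \<in> test_functions X" using \<phi>(1) A(1) test_functions_in_subset[OF L] by blast
      have "deriv_sup is \<eta> = cmod (of_real (inverse (\<gamma> m))) * deriv_sup is \<phi>"
        unfolding \<phi>(2) by (rule seminorm_scale[OF seminorm_deriv_sup \<phi>X])
      also have "\<dots> = inverse (\<gamma> m) * deriv_sup is \<phi>" using \<gamma>[of m] by (simp only: norm_of_real) simp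
      also have "\<dots> \<le> inverse (\<gamma> m) * \<bar>M m is\<bar>"
        using \<gamma>[of m] M[OF \<phi>(1), of "is"] by (intro mult_left_mono) auto
      finally have le: "deriv_sup is \<eta> \<le> inverse (\<gamma> m) * \<bar>M m is\<bar>" .
      have nn: "0 \<le> (\<Sum>m<length is. \<bar>M m is\<bar>)" by (intro sum_nonneg) auto
      show ?thesis
      proof (cases "length is \<le> m")
        case True
        have "inverse (\<gamma> m) * \<bar>M m is\<bar> \<le> inverse (\<gamma> m) * \<gamma> m"
          using \<gamma>[of m] \<gamma>_ge[OF True] by (intro mult_left_mono) auto
        also have "\<dots> = 1" using \<gamma>[of m] by simp
        finally show ?thesis using le nn by linarith
      next
        case False
        have "inverse (\<gamma> m) \<le> 1" using \<gamma>[of m] by (simp add: inverse_le_1_iff)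
        then have "inverse (\<gamma> m) * \<bar>M m is\<bar> \<le> 1 * \<bar>M m is\<bar>" by (intro mult_right_mono) auto
        moreover have "\<bar>M m is\<bar> \<le> (\<Sum>m<length is. \<bar>M m is\<bar>)"
          using False by (intro member_le_sum[of m "{..<length is}" "\<lambda>m. \<bar>M m is\<bar>"]) auto
        ultimately show ?thesis using le by linarith
      qed
    qed
    then show ?thesis by (intro bdd_aboveI2)
  qed
  ultimately have "lc_bounded (test_topology X) B"
    unfolding lc_bounded_test_topology_iff[OF X] using L by blast
  then show ?thesis
  proof (intro exI[of _ B] exI[of _ \<gamma>] conjI allI ballI)
    show "\<gamma> m > 0" for m using \<gamma>[of m] by linarith
    show "(\<lambda>x. of_real (inverse (\<gamma> m)) * \<phi> x) \<in> B" if "\<phi> \<in> A m" for m \<phi>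
      unfolding B_def using that by blast
  qed
qed

context weighted_composition
begin

lemma iterate_maps: "x \<in> X \<Longrightarrow> (\<psi> ^^ m) x \<in> X"
  using \<psi>_maps by (induction m) auto

lemma iterate_continuous: "continuous_on X (\<psi> ^^ m)"
proof (induction m)
  case (Suc m)
  have "(\<psi> ^^ m) ` X \<subseteq> X" using iterate_maps by blast
  then show ?case
    using continuous_on_compose[OF Suc continuous_on_subset[OF continuous_\<psi>]] by simp
qed (simp add: continuous_on_id)

lemma iterate_inj: "inj_on (\<psi> ^^ m) X"
proof (induction m)
  case (Suc m)
  have "inj_on \<psi> ((\<psi> ^^ m) ` X)" using inj_on_subset[OF inj_\<psi>] iterate_maps by blast
  then show ?case using comp_inj_on[OF Suc] by (simp add: comp_def)
qed simp

lemma iterated_transpose_support: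
  assumes K: "compact K" "K \<subseteq> X" and \<phi>: "\<phi> \<in> test_functions_in K"
  shows "(transpose_op ^^ m) \<phi> \<in> test_functions_in ((\<psi> ^^ m) ` K)"
proof (induction m)
  case (Suc m)
  have "compact ((\<psi> ^^ m) ` K)"
    using compact_continuous_image[OF continuous_on_subset[OF iterate_continuous K(2)] K(1)] .
  moreover have "(\<psi> ^^ m) ` K \<subseteq> X" using K(2) iterate_maps by blast
  ultimately show ?case using transpose_op_in[OF _ _ Suc] by (simp add: image_image)
qed (use \<phi> in simp)

lemma iterated_transpose_bounded:
  assumes "lc_bounded (test_topology X) B"
  shows "lc_bounded (test_topology X) ((transpose_op ^^ m) ` B)"
proof (induction m)
  case (Suc m)
  then show ?case using transpose_op_bounded[OF Suc] by (simp add: image_image)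
qed (use assms in simp)

lemma topologizable_of_stable_orbits:
  assumes stable: "stable_orbits X \<psi>"
  shows "topologizable (strong_topology X) (restrict pullback (distributions X))"
  unfolding topologizable_def topspace_strong_topology
proof (intro conjI allI impI continuous_pullback)
  let ?T = "restrict pullback (distributions X)"
  fix p assume "continuous_seminorm (strong_topology X) p"
  then have dom: "dominated_by (distributions X) (strong_seminorms X) p"
    unfolding continuous_seminorm_strong_iff by blast
  obtain B C where B: "lc_bounded (test_topology X) B" "B \<noteq> {}" "C > 0"
    "\<And>u. u \<in> distributions X \<Longrightarrow> p u \<le> C * sup_on B u"
    using strong_seminorm_bound[OF dom] by blast
  obtain K where K: "compact K" "K \<subseteq> X" "B \<subseteq> test_functions_in K"
    using bounded_test_functions_common_support[OF open_X B(1)] .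
  have "\<exists>L. compact L \<and> L \<subseteq> X \<and> (\<forall>m\<ge>1. (\<psi> ^^ m) ` K \<subseteq> L)"
    using stable K(1,2) unfolding stable_orbits_def by simp
  then obtain L where L: "compact L" "L \<subseteq> X" "\<And>m. m \<ge> 1 \<Longrightarrow> (\<psi> ^^ m) ` K \<subseteq> L"
    by blast
  \<comment> \<open>Only powers from the first on are confined to \<open>L\<close>, whence the shift of the index.\<close>
  define A where "A m = (transpose_op ^^ Suc m) ` B" for m
  have A_in: "A m \<subseteq> test_functions_in L" for m
  proof -
    have "(\<psi> ^^ Suc m) ` K \<subseteq> L" by (rule L(3)) simp
    then show ?thesis
      unfolding A_def using iterated_transpose_support[OF K(1,2), of _ "Suc m"] K(3)
        test_functions_in_mono[of "(\<psi> ^^ Suc m) ` K" L] by blast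
  qed
  have A_bounded: "lc_bounded (test_topology X) (A m)" for m
    unfolding A_def by (rule iterated_transpose_bounded[OF B(1)])
  obtain B' and \<gamma> :: "nat \<Rightarrow> real" where absorbed: "lc_bounded (test_topology X) B'" "\<forall>m. \<gamma> m > 0"
    "\<forall>m. \<forall>\<phi>\<in>A m. (\<lambda>x. of_real (inverse (\<gamma> m)) * \<phi> x) \<in> B'"
    using countably_many_bounded_sets_absorbed[of X L A, OF open_X L(1,2) A_in A_bounded]
    by (elim exE conjE) (rule that)
  have B': "lc_bounded (test_topology X) B'" "\<And>m. \<gamma> m > 0"
    "\<And>m \<phi>. \<phi> \<in> A m \<Longrightarrow> (\<lambda>x. of_real (inverse (\<gamma> m)) * \<phi> x) \<in> B'"
    using absorbed by simp_all
  obtain \<phi>0 where "\<phi>0 \<in> B" using B(2) by blast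
  then have ne: "B' \<noteq> {}" using B'(3)[of _ 0] unfolding A_def by blast
  have BX: "B \<subseteq> test_functions X" using K(3) test_functions_in_subset[OF K(1,2)] by blast
  show "\<exists>q. continuous_seminorm (strong_topology X) q \<and>
      (\<forall>m\<ge>1. \<exists>\<gamma>>0. \<forall>u\<in>distributions X. p ((?T ^^ m) u) \<le> \<gamma> * q u)"
  proof (intro exI[of _ "sup_on B'"] conjI allI impI)
    show "continuous_seminorm (strong_topology X) (sup_on B')" by (rule continuous_sup_on[OF B'(1) ne])
    fix m :: nat assume "1 \<le> m"
    then obtain k where m: "m = Suc k" by (cases m) auto
    have "p ((?T ^^ m) u) \<le> C * \<gamma> k * sup_on B' u" if u: "u \<in> distributions X" for u
    proof -
      have Tu: "(?T ^^ m) u \<in> distributions X" by (rule iterated_pullback(1)[OF u])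
      have "sup_on B ((?T ^^ m) u) \<le> \<gamma> k * sup_on B' u"
      proof (rule cSUP_least[OF B(2)])
        fix \<phi> assume \<phi>: "\<phi> \<in> B"
        let ?\<phi> = "(transpose_op ^^ m) \<phi>"
        have A\<phi>: "?\<phi> \<in> A k" unfolding A_def m using \<phi> by blast
        then have X\<phi>: "?\<phi> \<in> test_functions X" using A_in test_functions_in_subset[OF L(1,2)] by blast
        have "cmod ((?T ^^ m) u \<phi>) = cmod (u ?\<phi>)"
          using iterated_pullback(2)[OF u] \<phi> BX by (simp add: subset_eq)
        also have "\<dots> = \<gamma> k * cmod (u (\<lambda>x. of_real (inverse (\<gamma> k)) * ?\<phi> x))"
          unfolding distribution_scale[OF u X\<phi>] norm_mult norm_of_real using B'(2)[of k] by simp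
        also have "\<dots> \<le> \<gamma> k * sup_on B' u"
          using B'(2)[of k] by (intro mult_left_mono distribution_le_sup_on[OF u B'(1) B'(3)[OF A\<phi>]]) auto
        finally show "cmod ((?T ^^ m) u \<phi>) \<le> \<gamma> k * sup_on B' u" .
      qed
      then have "C * sup_on B ((?T ^^ m) u) \<le> C * (\<gamma> k * sup_on B' u)"
        using B(3) by (intro mult_left_mono) auto
      then show ?thesis using B(4)[OF Tu] by (simp add: mult.assoc)
    qed
    moreover have "C * \<gamma> k > 0" using B(3) B'(2) by simp
    ultimately show "\<exists>\<gamma>>0. \<forall>u\<in>distributions X. p ((?T ^^ m) u) \<le> \<gamma> * sup_on B' u" by blast
  qed
qed

end

section \<open>Topologizability implies stable orbits\<close>

context weighted_composition
begin

lemma transpose_op_along_orbit: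
  assumes "x \<in> X"
  shows "(transpose_op ^^ m) \<phi> ((\<psi> ^^ m) x) = (\<Prod>i<m. weight ((\<psi> ^^ i) x)) * \<phi> x"
proof (induction m)
  case (Suc m)
  have "(\<psi> ^^ m) x \<in> X" by (rule iterate_maps[OF assms])
  then have "transpose_op ((transpose_op ^^ m) \<phi>) (\<psi> ((\<psi> ^^ m) x)) =
      weight ((\<psi> ^^ m) x) * (transpose_op ^^ m) \<phi> ((\<psi> ^^ m) x)"
    by (simp add: transpose_op_def Y_def \<theta>_\<psi>)
  then show ?case using Suc by (simp add: mult_ac)
qed simp

lemma weight_nonzero: "x \<in> X \<Longrightarrow> w x \<noteq> 0 \<Longrightarrow> weight x \<noteq> 0"
  using det_J_nz by (simp add: weight_def)

text \<open>The iterates of \<open>\<psi>\<close> are open maps, so the points whose first \<open>m\<close> iterates avoid the zeros of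
  \<open>w\<close> form a dense open set.\<close>

lemma nonvanishing_along_orbit_dense:
  assumes dense: "X \<subseteq> closure {x \<in> X. w x \<noteq> 0}"
  shows "open {x \<in> X. \<forall>i<m. w ((\<psi> ^^ i) x) \<noteq> 0} \<and>
    (\<forall>U. open U \<and> U \<subseteq> X \<and> U \<noteq> {} \<longrightarrow> (\<exists>x\<in>U. \<forall>i<m. w ((\<psi> ^^ i) x) \<noteq> 0))"
proof (induction m)
  case 0
  then show ?case using open_X by auto
next
  case (Suc m)
  let ?W = "\<lambda>m. {x \<in> X. \<forall>i<m. w ((\<psi> ^^ i) x) \<noteq> 0}"
  have "continuous_on X (\<lambda>x. w ((\<psi> ^^ m) x))"
    using smooth_on_continuous[OF smooth_w, of "[]"] iterate_continuous[of m] iterate_maps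
    by (intro continuous_on_compose2[of X w X "\<psi> ^^ m"]) auto
  then have "open (X \<inter> (\<lambda>x. w ((\<psi> ^^ m) x)) -` (- {0}))"
    using open_X by (intro continuous_open_preimage) auto
  moreover have "?W (Suc m) = ?W m \<inter> (X \<inter> (\<lambda>x. w ((\<psi> ^^ m) x)) -` (- {0}))"
    by (auto simp: less_Suc_eq)
  ultimately have "open (?W (Suc m))" using Suc by auto
  moreover have "\<exists>x\<in>U. \<forall>i<Suc m. w ((\<psi> ^^ i) x) \<noteq> 0" if U: "open U" "U \<subseteq> X" "U \<noteq> {}" for U
  proof -
    let ?U = "U \<inter> ?W m"
    obtain x where "x \<in> U" "\<forall>i<m. w ((\<psi> ^^ i) x) \<noteq> 0" using Suc U by blast
    then have "x \<in> ?U" using U(2) by blast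
    then have U': "open ?U" "?U \<subseteq> X" "?U \<noteq> {}" using Suc U(1) by auto
    have "open ((\<psi> ^^ m) ` ?U)"
      using continuous_on_subset[OF iterate_continuous U'(2)] inj_on_subset[OF iterate_inj U'(2)] U'(1)
      by (intro invariance_of_domain)
    moreover have "(\<psi> ^^ m) ` ?U \<subseteq> X" using U'(2) iterate_maps by blast
    ultimately have "(\<psi> ^^ m) ` ?U \<inter> {x \<in> X. w x \<noteq> 0} \<noteq> {}"
      using open_Int_closure_eq_empty[of "(\<psi> ^^ m) ` ?U" "{x \<in> X. w x \<noteq> 0}"] dense U'(3) by blast
    then obtain x where "x \<in> U" "x \<in> ?W m" "w ((\<psi> ^^ m) x) \<noteq> 0" by blast
    then show ?thesis by (auto simp: less_Suc_eq)
  qed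
  ultimately show ?case by blast
qed

text \<open>The bump function detects where \<open>\<psi>\<^sup>m\<close> maps its ball: a point of the ball that leaves \<open>L\<close> would have
  nearby points that leave \<open>L\<close> and at which no weight along the orbit vanishes.\<close>

lemma local_orbits_in_compact:
  assumes dense: "X \<subseteq> closure {x \<in> X. w x \<noteq> 0}"
    and top: "topologizable (strong_topology X) (restrict pullback (distributions X))"
    and a: "a \<in> X"
  obtains r L where "r > 0" "compact L" "L \<subseteq> X" "\<And>m. m \<ge> 1 \<Longrightarrow> (\<psi> ^^ m) ` ball a r \<subseteq> L"
proof -
  let ?T = "restrict pullback (distributions X)"
  obtain r where r: "r > 0" "cball a r \<subseteq> X" using open_X a open_contains_cball by blast
  obtain b :: "real^'n \<Rightarrow> real" where b: "smooth_on UNIV b" "\<And>x. b x \<ge> 0" "\<And>x. b x > 0 \<longleftrightarrow> x \<in> ball a r"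
    using bump_function_exists[OF r(1), of a] by blast
  define \<phi> where "\<phi> x = complex_of_real (b x)" for x
  have \<phi>_nz: "\<phi> x \<noteq> 0 \<longleftrightarrow> x \<in> ball a r" for x
    unfolding \<phi>_def using b(2,3)[of x] by auto
  have "\<phi> x = 0" if "x \<notin> cball a r" for x using \<phi>_nz[of x] that by auto
  moreover have "smooth_on UNIV \<phi>" unfolding \<phi>_def by (rule smooth_on_of_real[OF open_UNIV b(1)])
  ultimately have "\<phi> \<in> test_functions_in (cball a r)" unfolding test_functions_in_def by blast
  then have \<phi>: "\<phi> \<in> test_functions X" using test_functions_in_subset[OF compact_cball r(2)] by blast
  have "lc_bounded (test_topology X) {\<phi>}"
    using \<phi> by (intro lc_bounded_finite) (auto simp: topspace_test_topology)
  then have "continuous_seminorm (strong_topology X) (sup_on {\<phi>})" by (intro continuous_sup_on) auto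
  then obtain q where q: "continuous_seminorm (strong_topology X) q"
    "\<And>m. m \<ge> 1 \<Longrightarrow> \<exists>\<gamma>>0. \<forall>u\<in>distributions X. sup_on {\<phi>} ((?T ^^ m) u) \<le> \<gamma> * q u"
    using top unfolding topologizable_def topspace_strong_topology by blast
  have dom: "dominated_by (distributions X) (strong_seminorms X) q"
    using q(1) unfolding continuous_seminorm_strong_iff by blast
  obtain B C where B: "lc_bounded (test_topology X) B" "B \<noteq> {}" "C > 0"
    "\<And>u. u \<in> distributions X \<Longrightarrow> q u \<le> C * sup_on B u"
    using strong_seminorm_bound[OF dom] by blast
  obtain L where L: "compact L" "L \<subseteq> X" "B \<subseteq> test_functions_in L"
    using bounded_test_functions_common_support[OF open_X B(1)] .
  \<comment> \<open>Point evaluations outside \<open>L\<close> vanish on \<open>B\<close>, hence on the iterated transposes of \<open>\<phi>\<close>.\<close>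
  have vanish: "(transpose_op ^^ m) \<phi> y = 0" if m: "m \<ge> 1" and y: "y \<in> X" "y \<notin> L" for m y
  proof -
    define \<delta> where "\<delta> \<phi> = (if \<phi> \<in> test_functions X then \<phi> y else 0)" for \<phi> :: "real^'n \<Rightarrow> complex"
    have \<delta>: "\<delta> \<in> distributions X" unfolding \<delta>_def by (rule delta_distribution[OF y(1)])
    have "\<delta> \<eta> = 0" if "\<eta> \<in> B" for \<eta>
      using that L(3) test_functions_in_zero[of \<eta> L y] y(2) unfolding \<delta>_def by auto
    then have "sup_on B \<delta> = 0" using B(2) by simp
    then have "q \<delta> \<le> 0" using B(4)[OF \<delta>] by simp
    moreover obtain \<gamma> where "\<gamma> > 0" "sup_on {\<phi>} ((?T ^^ m) \<delta>) \<le> \<gamma> * q \<delta>" using q(2)[OF m] \<delta> by blast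
    ultimately have "sup_on {\<phi>} ((?T ^^ m) \<delta>) \<le> 0" by (meson less_imp_le mult_nonneg_nonpos order_trans)
    then have "(?T ^^ m) \<delta> \<phi> = 0" by simp
    then have "\<delta> ((transpose_op ^^ m) \<phi>) = 0" using iterated_pullback(2)[OF \<delta> \<phi>] by simp
    moreover have "(transpose_op ^^ m) \<phi> \<in> test_functions X"
      using \<phi> transpose_op_test_function by (induction m) auto
    ultimately show ?thesis unfolding \<delta>_def by simp
  qed
  have "(\<psi> ^^ m) ` ball a r \<subseteq> L" if m: "m \<ge> 1" for m
  proof (rule ccontr)
    assume "\<not> (\<psi> ^^ m) ` ball a r \<subseteq> L"
    then obtain x where x: "x \<in> ball a r" "(\<psi> ^^ m) x \<notin> L" by blast
    let ?U = "ball a r \<inter> (X \<inter> (\<psi> ^^ m) -` (- L))"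
    have "open (X \<inter> (\<psi> ^^ m) -` (- L))"
      using iterate_continuous open_X compact_imp_closed[OF L(1)] by (intro continuous_open_preimage) auto
    then have "open ?U" by auto
    moreover have "x \<in> ?U" using x r(2) ball_subset_cball by fastforce
    ultimately obtain z where z: "z \<in> ?U" "\<forall>i<m. w ((\<psi> ^^ i) z) \<noteq> 0"
      using nonvanishing_along_orbit_dense[OF dense, of m] by blast
    have zX: "z \<in> X" using z by blast
    have "(transpose_op ^^ m) \<phi> ((\<psi> ^^ m) z) = 0"
      using z(1) by (intro vanish[OF m iterate_maps[OF zX]]) auto
    moreover have "(\<Prod>i<m. weight ((\<psi> ^^ i) z)) \<noteq> 0"
      using z(2) weight_nonzero iterate_maps[OF zX] by simp
    moreover have "\<phi> z \<noteq> 0" using z(1) \<phi>_nz by blast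
    ultimately show False using transpose_op_along_orbit[OF zX, of m \<phi>] by simp
  qed
  then show ?thesis using that r(1) L(1,2) by blast
qed

lemma stable_orbits_of_topologizable:
  assumes dense: "X \<subseteq> closure {x \<in> X. w x \<noteq> 0}"
    and top: "topologizable (strong_topology X) (restrict pullback (distributions X))"
  shows "stable_orbits X \<psi>"
  unfolding stable_orbits_def
proof (intro allI impI)
  fix K assume K: "compact K \<and> K \<subseteq> X"
  have "\<forall>a\<in>X. \<exists>r L. r > 0 \<and> compact L \<and> L \<subseteq> X \<and> (\<forall>m\<ge>1. (\<psi> ^^ m) ` ball a r \<subseteq> L)"
    using local_orbits_in_compact[OF dense top] by metis
  then obtain r L where rL: "\<And>a. a \<in> X \<Longrightarrow> r a > 0" "\<And>a. a \<in> X \<Longrightarrow> compact (L a)"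
    "\<And>a. a \<in> X \<Longrightarrow> L a \<subseteq> X" "\<And>a m. a \<in> X \<Longrightarrow> m \<ge> 1 \<Longrightarrow> (\<psi> ^^ m) ` ball a (r a) \<subseteq> L a"
    by metis
  have cover: "K \<subseteq> (\<Union>a\<in>K. ball a (r a))" using K rL(1) by fastforce
  obtain Z where Z: "Z \<subseteq> K" "finite Z" "K \<subseteq> (\<Union>a\<in>Z. ball a (r a))"
    by (rule compactE_image[OF _ _ cover]) (use K in auto)
  have ZX: "Z \<subseteq> X" using Z(1) K by blast
  show "\<exists>L. compact L \<and> L \<subseteq> X \<and> (\<forall>m\<ge>1. (\<psi> ^^ m) ` K \<subseteq> L)"
  proof (intro exI[of _ "\<Union>a\<in>Z. L a"] conjI allI impI)
    show "compact (\<Union>a\<in>Z. L a)" using Z(2) ZX rL(2) by (intro compact_UN) auto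
    show "(\<Union>a\<in>Z. L a) \<subseteq> X" using ZX rL(3) by blast
    show "(\<psi> ^^ m) ` K \<subseteq> (\<Union>a\<in>Z. L a)" if "m \<ge> 1" for m
      using Z(3) ZX rL(4)[OF _ that] by blast
  qed
qed

end

theorem corollary2p10:
  fixes X :: "(real^'n) set"
    and w :: "real^'n \<Rightarrow> complex"
    and \<psi> :: "real^'n \<Rightarrow> real^'n"
  assumes "open X"
    and "smooth_on X w"
    and "smooth_on X \<psi>"
    and "\<psi> ` X \<subseteq> X"
    and "inj_on \<psi> X"
    and "\<forall>x\<in>X. det (jacobian \<psi> (at x)) \<noteq> 0"
    and "X \<subseteq> closure {x \<in> X. w x \<noteq> 0}"
  shows "topologizable (strong_topology X) (weighted_composition_operator X w \<psi>)
         \<longleftrightarrow> stable_orbits X \<psi>"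
proof -
  interpret weighted_composition X w \<psi>
    using assms by unfold_locales auto
  show ?thesis
    unfolding weighted_composition_operator_eq
    using topologizable_of_stable_orbits stable_orbits_of_topologizable[OF assms(7)] by blast
qed

end
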